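(* Let $\Gamma$ be the $1$-skeleton of the $600$-cell. Then $\Gamma$ has a legal system. Consequently the group $G\cong G(\Gamma)$ generated by the reflections of $\mathbb{H}^4$ in the $3$-dimensional faces of the (compact) right-angled hyperbolic $120$-cell virtually algebraically fibers.
   Context: Let $\Gamma=\Gamma(V,E)$ be a simplicial graph. A state is a subset $S\subset V$; it is legal if the subgraphs of $\Gamma$ induced by $S$ and by $V-S$ are both nonempty and connected. A move at $v\in V$ is a subset $m_v\subset V$ with $v\in m_v$ and $u\notin m_v$ whenever $\{u,v\}\in E$. A system of moves is a choice of a move $m_v$ for each $v\in V$ (the $m_v$ need not be distinct). Identify $2^V$ with the group $\mathbb{Z}_2^V$ (multiplication is symmetric difference), and let $M\le\mathbb{Z}_2^V$ be the subgroup generated by the moves; $M$ acts on the set of states by symmetric difference. The system is legal if there is an $M$-orbit all of whose elements are legal states; $\Gamma$ has a legal system if some system of moves for $\Gamma$ is legal. $G(\Gamma)$ is the right-angled Coxeter group with generators $v\in V$ and relations $v^2=1$ for $v\in V$ and $uv=vu$ for $\{u,v\}\in E$. A group $G$ virtually algebraically fibers if there is a finite index subgroup $G'$ admitting an epimorphism $G'\to\mathbb{Z}$ with finitely generated kernel. The $600$-cell is the convex regular $4$-polytope dual to the $120$-cell; its boundary is a flag complex composed of $600$ tetrahedra in which the link of each vertex is an icosahedron, and its $1$-skeleton has $120$ vertices and $720$ edges. Since it is dual to the $120$-cell, the reflection group of the right-angled hyperbolic $120$-cell is the right-angled Coxeter group $G(\Gamma)$. *)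

theory Defs
  imports
    "HOL-Analysis.Analysis"
    "HOL-Combinatorics.Permutations"
    "HOL-Algebra.Elementary_Groups"
    "HOL-Algebra.Group_Action"
    "HOL-Algebra.Bij"
begin

section \<open>Legal systems of moves\<close>

text \<open>A graph is given by its vertex set \<open>V\<close> and a set \<open>E\<close> of edges, each edge
  being a two-element set \<open>{u, v}\<close>.\<close>

definition simplicial_graph :: "'a set \<Rightarrow> 'a set set \<Rightarrow> bool" where
  "simplicial_graph V E \<longleftrightarrow> (\<forall>e\<in>E. \<exists>u\<in>V. \<exists>v\<in>V. u \<noteq> v \<and> e = {u, v})"

definition induced_connected :: "'a set set \<Rightarrow> 'a set \<Rightarrow> bool" where
  "induced_connected E S \<longleftrightarrow>
     (\<forall>u\<in>S. \<forall>v\<in>S. (u, v) \<in> {(x, y). x \<in> S \<and> y \<in> S \<and> {x, y} \<in> E}\<^sup>*)"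

definition legal_state :: "'a set \<Rightarrow> 'a set set \<Rightarrow> 'a set \<Rightarrow> bool" where
  "legal_state V E S \<longleftrightarrow> S \<subseteq> V \<and>
     S \<noteq> {} \<and> induced_connected E S \<and>
     V - S \<noteq> {} \<and> induced_connected E (V - S)"

definition move_at :: "'a set \<Rightarrow> 'a set set \<Rightarrow> 'a \<Rightarrow> 'a set \<Rightarrow> bool" where
  "move_at V E v A \<longleftrightarrow> A \<subseteq> V \<and> v \<in> A \<and> (\<forall>u. {u, v} \<in> E \<longrightarrow> u \<notin> A)"

definition system_of_moves :: "'a set \<Rightarrow> 'a set set \<Rightarrow> ('a \<Rightarrow> 'a set) \<Rightarrow> bool" where
  "system_of_moves V E m \<longleftrightarrow> (\<forall>v\<in>V. move_at V E v (m v))"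

text \<open>The power set \<open>2\<^sup>V\<close> as the elementary abelian group \<open>\<int>\<^sub>2\<^sup>V\<close>.\<close>

definition Z2_power :: "'a set \<Rightarrow> 'a set monoid" where
  "Z2_power V = \<lparr>carrier = Pow V, monoid.mult = (\<lambda>A B. sym_diff A B), one = {}\<rparr>"

definition moves_group :: "'a set \<Rightarrow> ('a \<Rightarrow> 'a set) \<Rightarrow> 'a set monoid" where
  "moves_group V m = (Z2_power V)\<lparr>carrier := generate (Z2_power V) (m ` V)\<rparr>"

definition legal_system :: "'a set \<Rightarrow> 'a set set \<Rightarrow> ('a \<Rightarrow> 'a set) \<Rightarrow> bool" where
  "legal_system V E m \<longleftrightarrow> system_of_moves V E m \<and>
     (\<exists>S. S \<subseteq> V \<and>
        (\<forall>T \<in> orbit (moves_group V m) (\<lambda>A S. sym_diff A S) S. legal_state V E T))"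

definition has_legal_system :: "'a set \<Rightarrow> 'a set set \<Rightarrow> bool" where
  "has_legal_system V E \<longleftrightarrow> (\<exists>m. legal_system V E m)"

lemma comm_group_Z2_power: "comm_group (Z2_power V)"
proof (rule comm_groupI)
  fix A assume "A \<in> carrier (Z2_power V)"
  then show "\<exists>B\<in>carrier (Z2_power V). B \<otimes>\<^bsub>Z2_power V\<^esub> A = \<one>\<^bsub>Z2_power V\<^esub>"
    by (auto simp: Z2_power_def)
qed (auto simp: Z2_power_def)


section \<open>Groups given by generators and relations\<close>

text \<open>Words are lists of signed letters, \<open>(x, True)\<close> standing for the generator \<open>x\<close>
  and \<open>(x, False)\<close> for its inverse.  A relation is a pair of words.\<close>

type_synonym 'a word = "('a \<times> bool) list"

inductive_set presentation_rel :: "'a set \<Rightarrow> ('a word \<times> 'a word) set \<Rightarrow> ('a word \<times> 'a word) set"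
  for X :: "'a set" and R :: "('a word \<times> 'a word) set" where
  refl: "w \<in> lists (X \<times> UNIV) \<Longrightarrow> (w, w) \<in> presentation_rel X R"
| sym: "(u, w) \<in> presentation_rel X R \<Longrightarrow> (w, u) \<in> presentation_rel X R"
| trans: "(u, v) \<in> presentation_rel X R \<Longrightarrow> (v, w) \<in> presentation_rel X R
     \<Longrightarrow> (u, w) \<in> presentation_rel X R"
| append: "(u, u') \<in> presentation_rel X R \<Longrightarrow> (w, w') \<in> presentation_rel X R
     \<Longrightarrow> (u @ w, u' @ w') \<in> presentation_rel X R"
| cancel: "x \<in> X \<Longrightarrow> ([(x, s), (x, \<not> s)], []) \<in> presentation_rel X R"
| relation: "(l, r) \<in> R \<Longrightarrow> l \<in> lists (X \<times> UNIV) \<Longrightarrow> r \<in> lists (X \<times> UNIV)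
     \<Longrightarrow> (l, r) \<in> presentation_rel X R"

definition presented_group :: "'a set \<Rightarrow> ('a word \<times> 'a word) set \<Rightarrow> 'a word set monoid" where
  "presented_group X R =
     \<lparr>carrier = lists (X \<times> UNIV) // presentation_rel X R,
      monoid.mult = (\<lambda>A B. \<Union>a\<in>A. \<Union>b\<in>B. presentation_rel X R `` {a @ b}),
      one = presentation_rel X R `` {[]}\<rparr>"

definition racg :: "'a set \<Rightarrow> 'a set set \<Rightarrow> 'a word set monoid" where
  "racg V E = presented_group V
     ({([(v, True), (v, True)], []) |v. v \<in> V} \<union>
      {([(u, True), (v, True)], [(v, True), (u, True)]) |u v. {u, v} \<in> E})"

lemma equiv_presentation_rel: "equiv (lists (X \<times> UNIV)) (presentation_rel X R)"
proof (rule equivI)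
  have "u \<in> lists (X \<times> UNIV) \<and> w \<in> lists (X \<times> UNIV)"
    if "(u, w) \<in> presentation_rel X R" for u w
    using that by induction simp_all
  then show "presentation_rel X R \<subseteq> lists (X \<times> UNIV) \<times> lists (X \<times> UNIV)"
    by (intro subrelI SigmaI) blast+
  show "refl_on (lists (X \<times> UNIV)) (presentation_rel X R)"
    by (rule refl_onI) (rule presentation_rel.refl)
  show "sym (presentation_rel X R)"
    by (rule symI) (rule presentation_rel.sym)
  show "Relation.trans (presentation_rel X R)"
    by (rule transI) (rule presentation_rel.trans)
qed

lemma presented_group_mult:
  assumes "u \<in> lists (X \<times> UNIV)" "w \<in> lists (X \<times> UNIV)"
  shows "presentation_rel X R `` {u} \<otimes>\<^bsub>presented_group X R\<^esub> presentation_rel X R `` {w}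
           = presentation_rel X R `` {u @ w}"
proof -
  let ?r = "presentation_rel X R"
  have eq: "?r `` {a @ b} = ?r `` {u @ w}" if "a \<in> ?r `` {u}" "b \<in> ?r `` {w}" for a b
  proof -
    have "(u @ w, a @ b) \<in> ?r"
      using that by (intro presentation_rel.append) (simp_all only: Image_singleton_iff)
    then show ?thesis
      by (rule equiv_class_eq[OF equiv_presentation_rel, symmetric])
  qed
  have ne: "?r `` {u} \<noteq> {}" "?r `` {w} \<noteq> {}"
    using equiv_class_self[OF equiv_presentation_rel] assms by blast+
  have "?r `` {u} \<otimes>\<^bsub>presented_group X R\<^esub> ?r `` {w}
      = (\<Union>a\<in>?r `` {u}. \<Union>b\<in>?r `` {w}. ?r `` {a @ b})"
    unfolding presented_group_def monoid.select_convs by (rule HOL.refl)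
  also have "\<dots> = (\<Union>a\<in>?r `` {u}. \<Union>b\<in>?r `` {w}. ?r `` {u @ w})"
    by (intro SUP_cong HOL.refl) (rule eq)
  also have "\<dots> = ?r `` {u @ w}"
    using ne by (simp only: UN_constant if_False)
  finally show ?thesis .
qed

lemma group_presented_group: "group (presented_group X R)"
proof -
  let ?W = "lists (X \<times> (UNIV :: bool set))" and ?r = "presentation_rel X R"
  let ?G = "presented_group X R"
  have carI: "?r `` {w} \<in> carrier ?G" if "w \<in> ?W" for w
    unfolding presented_group_def partial_object.select_convs using that by (rule quotientI)
  have carE: "\<exists>w. w \<in> ?W \<and> A = ?r `` {w}" if "A \<in> carrier ?G" for A
    using that unfolding presented_group_def partial_object.select_convs
    by (elim quotientE) (intro exI conjI)
  have append: "u @ w \<in> ?W" if "u \<in> ?W" "w \<in> ?W" for u w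
    using that by simp
  have one: "\<one>\<^bsub>?G\<^esub> = ?r `` {[]}"
    by (simp add: presented_group_def)
  have inverse: "\<exists>u\<in>?W. (u @ w, []) \<in> ?r" if "w \<in> ?W" for w
    using that
  proof (induction w)
    case Nil
    then show ?case by (auto intro: presentation_rel.refl)
  next
    case (Cons a w)
    obtain x s where a: "a = (x, s)" "x \<in> X" using Cons by (cases a) auto
    obtain u where u: "u \<in> ?W" "(u @ w, []) \<in> ?r" using Cons by auto
    have "([(x, \<not> s), (x, s)], []) \<in> ?r"
      using presentation_rel.cancel[of x X "\<not> s" R] a by simp
    then have "(u @ ([(x, \<not> s), (x, s)] @ w), u @ ([] @ w)) \<in> ?r"
      using u Cons by (intro presentation_rel.append presentation_rel.refl) auto
    then have "((u @ [(x, \<not> s)]) @ a # w, u @ w) \<in> ?r"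
      by (simp add: a)
    then have "((u @ [(x, \<not> s)]) @ a # w, []) \<in> ?r"
      using u(2) by (rule presentation_rel.trans)
    then show ?case using u a by (intro bexI[of _ "u @ [(x, \<not> s)]"]) auto
  qed
  note mult = presented_group_mult[where X = X and R = R]
  show ?thesis
  proof (rule groupI)
    fix A B assume "A \<in> carrier ?G" "B \<in> carrier ?G"
    then obtain a b where "a \<in> ?W" "b \<in> ?W" "A = ?r `` {a}" "B = ?r `` {b}"
      using carE by metis
    then show "A \<otimes>\<^bsub>?G\<^esub> B \<in> carrier ?G"
      by (metis mult carI append)
  next
    show "\<one>\<^bsub>?G\<^esub> \<in> carrier ?G" unfolding one by (rule carI) simp
  next
    fix A B C assume "A \<in> carrier ?G" "B \<in> carrier ?G" "C \<in> carrier ?G"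
    then obtain a b c where "a \<in> ?W" "b \<in> ?W" "c \<in> ?W"
      and abc: "A = ?r `` {a}" "B = ?r `` {b}" "C = ?r `` {c}"
      using carE by metis
    then show "A \<otimes>\<^bsub>?G\<^esub> B \<otimes>\<^bsub>?G\<^esub> C = A \<otimes>\<^bsub>?G\<^esub> (B \<otimes>\<^bsub>?G\<^esub> C)"
      by (metis mult append append_assoc)
  next
    fix A assume "A \<in> carrier ?G"
    then obtain a where a: "a \<in> ?W" "A = ?r `` {a}" using carE by metis
    show "\<one>\<^bsub>?G\<^esub> \<otimes>\<^bsub>?G\<^esub> A = A"
      unfolding one a(2) mult[OF lists.Nil a(1)] append_Nil by (rule HOL.refl)
    obtain u where u: "u \<in> ?W" "(u @ a, []) \<in> ?r" using inverse a by metis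
    have "?r `` {u @ a} = ?r `` {[]}"
      using u(2) by (rule equiv_class_eq[OF equiv_presentation_rel])
    then have "?r `` {u} \<otimes>\<^bsub>?G\<^esub> A = \<one>\<^bsub>?G\<^esub>"
      unfolding one a(2) mult[OF u(1) a(1)] .
    then show "\<exists>B\<in>carrier ?G. B \<otimes>\<^bsub>?G\<^esub> A = \<one>\<^bsub>?G\<^esub>"
      using carI[OF u(1)] by (rule bexI)
  qed
qed


section \<open>Virtual algebraic fibering\<close>

definition virtually_algebraically_fibers :: "('a, 'b) monoid_scheme \<Rightarrow> bool" where
  "virtually_algebraically_fibers G \<longleftrightarrow>
     (\<exists>H. subgroup H G \<and> finite (rcosets\<^bsub>G\<^esub> H) \<and>
        (\<exists>f \<in> epi (G\<lparr>carrier := H\<rparr>) integer_group.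
           \<exists>K. finite K \<and> K \<subseteq> H \<and>
             generate G K = kernel (G\<lparr>carrier := H\<rparr>) integer_group f))"


section \<open>The 600-cell and its 1-skeleton\<close>

definition polytope_vertices :: "'a::euclidean_space set \<Rightarrow> 'a set" where
  "polytope_vertices P = {x. x extreme_point_of P}"

definition polytope_edges :: "'a::euclidean_space set \<Rightarrow> 'a set set" where
  "polytope_edges P = {{x, y} |x y. closed_segment x y edge_of P}"

lemma simplicial_graph_skeleton: "simplicial_graph (polytope_vertices P) (polytope_edges P)"
proof -
  have "x extreme_point_of P \<and> y extreme_point_of P \<and> x \<noteq> y"
    if "closed_segment x y edge_of P" for x y
  proof -
    have face: "closed_segment x y face_of P" and "aff_dim (closed_segment x y) = 1"
      using that by (auto simp: edge_of_def)
    moreover have "x extreme_point_of closed_segment x y" "y extreme_point_of closed_segment x y"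
      by (simp_all add: extreme_point_of_segment)
    ultimately show ?thesis
      by (auto simp: extreme_point_of_face)
  qed
  then show ?thesis
    unfolding simplicial_graph_def polytope_vertices_def polytope_edges_def by blast
qed

definition golden :: real where
  "golden = (1 + sqrt 5) / 2"

definition signed_even_perms :: "real^4 \<Rightarrow> (real^4) set" where
  "signed_even_perms c =
     {(\<chi> i. s i * c $ p i) |s p. (\<forall>i. s i \<in> {1, -1}) \<and> p permutes UNIV \<and> evenperm p}"

text \<open>The regular 600-cell with circumradius 1: the convex hull of the 8 unit vectors
  \<open>\<plusminus>e\<^sub>i\<close>, the 16 vectors with all coordinates \<open>\<plusminus>1/2\<close>, and the 96 vectors obtained from
  \<open>(\<phi>, 1, 1/\<phi>, 0)/2\<close> by even permutations of the coordinates and sign changes.\<close>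

definition cell600 :: "(real^4) set" where
  "cell600 = convex hull
     (signed_even_perms (vector [1, 0, 0, 0]) \<union>
      signed_even_perms (vector [1/2, 1/2, 1/2, 1/2]) \<union>
      signed_even_perms (vector [golden/2, 1/2, 1/(2*golden), 0]))"


section \<open>Hyperbolic 4-space and the right-angled 120-cell\<close>

text \<open>Hyperboloid model; the last component is the time-like coordinate.\<close>

type_synonym minkowski = "(real^4) \<times> real"

definition lorentz :: "minkowski \<Rightarrow> minkowski \<Rightarrow> real" where
  "lorentz x y = fst x \<bullet> fst y - snd x * snd y"

definition hyp4 :: "minkowski set" where
  "hyp4 = {x. lorentz x x = -1 \<and> snd x > 0}"

text \<open>A vector \<open>e\<close> with \<open>lorentz e e = 1\<close> represents the hyperplane \<open>{x \<in> hyp4. lorentz x e = 0}\<close>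
  together with the half-space \<open>{x \<in> hyp4. lorentz x e \<le> 0}\<close>, of which it is the outward
  unit normal.\<close>

definition hyp_reflection :: "minkowski \<Rightarrow> minkowski \<Rightarrow> minkowski" where
  "hyp_reflection e = (\<lambda>x\<in>hyp4. x - (2 * lorentz x e) *\<^sub>R e)"

lemma hyp_reflection_Bij:
  assumes e: "lorentz e e = 1"
  shows "hyp_reflection e \<in> carrier (BijGroup hyp4)"
proof -
  define f where "f x = x - (2 * lorentz x e) *\<^sub>R e" for x
  have diff: "lorentz (x - c *\<^sub>R e) y = lorentz x y - c * lorentz e y" for x y c
    by (simp add: lorentz_def algebra_simps)
  have comm: "lorentz x y = lorentz y x" for x y
    by (simp add: lorentz_def inner_commute)
  have fe: "lorentz (f x) e = - lorentz x e" for x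
    by (simp add: f_def diff e)
  have ff: "f (f x) = x" for x
    unfolding f_def[of "f x"] fe by (simp add: f_def)
  have form: "lorentz (f x) (f x) = lorentz x x" for x
  proof -
    have "lorentz (f x) (f x) = lorentz (f x) x - 2 * lorentz x e * lorentz (f x) e"
      by (subst (2) f_def) (simp only: comm[of "f x"] diff)
    also have "\<dots> = lorentz x x"
      unfolding fe by (simp add: f_def diff comm[of e x])
    finally show ?thesis .
  qed
  have pos: "snd (f x) > 0" if "x \<in> hyp4" for x
  proof -
    obtain y t where x: "x = (y, t)" by (cases x)
    obtain a b where ab: "e = (a, b)" by (cases e)
    have y: "y \<bullet> y = t * t - 1" "t > 0" and a: "a \<bullet> a = 1 + b * b"
      using that e by (auto simp: hyp4_def lorentz_def x ab)
    have "(2 * b * (y \<bullet> a))\<^sup>2 = 4 * b\<^sup>2 * (y \<bullet> a)\<^sup>2"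
      by (simp add: power2_eq_square)
    also have "\<dots> \<le> 4 * b\<^sup>2 * ((y \<bullet> y) * (a \<bullet> a))"
      using Cauchy_Schwarz_ineq[of y a] by (intro mult_left_mono) auto
    also have "\<dots> \<le> 4 * b\<^sup>2 * (t\<^sup>2 * (1 + b\<^sup>2))"
      unfolding y a by (intro mult_left_mono) (auto simp: power2_eq_square algebra_simps)
    also have "\<dots> < (t * (1 + 2 * b\<^sup>2))\<^sup>2"
      using y(2) by (simp add: power2_eq_square algebra_simps)
    finally have "2 * b * (y \<bullet> a) < t * (1 + 2 * b\<^sup>2)"
      by (rule power_less_imp_less_base) (use y(2) in simp)
    then show ?thesis
      by (simp add: f_def x ab lorentz_def algebra_simps power2_eq_square)
  qed
  have "f x \<in> hyp4" if "x \<in> hyp4" for x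
    using that pos[OF that] by (simp add: hyp4_def form)
  then have "bij_betw f hyp4 hyp4"
    by (intro bij_betw_byWitness[where f' = f]) (auto simp: ff)
  then show ?thesis
    by (simp add: hyp_reflection_def BijGroup_def Bij_def f_def[abs_def] cong: bij_betw_cong)
qed

text \<open>\<open>e\<close> is the outward unit normal of a 3-dimensional face of \<open>P\<close>.  A subset of \<open>hyp4\<close>
  of hyperbolic dimension \<open>d\<close> spans a linear subspace of dimension \<open>d + 1\<close>.\<close>

definition facet_normal :: "minkowski set \<Rightarrow> minkowski \<Rightarrow> bool" where
  "facet_normal P e \<longleftrightarrow> lorentz e e = 1 \<and> (\<forall>x\<in>P. lorentz x e \<le> 0) \<and>
     dim {x \<in> P. lorentz x e = 0} = 4"

definition reflection_group :: "minkowski set \<Rightarrow> (minkowski \<Rightarrow> minkowski) monoid" where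
  "reflection_group P =
     (BijGroup hyp4)\<lparr>carrier := generate (BijGroup hyp4) {hyp_reflection e |e. facet_normal P e}\<rparr>"

text \<open>The outward normal of the hyperplane at distance \<open>r\<close> from the base point \<open>(0, 1)\<close>,
  orthogonal to the geodesic ray from the base point in the unit direction \<open>v\<close>.\<close>

definition wall :: "real \<Rightarrow> real^4 \<Rightarrow> minkowski" where
  "wall r v = (cosh r *\<^sub>R v, sinh r)"

text \<open>The 120-cell is dual to the 600-cell: the regular hyperbolic 120-cell with inradius \<open>r\<close>
  is bounded by the walls in the directions of the vertices of the 600-cell.\<close>

definition hyp_cell120 :: "real \<Rightarrow> minkowski set" where
  "hyp_cell120 r = {x \<in> hyp4. \<forall>v \<in> polytope_vertices cell600. lorentz x (wall r v) \<le> 0}"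

text \<open>Adjacent vertices \<open>v\<close>, \<open>w\<close> of the 600-cell have \<open>v \<bullet> w = cos (\<pi>/5) = \<phi>/2\<close>, so
  \<open>lorentz (wall r v) (wall r w) = (cosh r)\<^sup>2 * \<phi>/2 - (sinh r)\<^sup>2\<close>; the dihedral angles
  are right exactly when \<open>(tanh r)\<^sup>2 = \<phi>/2\<close>.\<close>

definition right_angled_inradius :: real where
  "right_angled_inradius = artanh (sqrt (golden / 2))"

definition right_angled_cell120 :: "minkowski set" where
  "right_angled_cell120 = hyp_cell120 right_angled_inradius"

lemma right_angled_inradius: "right_angled_inradius > 0" "(tanh right_angled_inradius)\<^sup>2 = golden / 2"
proof -
  define t where "t = sqrt (golden / 2)"
  have "sqrt 5 < sqrt (3\<^sup>2)" by (rule real_sqrt_less_mono) simp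
  then have g: "0 < golden" "golden < 2" by (auto simp: golden_def add_pos_nonneg)
  then have t: "0 < t" "t < 1" "t\<^sup>2 = golden / 2" by (auto simp: t_def)
  define q where "q = (1 + t) / (1 - t)"
  have q: "1 < q" using t by (simp add: q_def field_simps)
  have r: "right_angled_inradius = ln q / 2"
    by (simp add: right_angled_inradius_def artanh_def t_def q_def)
  show "right_angled_inradius > 0" unfolding r using ln_gt_zero[OF q] by simp
  have "exp (- 2 * right_angled_inradius) = inverse q"
    using q by (simp add: r exp_minus)
  moreover have "(1 - inverse q) / (1 + inverse q) = t"
    using t by (simp add: q_def divide_simps)
  ultimately have "tanh right_angled_inradius = t"
    by (simp only: tanh_real_altdef)
  then show "(tanh right_angled_inradius)\<^sup>2 = golden / 2" using t by simp
qed

lemma adjacent_walls_orthogonal: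
  assumes "v \<bullet> w = golden / 2"
  shows "lorentz (wall right_angled_inradius v) (wall right_angled_inradius w) = 0"
proof -
  let ?r = right_angled_inradius
  have "(sinh ?r)\<^sup>2 = (cosh ?r)\<^sup>2 * (v \<bullet> w)"
    using right_angled_inradius(2) by (simp add: assms tanh_def power_divide field_simps)
  then show ?thesis
    by (simp add: lorentz_def wall_def power2_eq_square mult.assoc)
qed

lemma lorentz_wall_self: "norm v = 1 \<Longrightarrow> lorentz (wall r v) (wall r v) = 1"
  using cosh_square_eq[of r]
  by (simp add: lorentz_def wall_def dot_square_norm power2_eq_square)

end

theory Submission
  imports Defs
begin

text \<open>Three arguments make up the proof.

\<^emph>\<open>The legal system.\<close>  Regard \<open>\<real>\<^sup>4\<close> as the quaternions.  The 120 vertices form the binary icosahedral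
group, and the binary tetrahedral group, a 24-cell, has five cosets in it, which are permuted cyclically
by the right multiplication \<open>rot\<close> with an element of order 5.  Vertices are adjacent exactly if
their inner product is \<open>\<phi>/2\<close>; two vertices of one coset never are, so the coset of \<open>v\<close> is a move at \<open>v\<close>.
The initial state has one vertex of each antipodal pair, and it is invariant under \<open>rot\<close>.  The moves then
replace its part in one coset by the antipodes, which gives 32 states.  The isometry \<open>rot\<close> and the
antipodal map act on this orbit with four classes, and a graph search on integer codes of the vertices
shows that a representative of each is connected (\<open>cconn_states\<close>, \<open>connected_states\<close>).  The complement of
a state is a state, so all of them are legal (\<open>legal_system_600\<close>).  That the graph of the convex hull is
the one given by inner products is shown in \<open>polytope_vertices_cell600\<close> and \<open>E600_iff\<close>: since the
symmetries are transitive, it is enough to look at functionals that are maximal at a single given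
vertex.

\<^emph>\<open>The presentation.\<close>  The facet normals of the 120-cell are its walls (\<open>facet_normals_hyp_cell120\<close>).  Walls of
adjacent vertices are orthogonal and their reflections commute; all other pairs have Lorentz product at
most \<open>-1\<close>.  For such a Gram matrix, an induction over reduced words shows that a nonempty
reduced word moves the base point across the wall of its first letter (\<open>reduced_signs\<close>).  Hence the
right-angled Coxeter group acts faithfully (\<open>reflections_racg\<close>).

\<^emph>\<open>Fibering.\<close>  Each edge of the Cayley graph is given a direction by the state at its ends, which defines a
height on the group.  The legality of all states is the connectedness of ascending and descending links
in the sense of Bestvina and Brady, and it allows paths to be pushed into the elements of height 0 and
1 (\<open>peak_reduction\<close>).  On a finite index subgroup the height is a homomorphism, and the connected level set
shows that its kernel is finitely generated (\<open>fibering\<close>).\<close>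

section \<open>Integer codes for vectors over the golden ring\<close>

lemma golden_sq: "golden * golden = golden + 1"
proof -
  have "sqrt 5 * sqrt 5 = (5::real)" by simp
  then show ?thesis by (simp add: golden_def field_simps)
qed

lemma golden_bounds: "1618 / 1000 < golden" "golden < 1619 / 1000"
proof -
  have "2236 / 1000 < sqrt 5" by (rule real_less_rsqrt) (simp add: power2_eq_square)
  then show "1618 / 1000 < golden" by (simp add: golden_def)
  have "sqrt 5 < 2238 / 1000" by (rule real_less_lsqrt) (simp_all add: power2_eq_square)
  then show "golden < 1619 / 1000" by (simp add: golden_def)
qed

lemma inverse_golden: "1 / golden = golden - 1"
  using golden_sq golden_bounds by (simp add: field_simps)

type_synonym zphi = "int \<times> int"

text \<open>The pair \<open>(a, b)\<close> stands for \<open>(a + b \<phi>) / 2\<close>.  All coordinates of vertices of the 600-cell have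
this form, so every finite check below becomes a computation with integers.\<close>

fun zphi_val :: "zphi \<Rightarrow> real" where "zphi_val (a, b) = (of_int a + of_int b * golden) / 2"
declare zphi_val.simps [simp del]

fun zneg :: "zphi \<Rightarrow> zphi" where "zneg (a, b) = (- a, - b)"
fun zadd :: "zphi \<Rightarrow> zphi \<Rightarrow> zphi" where "zadd (a, b) (c, d) = (a + c, b + d)"
fun zmul :: "zphi \<Rightarrow> zphi \<Rightarrow> zphi" where "zmul (a, b) (c, d) = (a * c + b * d, a * d + b * c + b * d)"
fun zhalf :: "zphi \<Rightarrow> zphi" where "zhalf (a, b) = (a div 2, b div 2)"
fun zeven :: "zphi \<Rightarrow> bool" where "zeven (a, b) \<longleftrightarrow> a mod 2 = 0 \<and> b mod 2 = 0"

lemma zphi_val_zneg [simp]: "zphi_val (zneg x) = - zphi_val x"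
  by (cases x) (simp add: zphi_val.simps field_simps)

lemma zphi_val_zadd [simp]: "zphi_val (zadd x y) = zphi_val x + zphi_val y"
  by (cases x; cases y) (simp add: zphi_val.simps field_simps)

lemma zphi_val_zmul [simp]: "zphi_val (zmul x y) = 2 * zphi_val x * zphi_val y"
proof -
  obtain a b c d where xy: "x = (a, b)" "y = (c, d)" by (cases x; cases y)
  have "2 * zphi_val x * zphi_val y = (of_int (a * c) + of_int (a * d + b * c) * golden
      + of_int (b * d) * (golden * golden)) / 2"
    by (simp add: xy zphi_val.simps field_simps)
  then show ?thesis unfolding golden_sq by (simp add: xy zphi_val.simps field_simps)
qed

lemma zphi_val_zhalf: "zeven x \<Longrightarrow> zphi_val (zhalf x) = zphi_val x / 2"
  by (cases x) (auto simp: zphi_val.simps field_simps elim!: dvdE simp flip: dvd_eq_mod_eq_0)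

text \<open>Irrationality makes the encoding injective, so that vertices may be counted and told apart
by comparing their codes.\<close>

lemma sqrt5_irrational: "sqrt 5 \<notin> \<rat>"
proof
  assume "sqrt 5 \<in> \<rat>"
  then obtain m n :: nat where n: "n \<noteq> 0" and mn: "\<bar>sqrt 5\<bar> = real m / real n" and "coprime m n"
    by (rule Rats_abs_nat_div_natE)
  have "(sqrt 5)\<^sup>2 = (real m / real n)\<^sup>2" using mn by simp
  then have "real (m\<^sup>2) = real (5 * n\<^sup>2)"
    using n by (simp add: power_divide field_simps)
  then have eq: "m\<^sup>2 = 5 * n\<^sup>2" by (simp only: of_nat_eq_iff)
  have p: "prime (5::nat)" by simp
  have "5 dvd m" using eq p by (metis dvd_triv_left prime_dvd_power)
  then obtain k where k: "m = 5 * k" by blast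
  then have "n\<^sup>2 = 5 * k\<^sup>2" using eq by (simp add: power2_eq_square)
  then have "5 dvd n" using p by (metis dvd_triv_left prime_dvd_power)
  then show False
    using \<open>coprime m n\<close> \<open>5 dvd m\<close> using coprime_common_divisor[of m n 5] by simp
qed

lemma zphi_val_inj [simp]: "zphi_val x = zphi_val y \<longleftrightarrow> x = y"
proof
  assume eq: "zphi_val x = zphi_val y"
  obtain a b c d where xy: "x = (a, b)" "y = (c, d)" by (cases x; cases y)
  have lin: "of_int (a - c) = of_int (d - b) * golden"
    using eq by (simp add: xy zphi_val.simps algebra_simps)
  have "d = b"
  proof (rule ccontr)
    assume "d \<noteq> b"
    then have "golden = of_int (a - c) / of_int (d - b)"
      using lin by (simp add: zphi_val.simps field_simps)
    then have "golden \<in> \<rat>"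
      by (metis Rats_divide Rats_of_int)
    then have "2 * golden - 1 \<in> \<rat>"
      by (intro Rats_diff Rats_mult) simp_all
    moreover have "sqrt 5 = 2 * golden - 1"
      by (simp add: golden_def field_simps)
    ultimately have "sqrt 5 \<in> \<rat>"
      by (simp only:)
    then show False using sqrt5_irrational by simp
  qed
  then show "x = y" using lin xy by simp
qed simp

type_synonym code = "zphi \<times> zphi \<times> zphi \<times> zphi"

fun vec_of_code :: "code \<Rightarrow> real^4" where "vec_of_code (a, b, c, d) = vector [zphi_val a, zphi_val b, zphi_val c, zphi_val d]"
fun cneg :: "code \<Rightarrow> code" where "cneg (a, b, c, d) = (zneg a, zneg b, zneg c, zneg d)"
fun cdot :: "code \<Rightarrow> code \<Rightarrow> zphi" where
  "cdot (a, b, c, d) (a', b', c', d') = zadd (zadd (zmul a a') (zmul b b')) (zadd (zmul c c') (zmul d d'))"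

lemma vector_4 [simp]:
  "(vector [x, y, z, w] :: 'a::zero^4) $ 1 = x"
  "(vector [x, y, z, w] :: 'a::zero^4) $ 2 = y"
  "(vector [x, y, z, w] :: 'a::zero^4) $ 3 = z"
  "(vector [x, y, z, w] :: 'a::zero^4) $ 4 = w"
  by (simp_all add: vector_def)

lemma vec_of_code_inj [simp]: "vec_of_code x = vec_of_code y \<longleftrightarrow> x = y"
  by (cases x rule: prod_cases4; cases y rule: prod_cases4) (simp add: vec_eq_iff forall_4)

lemma vec_of_code_cneg [simp]: "vec_of_code (cneg x) = - vec_of_code x"
  by (cases x rule: prod_cases4) (simp add: vec_eq_iff forall_4)

lemma vec_of_code_inner: "vec_of_code x \<bullet> vec_of_code y = zphi_val (cdot x y) / 2"
  by (cases x rule: prod_cases4; cases y rule: prod_cases4) (simp add: inner_vec_def sum_4)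

section \<open>Signed even permutations of four coordinates\<close>

text \<open>The twelve even permutations of four positions, written out as the quadruples that they produce.\<close>

fun arrangements :: "'a \<times> 'a \<times> 'a \<times> 'a \<Rightarrow> ('a \<times> 'a \<times> 'a \<times> 'a) list" where
  "arrangements (a, b, c, d) =
    [(a,b,c,d), (b,a,d,c), (c,d,a,b), (d,c,b,a), (a,c,d,b), (a,d,b,c),
     (c,b,d,a), (d,b,a,c), (b,d,c,a), (d,a,c,b), (b,c,a,d), (c,a,b,d)]"

lemma transpose_pair:
  fixes a b c d :: "'a::finite"
  assumes "p = Transposition.transpose a b \<circ> Transposition.transpose c d" "a \<noteq> b \<longleftrightarrow> c \<noteq> d"
  shows "p permutes UNIV \<and> evenperm p"
proof
  show "p permutes UNIV"
    unfolding assms(1) by (intro permutes_compose permutes_swap_id UNIV_I)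
  show "evenperm p"
    unfolding assms(1) using assms(2)
    by (simp add: evenperm_comp[OF permutation_swap_id permutation_swap_id] evenperm_swap)
qed

lemma arrangements_even:
  fixes p :: "4 \<Rightarrow> 4"
  assumes "(p 1, p 2, p 3, p 4) \<in> set (arrangements (1, 2, 3, 4))"
  shows "p permutes UNIV \<and> evenperm p"
proof -
  have eqI: "p = q" if "p 1 = q 1" "p 2 = q 2" "p 3 = q 3" "p 4 = q 4" for q
    using that forall_4[of "\<lambda>x. p x = q x"] by (simp add: fun_eq_iff)
  note t = transpose_pair[OF eqI]
  show ?thesis
    using assms
    apply (simp only: arrangements.simps set_simps insert_iff empty_iff prod.inject simp_thms)
    apply (elim disjE conjE)
    subgoal by (rule t[of 1 1 1 1]) (simp_all add: Transposition.transpose_def)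
    subgoal by (rule t[of 1 2 3 4]) (simp_all add: Transposition.transpose_def)
    subgoal by (rule t[of 1 3 2 4]) (simp_all add: Transposition.transpose_def)
    subgoal by (rule t[of 1 4 2 3]) (simp_all add: Transposition.transpose_def)
    subgoal by (rule t[of 2 3 3 4]) (simp_all add: Transposition.transpose_def)
    subgoal by (rule t[of 2 4 4 3]) (simp_all add: Transposition.transpose_def)
    subgoal by (rule t[of 1 3 3 4]) (simp_all add: Transposition.transpose_def)
    subgoal by (rule t[of 1 4 4 3]) (simp_all add: Transposition.transpose_def)
    subgoal by (rule t[of 1 2 2 4]) (simp_all add: Transposition.transpose_def)
    subgoal by (rule t[of 1 4 4 2]) (simp_all add: Transposition.transpose_def)
    subgoal by (rule t[of 1 2 2 3]) (simp_all add: Transposition.transpose_def)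
    subgoal by (rule t[of 1 3 3 2]) (simp_all add: Transposition.transpose_def)
    done
qed

text \<open>Exchanging the values 1 and 2 turns any quadruple of distinct values outside the list into one
on the list.  A permutation outside the list is therefore odd.\<close>

lemma even_arrangements:
  fixes p :: "4 \<Rightarrow> 4"
  assumes p: "p permutes UNIV" "evenperm p"
  shows "(p 1, p 2, p 3, p 4) \<in> set (arrangements (1, 2, 3, 4))"
proof (rule ccontr)
  assume neg: "\<not> ?thesis"
  let ?t = "Transposition.transpose 1 2 :: 4 \<Rightarrow> 4"
  have inj: "p i = p j \<longleftrightarrow> i = j" for i j
    using permutes_inj[OF p(1)] by (auto dest: injD)
  have ne: "p 1 \<noteq> p 2" "p 1 \<noteq> p 3" "p 1 \<noteq> p 4" "p 2 \<noteq> p 3" "p 2 \<noteq> p 4" "p 3 \<noteq> p 4"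
    by (simp_all add: inj)
  have odd: "\<forall>a b c d :: 4. a \<noteq> b \<longrightarrow> a \<noteq> c \<longrightarrow> a \<noteq> d \<longrightarrow> b \<noteq> c \<longrightarrow> b \<noteq> d \<longrightarrow> c \<noteq> d \<longrightarrow>
      (a, b, c, d) \<notin> set (arrangements (1, 2, 3, 4)) \<longrightarrow>
      (?t a, ?t b, ?t c, ?t d) \<in> set (arrangements (1, 2, 3, 4))"
    apply (simp only: forall_4)
    apply (simp del: arrangements.simps)
    apply (simp add: Transposition.transpose_def)
    done
  have "((?t \<circ> p) 1, (?t \<circ> p) 2, (?t \<circ> p) 3, (?t \<circ> p) 4) \<in> set (arrangements (1, 2, 3, 4))"
    unfolding o_apply by (rule odd[rule_format, OF ne neg])
  then have "evenperm (?t \<circ> p)" using arrangements_even by blast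
  moreover have "permutation p"
    using p(1) by (auto simp: permutation_permutes)
  ultimately show False
    using p(2) by (simp add: evenperm_comp evenperm_swap permutation_swap_id)
qed

text \<open>Zero has only one sign, so that the enumeration of the vertices has no repetitions.  The nested
conditionals let the simplifier skip the branches that are not taken.\<close>

fun zsigns :: "zphi \<Rightarrow> zphi list" where
  "zsigns (a, b) = (if a = 0 then if b = 0 then [(a, b)] else [(a, b), (- a, - b)] else [(a, b), (- a, - b)])"

fun csigns :: "code \<Rightarrow> code list" where
  "csigns (a, b, c, d) = [(a', b', c', d'). a' \<leftarrow> zsigns a, b' \<leftarrow> zsigns b, c' \<leftarrow> zsigns c, d' \<leftarrow> zsigns d]"

lemma set_zsigns: "z \<in> set (zsigns w) \<longleftrightarrow> z = w \<or> z = zneg w"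
  by (cases w) auto

lemma set_csigns: "(a', b', c', d') \<in> set (csigns (a, b, c, d)) \<longleftrightarrow>
    a' \<in> set (zsigns a) \<and> b' \<in> set (zsigns b) \<and> c' \<in> set (zsigns c) \<and> d' \<in> set (zsigns d)"
  by (auto simp del: zsigns.simps)

lemma signed_even_perms_code:
  "signed_even_perms (vec_of_code x) = vec_of_code ` (\<Union>y\<in>set (arrangements x). set (csigns y))"
proof -
  obtain a b c d where x: "x = (a, b, c, d)" by (cases x rule: prod_cases4)
  define f :: "4 \<Rightarrow> zphi" where "f i = (if i = 1 then a else if i = 2 then b else if i = 3 then c else d)" for i
  have f: "vec_of_code x $ i = zphi_val (f i)" for i
    using exhaust_4[of i] by (auto simp: x f_def)
  have xf: "x = (f 1, f 2, f 3, f 4)"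
    by (simp add: x f_def)
  have map: "arrangements (f i, f j, f k, f l) = map (\<lambda>(i, j, k, l). (f i, f j, f k, f l)) (arrangements (i, j, k, l))" for i j k l
    by simp
  show ?thesis
  proof (intro equalityI subsetI)
    fix v assume "v \<in> signed_even_perms (vec_of_code x)"
    then obtain s p where v: "v = (\<chi> i. s i * vec_of_code x $ p i)"
      and s: "\<And>i. s i \<in> {1, - 1}" and p: "p permutes UNIV" "evenperm p"
      unfolding signed_even_perms_def by blast
    define g where "g i = (if s i = 1 then f (p i) else zneg (f (p i)))" for i
    have "v $ i = zphi_val (g i)" for i
      using s[of i] by (auto simp: v g_def f)
    then have "v = vec_of_code (g 1, g 2, g 3, g 4)"
      by (simp add: vec_eq_iff forall_4)
    moreover have "(g 1, g 2, g 3, g 4) \<in> set (csigns (f (p 1), f (p 2), f (p 3), f (p 4)))"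
      by (simp only: set_csigns set_zsigns g_def) auto
    moreover have "(f (p 1), f (p 2), f (p 3), f (p 4)) \<in> set (arrangements x)"
      unfolding xf map set_map using even_arrangements[OF p] by (rule rev_image_eqI) simp
    ultimately show "v \<in> vec_of_code ` (\<Union>y\<in>set (arrangements x). set (csigns y))"
      by blast
  next
    fix v assume "v \<in> vec_of_code ` (\<Union>y\<in>set (arrangements x). set (csigns y))"
    then obtain y z where y: "y \<in> set (arrangements x)" and z: "z \<in> set (csigns y)" "v = vec_of_code z"
      by blast
    obtain i j k l where ijkl: "(i, j, k, l) \<in> set (arrangements (1::4, 2, 3, 4))" "y = (f i, f j, f k, f l)"
      using y unfolding xf map set_map by (auto simp del: arrangements.simps)
    define p :: "4 \<Rightarrow> 4" where "p n = (if n = 1 then i else if n = 2 then j else if n = 3 then k else l)" for n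
    have p: "p 1 = i" "p 2 = j" "p 3 = k" "p 4 = l"
      by (simp_all add: p_def)
    have perm: "p permutes UNIV \<and> evenperm p"
      using arrangements_even[of p] ijkl(1) by (simp only: p)
    obtain a' b' c' d' where z': "z = (a', b', c', d')" by (cases z rule: prod_cases4)
    have "v $ n = zphi_val (f (p n)) \<or> v $ n = - zphi_val (f (p n))" for n
      using z exhaust_4[of n] unfolding z' ijkl(2) set_csigns set_zsigns
      by (auto simp: p)
    then have "\<forall>n. \<exists>s. s \<in> {1, - 1} \<and> v $ n = s * vec_of_code x $ p n"
      by (metis f insertCI mult_1 mult_minus1)
    then obtain s where s: "\<And>n. s n \<in> {1, - 1}" "\<And>n. v $ n = s n * vec_of_code x $ p n"
      by metis
    then show "v \<in> signed_even_perms (vec_of_code x)"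
      unfolding signed_even_perms_def using perm by (auto simp: vec_eq_iff)
  qed
qed

section \<open>The vertices as five cosets of a 24-cell\<close>

definition verts :: "(real^4) set" where
  "verts = signed_even_perms (vector [1, 0, 0, 0]) \<union>
      signed_even_perms (vector [1/2, 1/2, 1/2, 1/2]) \<union>
      signed_even_perms (vector [golden/2, 1/2, 1/(2*golden), 0])"

text \<open>Twice the right multiplication by the quaternion \<open>(1/\<phi> + i + \<phi> k) / 2\<close>, on codes.  The pairs
\<open>(-1, 1)\<close> and \<open>(0, 1)\<close> encode \<open>1/\<phi> = \<phi> - 1\<close> and \<open>\<phi>\<close> up to the factor 2, which \<open>zmul\<close> supplies;
halving is postponed because it is exact only on the codes of vertices.\<close>

fun crot2 :: "code \<Rightarrow> code" where
  "crot2 (a, b, c, d) =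
     (zadd (zmul (-1, 1) a) (zneg (zadd b (zmul (0, 1) d))),
      zadd a (zadd (zmul (-1, 1) b) (zmul (0, 1) c)),
      zadd (zmul (-1, 1) c) (zadd d (zneg (zmul (0, 1) b))),
      zadd (zmul (0, 1) a) (zadd (zmul (-1, 1) d) (zneg c)))"
fun ceven :: "code \<Rightarrow> bool" where "ceven (a, b, c, d) \<longleftrightarrow> zeven a \<and> zeven b \<and> zeven c \<and> zeven d"
fun chalf :: "code \<Rightarrow> code" where "chalf (a, b, c, d) = (zhalf a, zhalf b, zhalf c, zhalf d)"
definition crot :: "code \<Rightarrow> code" where "crot c = chalf (crot2 c)"

text \<open>The same right multiplication on vectors.  The quaternion has norm 1 and order 5, and it lies in
the group formed by the vertices; hence \<open>rot\<close> is an isometry that permutes the vertices.\<close>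

definition rot :: "real^4 \<Rightarrow> real^4" where
  "rot x = vector
     [((golden - 1) * x$1 - x$2 - golden * x$4) / 2,
      (x$1 + (golden - 1) * x$2 + golden * x$3) / 2,
      ((golden - 1) * x$3 + x$4 - golden * x$2) / 2,
      (golden * x$1 + (golden - 1) * x$4 - x$3) / 2]"

lemma linear_rot: "linear rot"
  by (rule linearI) (simp_all add: rot_def vec_eq_iff forall_4 field_simps)

lemma rot_inner: "rot x \<bullet> rot y = x \<bullet> y"
proof -
  have "4 * (rot x \<bullet> rot y) = (2 + 2 * (golden * golden) - 2 * golden) * (x \<bullet> y)"
    by (simp add: rot_def inner_vec_def sum_4 field_simps)
  also have "2 + 2 * (golden * golden) - 2 * golden = 4"
    by (simp add: golden_sq)
  finally show ?thesis by simp
qed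

lemma orthogonal_rot: "orthogonal_transformation rot"
  by (simp add: orthogonal_transformation_def linear_rot rot_inner)

lemma vec_of_code_chalf: "ceven x \<Longrightarrow> vec_of_code (chalf x) = vec_of_code x /\<^sub>R 2"
  by (cases x rule: prod_cases4) (simp add: vec_eq_iff forall_4 zphi_val_zhalf)

lemma rot_vec_of_code: "ceven (crot2 x) \<Longrightarrow> rot (vec_of_code x) = vec_of_code (crot x)"
  unfolding crot_def vec_of_code_chalf
  by (cases x rule: prod_cases4) (simp add: vec_eq_iff forall_4 rot_def zphi_val.simps[of "-1" 1] zphi_val.simps[of 0 1])

text \<open>The vectors \<open>\<plusminus>e\<^sub>i\<close> and \<open>(\<plusminus>1, \<plusminus>1, \<plusminus>1, \<plusminus>1) / 2\<close> are the vertices of a 24-cell, the binary tetrahedral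
group.  The list picks one vertex from each antipodal pair: the one whose first nonzero
coordinate is positive.\<close>

definition row0 :: "code list" where
  "row0 = [((2,0),(0,0),(0,0),(0,0)), ((0,0),(2,0),(0,0),(0,0)),
           ((0,0),(0,0),(2,0),(0,0)), ((0,0),(0,0),(0,0),(2,0)),
           ((1,0),(1,0),(1,0),(1,0)), ((1,0),(1,0),(1,0),(-1,0)),
           ((1,0),(1,0),(-1,0),(1,0)), ((1,0),(1,0),(-1,0),(-1,0)),
           ((1,0),(-1,0),(1,0),(1,0)), ((1,0),(-1,0),(1,0),(-1,0)),
           ((1,0),(-1,0),(-1,0),(1,0)), ((1,0),(-1,0),(-1,0),(-1,0))]"

text \<open>The translates of the first row by the powers of the quaternion.  With the antipodes added, they
are the five cosets of the binary tetrahedral group in the binary icosahedral group.\<close>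

definition rows :: "code list list" where
  "rows = (let r1 = map crot row0; r2 = map crot r1; r3 = map crot r2; r4 = map crot r3
     in [row0, r1, r2, r3, r4])"

definition codes :: "code list" where
  "codes = (let cs = concat rows in cs @ map cneg cs)"

definition all_codes :: "code list" where
  "all_codes = concat (map csigns
     ([((2,0),(0,0),(0,0),(0,0)), ((0,0),(2,0),(0,0),(0,0)),
       ((0,0),(0,0),(2,0),(0,0)), ((0,0),(0,0),(0,0),(2,0)), ((1,0),(1,0),(1,0),(1,0))]
      @ arrangements ((0,1),(1,0),(-1,1),(0,0))))"

lemma verts_all_codes: "verts = vec_of_code ` set all_codes"
proof -
  have 1: "vector [1, 0, 0, 0] = vec_of_code ((2,0),(0,0),(0,0),(0,0))"
    and 2: "vector [1/2, 1/2, 1/2, 1/2] = vec_of_code ((1,0),(1,0),(1,0),(1,0))"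
    and 3: "vector [golden/2, 1/2, 1/(2*golden), 0] = vec_of_code ((0,1),(1,0),(-1,1),(0,0))"
    using inverse_golden by (simp_all add: vec_eq_iff forall_4 zphi_val.simps field_simps)
  show ?thesis
    unfolding verts_def 1 2 3 signed_even_perms_code image_Un[symmetric] all_codes_def
    by (rule arg_cong[where f = "image vec_of_code"]) (simp add: Un_ac del: csigns.simps)
qed

text \<open>Comparison, membership and inclusion with nested conditionals: the simplifier evaluates only
the branch that is taken, so that two codes are usually told apart by one coordinate.\<close>

fun ceq :: "code \<Rightarrow> code \<Rightarrow> bool" where
  "ceq ((a,b),(c,d),(e,f),(g,h)) ((a',b'),(c',d'),(e',f'),(g',h')) =
     (if a = a' then if b = b' then if c = c' then if d = d' then if e = e' then if f = f' then
       if g = g' then h = h' else False else False else False else False else False else False else False)"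
fun cmem :: "code \<Rightarrow> code list \<Rightarrow> bool" where
  "cmem x [] = False"
| "cmem x (y # ys) = (if ceq x y then True else cmem x ys)"
fun csub :: "code list \<Rightarrow> code list \<Rightarrow> bool" where
  "csub [] ys = True"
| "csub (x # xs) ys = (if cmem x ys then csub xs ys else False)"
fun cdistinct :: "code list \<Rightarrow> bool" where
  "cdistinct [] = True"
| "cdistinct (x # xs) = (if cmem x xs then False else cdistinct xs)"

lemma ceq_iff: "ceq x y \<longleftrightarrow> x = y"
  by (cases "(x, y)" rule: ceq.cases) auto
lemma cmem_iff: "cmem x xs \<longleftrightarrow> x \<in> set xs"
  by (induction xs) (auto simp: ceq_iff)
lemma csub_iff: "csub xs ys \<longleftrightarrow> set xs \<subseteq> set ys"
  by (induction xs) (auto simp: cmem_iff)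
lemma cdistinct_iff: "cdistinct xs \<longleftrightarrow> distinct xs"
  by (induction xs) (auto simp: cmem_iff)

lemma distinct_codes: "distinct codes"
  unfolding cdistinct_iff[symmetric] by code_simp

lemma length_codes: "length codes = 120" "length all_codes = 120"
  by code_simp+

lemma codes_sub: "set codes \<subseteq> set all_codes"
  unfolding csub_iff[symmetric] by code_simp

text \<open>One inclusion is enough, since both lists have 120 entries and one of them has no repetition.\<close>

lemma set_codes: "set all_codes = set codes"
proof (rule card_subset_eq[OF _ codes_sub, symmetric])
  have "card (set all_codes) \<le> card (set codes)"
    using card_length[of all_codes] distinct_card[OF distinct_codes] by (simp add: length_codes)
  then show "card (set codes) = card (set all_codes)"
    using card_mono[OF _ codes_sub] by simp
qed simp

lemma verts_codes: "verts = vec_of_code ` set codes"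
  by (simp add: verts_all_codes set_codes)

lemma even_codes: "\<forall>c\<in>set (concat rows). ceven (crot2 c)"
  by code_simp

lemma rot5: "map crot (last rows) = row0"
  by code_simp

section \<open>Symmetries of the vertex set\<close>

definition vert_isometry :: "(real^4 \<Rightarrow> real^4) \<Rightarrow> bool" where
  "vert_isometry f \<longleftrightarrow> orthogonal_transformation f \<and> f ` verts = verts"

lemma finite_verts: "finite verts"
  by (simp add: verts_codes)

lemma vert_isometryI: "orthogonal_transformation f \<Longrightarrow> f ` verts \<subseteq> verts \<Longrightarrow> vert_isometry f"
  unfolding vert_isometry_def
  by (meson endo_inj_surj finite_verts inj_on_subset orthogonal_transformation_inj subset_UNIV)

lemma vert_isometry_comp: "vert_isometry f \<Longrightarrow> vert_isometry g \<Longrightarrow> vert_isometry (f \<circ> g)"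
  unfolding vert_isometry_def image_comp[symmetric] by (simp add: orthogonal_transformation_compose)

lemma vert_isometry_inv: "vert_isometry f \<Longrightarrow> vert_isometry (inv_into UNIV f)"
  unfolding vert_isometry_def
  by (metis image_inv_f_f orthogonal_transformation_inj orthogonal_transformation_inv)

lemma vert_isometry_inner: "vert_isometry f \<Longrightarrow> f x \<bullet> f y = x \<bullet> y"
  by (simp add: vert_isometry_def orthogonal_transformation_def)

lemma vert_isometry_uminus: "vert_isometry uminus"
proof (rule vert_isometryI)
  show "uminus ` verts \<subseteq> verts"
  proof -
    have "cneg c \<in> set codes" if "c \<in> set codes" for c
    proof -
      have "cneg (cneg c) = c" by (cases c rule: prod_cases4) (auto elim!: zneg.elims)
      then show ?thesis using that by (auto simp: codes_def Let_def)
    qed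
    then show ?thesis
      unfolding verts_codes image_image vec_of_code_cneg[symmetric] by blast
  qed
qed (simp add: orthogonal_transformation_def linear_uminus)

lemma crot_rows:
  assumes "c \<in> set (concat rows)"
  shows "crot c \<in> set (concat rows)"
proof -
  have "set (map crot (concat rows)) \<subseteq> set (concat rows)"
    using rot5 by (simp add: rows_def Let_def) blast
  then show ?thesis using assms by auto
qed

lemma vert_isometry_rot: "vert_isometry rot"
proof (rule vert_isometryI[OF orthogonal_rot], clarify)
  fix x assume "x \<in> verts"
  have neg: "- v \<in> verts" if "v \<in> verts" for v
    using vert_isometry_uminus that by (auto simp: vert_isometry_def)
  have *: "rot (vec_of_code c) \<in> verts" if "c \<in> set (concat rows)" for c
    using crot_rows[OF that] rot_vec_of_code[of c] even_codes that by (auto simp: verts_codes codes_def Let_def)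
  from \<open>x \<in> verts\<close> obtain c where c: "c \<in> set (concat rows)" and "x = vec_of_code c \<or> x = - vec_of_code c"
    unfolding verts_codes codes_def Let_def set_append set_map image_Un image_image vec_of_code_cneg by blast
  then show "rot x \<in> verts"
    using *[OF c] neg linear_neg[OF linear_rot] by auto
qed

text \<open>Signed even permutations form a group, so they preserve each of the three families of vertices
and act transitively on it.\<close>

lemma vert_isometry_signed_perm:
  assumes "x \<in> signed_even_perms c"
  shows "\<exists>f. vert_isometry f \<and> f c = x"
proof -
  from assms obtain s p where x: "x = (\<chi> i. s i * c $ p i)"
    and s: "\<And>i. s i \<in> {1, - 1}" and p: "p permutes UNIV" "evenperm p"
    unfolding signed_even_perms_def by blast
  define f :: "real^4 \<Rightarrow> real^4" where "f y = (\<chi> i. s i * y $ p i)" for y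
  have ss: "s i * s i = 1" for i using s[of i] by auto
  have "f y \<bullet> f z = y \<bullet> z" for y z
  proof -
    have "f y \<bullet> f z = (\<Sum>i\<in>UNIV. (s i * s i) * (y $ p i * z $ p i))"
      by (simp add: f_def inner_vec_def mult_ac)
    also have "\<dots> = (\<Sum>i\<in>UNIV. y $ p i * z $ p i)" by (simp add: ss)
    also have "\<dots> = y \<bullet> z"
      using sum.permute[OF p(1), of "\<lambda>i. y $ i * z $ i"] by (simp add: inner_vec_def o_def)
    finally show ?thesis .
  qed
  moreover have "linear f"
    by (rule linearI) (simp_all add: f_def vec_eq_iff algebra_simps)
  ultimately have orth: "orthogonal_transformation f" by (simp add: orthogonal_transformation_def)
  have closed: "f y \<in> signed_even_perms d" if y: "y \<in> signed_even_perms d" for y d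
  proof -
    from y obtain s' p' where y: "y = (\<chi> i. s' i * d $ p' i)"
      and s': "\<And>i. s' i \<in> {1, - 1}" and p': "p' permutes UNIV" "evenperm p'"
      unfolding signed_even_perms_def by blast
    have perm: "permutation p" "permutation p'"
      using p p' by (auto simp: permutation_permutes)
    have "f y = (\<chi> i. (s i * s' (p i)) * d $ (p' \<circ> p) i)"
      by (simp add: f_def y vec_eq_iff)
    moreover have "s i * s' (p i) \<in> {1, - 1}" for i using s[of i] s'[of "p i"] by auto
    moreover have "p' \<circ> p permutes UNIV" using p p' by (simp add: permutes_compose)
    moreover have "evenperm (p' \<circ> p)" using perm p p' by (simp add: evenperm_comp)
    ultimately show ?thesis
      unfolding signed_even_perms_def
      by (intro CollectI exI[of _ "\<lambda>i. s i * s' (p i)"] exI[of _ "p' \<circ> p"]) blast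
  qed
  have "vert_isometry f"
    by (rule vert_isometryI[OF orth]) (use closed in \<open>auto simp: verts_def\<close>)
  then show ?thesis using x by (auto simp: f_def)
qed

definition e1 :: "real^4" where "e1 = vector [1, 0, 0, 0]"

lemma e1_inner [simp]: "e1 \<bullet> x = x $ 1" "x \<bullet> e1 = x $ 1"
  by (simp_all add: e1_def inner_vec_def sum_4)

text \<open>Signed even permutations connect the vertices within each of the three families, and \<open>rot\<close> moves
a member of each of the two small families into the large one.\<close>

lemma vert_transitive:
  assumes "x \<in> verts"
  shows "\<exists>f. vert_isometry f \<and> f e1 = x"
proof -
  define R where "R a b \<longleftrightarrow> (\<exists>f. vert_isometry f \<and> f a = b)" for a b
  have trans: "R a c" if "R a b" "R b c" for a b c
    using that vert_isometry_comp unfolding R_def by (metis o_apply)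
  have sym: "R b a" if "R a b" for a b
    using that vert_isometry_inv unfolding R_def vert_isometry_def
    by (metis inv_f_f orthogonal_transformation_inj vert_isometry_def)
  let ?h = "vector [1/2, 1/2, 1/2, 1/2] :: real^4"
  let ?w = "vector [golden/2, 1/2, 1/(2*golden), 0] :: real^4"
  have w: "?w = vec_of_code ((0,1),(1,0),(-1,1),(0,0))"
    using inverse_golden by (simp add: vec_eq_iff forall_4 zphi_val.simps field_simps)
  have "((-1,1),(1,0),(0,0),(0,1)) \<in> (\<Union>y\<in>set (arrangements ((0,1),(1,0),(-1,1),(0,0))). set (csigns y))"
    by (rule UN_I[of "((-1,1),(1,0),(0,0),(0,1))"]) (simp, simp only: set_csigns set_zsigns simp_thms)
  moreover have "rot e1 = vec_of_code ((-1,1),(1,0),(0,0),(0,1))"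
    by (simp add: e1_def rot_def vec_eq_iff forall_4 zphi_val.simps)
  ultimately have "rot e1 \<in> signed_even_perms ?w"
    unfolding w signed_even_perms_code by (simp only: imageI)
  then have "R ?w (rot e1)" unfolding R_def by (rule vert_isometry_signed_perm)
  moreover have rot: "R a (rot a)" for a
    unfolding R_def using vert_isometry_rot by blast
  ultimately have 1: "R e1 ?w" using sym trans by blast
  have "((-1,0),(0,1),(0,0),(-1,1)) \<in> (\<Union>y\<in>set (arrangements ((0,1),(1,0),(-1,1),(0,0))). set (csigns y))"
    by (rule UN_I[of "((1,0),(0,1),(0,0),(-1,1))"]) (simp, simp add: set_csigns set_zsigns del: csigns.simps zsigns.simps)
  moreover have "rot ?h = vec_of_code ((-1,0),(0,1),(0,0),(-1,1))"
    by (simp add: rot_def vec_eq_iff forall_4 zphi_val.simps field_simps)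
  ultimately have "rot ?h \<in> signed_even_perms ?w"
    unfolding w signed_even_perms_code by (simp only: imageI)
  then have "R ?w (rot ?h)" unfolding R_def by (rule vert_isometry_signed_perm)
  then have 2: "R e1 ?h" using 1 rot sym trans by blast
  have "R e1 x"
    using assms 1 2 trans vert_isometry_signed_perm unfolding verts_def e1_def[symmetric] R_def
    by (metis (no_types, lifting) R_def Un_iff)
  then show ?thesis by (simp add: R_def)
qed

section \<open>Vertices and edges of the 600-cell\<close>

lemma norm_verts: "x \<in> verts \<Longrightarrow> x \<bullet> x = 1"
  using vert_transitive[of x] vert_isometry_inner by (metis e1_def e1_inner(1) vector_4(1))

lemma first_coordinates:
  "\<forall>c\<in>set codes. c = ((2,0),(0,0),(0,0),(0,0)) \<or> fst c = (0,1) \<or>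
    fst c \<in> {(1,0), (-1,1), (0,0), (1,-1), (-1,0), (0,-1), (-2,0)}"
  by code_simp

lemma e1_code: "e1 = vec_of_code ((2,0),(0,0),(0,0),(0,0))"
  by (simp add: e1_def vec_eq_iff forall_4 zphi_val.simps)

text \<open>By transitivity one of the two vertices may be taken to be \<open>e1\<close>; the inner product is then the first
coordinate of the other one.\<close>

lemma inner_cases:
  assumes "x \<in> verts" "y \<in> verts" "x \<noteq> y"
  shows "x \<bullet> y = golden / 2 \<or> x \<bullet> y \<le> 1 / 2"
proof -
  obtain f where f: "vert_isometry f" "f e1 = x" using vert_transitive[OF assms(1)] by blast
  obtain z where z: "z \<in> verts" "y = f z" using f assms(2) by (auto simp: vert_isometry_def)
  then have ne: "z \<noteq> e1" using f assms(3) by auto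
  have xy: "x \<bullet> y = z $ 1" using vert_isometry_inner[OF f(1), of e1 z] f z by simp
  obtain c where c: "c \<in> set codes" "z = vec_of_code c" using z by (auto simp: verts_codes)
  have z1: "z $ 1 = zphi_val (fst c)" unfolding c(2) by (cases c rule: prod_cases4) simp
  have "c \<noteq> ((2,0),(0,0),(0,0),(0,0))" using ne c e1_code by auto
  then have "fst c = (0,1) \<or> fst c \<in> {(1,0), (-1,1), (0,0), (1,-1), (-1,0), (0,-1), (-2,0)}"
    using first_coordinates c(1) by blast
  then show ?thesis
    unfolding xy z1 using golden_bounds by (auto simp: zphi_val.simps)
qed

text \<open>The twelve neighbours of \<open>e1\<close>, which form an icosahedron.\<close>

lemma neighbours_e1:
  assumes "s = 1 \<or> s = - 1" "t = 1 \<or> t = - 1"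
  shows "vector [golden/2, s/2, t*(golden-1)/2, 0] \<in> verts"
    "vector [golden/2, s*(golden-1)/2, 0, t/2] \<in> verts"
    "vector [golden/2, 0, s/2, t*(golden-1)/2] \<in> verts"
proof -
  define z :: "real \<Rightarrow> zphi \<Rightarrow> zphi" where "z s x = (if s = 1 then x else zneg x)" for s x
  have zphi_val: "zphi_val (z s x) = s * zphi_val x" "zphi_val (z t x) = t * zphi_val x" for x
    using assms by (auto simp: z_def)
  have mem: "z s x \<in> set (zsigns x)" "x \<in> set (zsigns x)" for s x
    by (simp_all only: set_zsigns z_def) auto
  have all: "x \<in> set all_codes" if "y \<in> set (arrangements ((0,1),(1,0),(-1,1),(0,0)))" "x \<in> set (csigns y)" for x y
    using that unfolding all_codes_def set_concat set_map set_append by blast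
  have 1: "((0,1), z s (1,0), z t (-1,1), (0,0)) \<in> set all_codes"
    by (rule all[of "((0,1), (1,0), (-1,1), (0,0))"]) (simp, simp only: set_csigns mem simp_thms)
  have 2: "((0,1), z s (-1,1), (0,0), z t (1,0)) \<in> set all_codes"
    by (rule all[of "((0,1), (-1,1), (0,0), (1,0))"]) (simp, simp only: set_csigns mem simp_thms)
  have 3: "((0,1), (0,0), z s (1,0), z t (-1,1)) \<in> set all_codes"
    by (rule all[of "((0,1), (0,0), (1,0), (-1,1))"]) (simp, simp only: set_csigns mem simp_thms)
  have zero: "zphi_val (0, 0) = 0" "zphi_val (0, 1) = golden / 2" "zphi_val (1, 0) = 1 / 2" "zphi_val (-1, 1) = (golden - 1) / 2"
    by (simp_all add: zphi_val.simps)
  show "vector [golden/2, s/2, t*(golden-1)/2, 0] \<in> verts"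
    "vector [golden/2, s*(golden-1)/2, 0, t/2] \<in> verts"
    "vector [golden/2, 0, s/2, t*(golden-1)/2] \<in> verts"
    unfolding verts_all_codes
    using imageI[OF 1, of vec_of_code] imageI[OF 2, of vec_of_code] imageI[OF 3, of vec_of_code] by (simp_all add: zphi_val zero)
qed

text \<open>A functional \<open>n\<close> with maximum \<open>h\<close> at \<open>e1\<close> is bounded by \<open>h\<close> on the twelve neighbours.  With
\<open>a, b, c\<close> the absolute values of the last three coordinates of \<open>n\<close>, this says that \<open>a + b / \<phi>\<close>,
\<open>c + a / \<phi>\<close> and \<open>b + c / \<phi>\<close> are at most \<open>(2 - \<phi>) h\<close>.  Each of \<open>a, b, c\<close> is then small, and so is
their sum; hence \<open>a\<^sup>2 + b\<^sup>2 + c\<^sup>2\<close> is at most \<open>0.271 h\<^sup>2\<close>.  By the Cauchy-Schwarz inequality, a unit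
vector at an angle of at least 60 degrees from \<open>e1\<close> does not reach the value \<open>h\<close>.\<close>

lemma e1_not_supporting:
  assumes "n $ 1 = h" "h > 0" and le: "\<And>z. z \<in> verts \<Longrightarrow> n \<bullet> z \<le> h"
    and y: "y \<bullet> y = 1" "y $ 1 \<le> 1 / 2"
  shows "n \<bullet> y \<noteq> h"
proof
  assume eq: "n \<bullet> y = h"
  let ?k = "382 / 1000 * h" and ?i = "golden - 1"
  define a b c where "a = \<bar>n $ 2\<bar>" and "b = \<bar>n $ 3\<bar>" and "c = \<bar>n $ 4\<bar>"
  have ngh: "n \<bullet> vector [golden/2, p, q, r] = golden * h / 2 + n$2 * p + n$3 * q + n$4 * r" for p q r
    using assms(1) by (simp add: inner_vec_def sum_4)
  have sg: "\<exists>s. (s = 1 \<or> s = - 1) \<and> s * x = \<bar>x\<bar>" for x :: real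
    by (cases "x \<ge> 0") (auto intro: exI[of _ 1] exI[of _ "- 1"])
  obtain s2 s3 s4 where s: "s2 = 1 \<or> s2 = - 1" "s2 * n$2 = a" "s3 = 1 \<or> s3 = - 1" "s3 * n$3 = b"
      "s4 = 1 \<or> s4 = - 1" "s4 * n$4 = c"
    using sg[of "n$2"] sg[of "n$3"] sg[of "n$4"] unfolding a_def b_def c_def by metis
  have g: "(2 - golden) * h \<le> ?k" using golden_bounds assms(2) by (intro mult_right_mono) auto
  have "a + ?i * b \<le> (2 - golden) * h"
    using le[OF neighbours_e1(1)[OF s(1,3)]] unfolding ngh s(2,4)[symmetric] by (simp add: field_simps)
  then have 1: "a + ?i * b \<le> ?k" using g by linarith
  have "?i * a + c \<le> (2 - golden) * h"
    using le[OF neighbours_e1(2)[OF s(1,5)]] unfolding ngh s(2,6)[symmetric] by (simp add: field_simps)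
  then have 2: "?i * a + c \<le> ?k" using g by linarith
  have "b + ?i * c \<le> (2 - golden) * h"
    using le[OF neighbours_e1(3)[OF s(3,5)]] unfolding ngh s(4,6)[symmetric] by (simp add: field_simps)
  then have 3: "b + ?i * c \<le> ?k" using g by linarith
  have pos: "a \<ge> 0" "b \<ge> 0" "c \<ge> 0" by (simp_all add: a_def b_def c_def)
  have i: "?i * x \<ge> 618 / 1000 * x" if "x \<ge> 0" for x
    using golden_bounds that by (intro mult_right_mono) auto
  have abc: "a \<le> ?k" "b \<le> ?k" "c \<le> ?k" "a + b + c \<le> 709 / 1000 * h"
    using 1 2 3 i[OF pos(1)] i[OF pos(2)] i[OF pos(3)] pos assms(2) by linarith+
  define q where "q = (n$2)\<^sup>2 + (n$3)\<^sup>2 + (n$4)\<^sup>2"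
  have "q = a * a + b * b + c * c"
    by (simp add: q_def a_def b_def c_def power2_eq_square)
  also have "\<dots> \<le> ?k * a + ?k * b + ?k * c"
    using abc pos by (intro add_mono mult_right_mono) auto
  also have "\<dots> = ?k * (a + b + c)" by (simp add: algebra_simps)
  also have "\<dots> \<le> ?k * (709 / 1000 * h)"
    using abc(4) assms(2) by (intro mult_left_mono) auto
  also have "\<dots> = 270838 / 1000000 * (h * h)" by simp
  also have "\<dots> \<le> 271 / 1000 * (h * h)" by (intro mult_right_mono) simp_all
  finally have q: "q \<le> 271 / 1000 * (h * h)" .
  let ?u = "1 - y $ 1"
  define r where "r = (y$2)\<^sup>2 + (y$3)\<^sup>2 + (y$4)\<^sup>2"
  have r: "r = ?u * (1 + y $ 1)"
    using y(1) by (simp add: r_def inner_vec_def sum_4 power2_eq_square algebra_simps)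
  have dot: "?u * h = n$2 * y$2 + n$3 * y$3 + n$4 * y$4"
    using eq assms(1) by (simp add: inner_vec_def sum_4 algebra_simps)
  have "(n$2 * y$2 + n$3 * y$3 + n$4 * y$4)\<^sup>2 \<le> q * r"
    using Cauchy_Schwarz_ineq[of "vector [n$2, n$3, n$4] :: real^3" "vector [y$2, y$3, y$4]"]
    by (simp add: inner_vec_def sum_3 q_def r_def power2_eq_square)
  then have "(?u * h)\<^sup>2 \<le> q * r" unfolding dot .
  also have "\<dots> \<le> 271 / 1000 * (h * h) * r"
    by (rule mult_right_mono[OF q]) (simp add: r_def)
  also have "\<dots> = (?u * (h * h)) * (271 / 1000 * (1 + y $ 1))" by (simp add: r)
  finally have "(?u * (h * h)) * ?u \<le> (?u * (h * h)) * (271 / 1000 * (1 + y $ 1))"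
    by (simp add: power2_eq_square mult_ac)
  moreover have "?u * (h * h) > 0" using y(2) assms(2) by simp
  ultimately have "?u \<le> 271 / 1000 * (1 + y $ 1)" by (simp only: mult_le_cancel_left_pos)
  then show False using y(2) by simp
qed

lemma not_supporting:
  assumes x: "x \<in> verts" "n \<bullet> x = h" and h: "h > 0" and le: "\<And>z. z \<in> verts \<Longrightarrow> n \<bullet> z \<le> h"
    and y: "y \<in> verts" "x \<bullet> y \<le> 1 / 2"
  shows "n \<bullet> y \<noteq> h"
proof -
  obtain f where f: "vert_isometry f" "f e1 = x" using vert_transitive[OF x(1)] by blast
  then have "surj f" by (simp add: vert_isometry_def orthogonal_transformation_surj)
  then obtain m z where m: "n = f m" and z: "y = f z" by (meson surjE)
  have inner: "f a \<bullet> f b = a \<bullet> b" for a b by (rule vert_isometry_inner[OF f(1)])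
  have "m \<bullet> z \<noteq> h"
  proof (rule e1_not_supporting)
    show "m $ 1 = h" using x(2) inner[of m e1] f(2) by (simp add: m)
    show "m \<bullet> v \<le> h" if "v \<in> verts" for v
    proof -
      have "f v \<in> verts" using f(1) that by (auto simp: vert_isometry_def)
      then show ?thesis using le[of "f v"] inner[of m v] by (simp add: m)
    qed
    show "z \<bullet> z = 1" using norm_verts[OF y(1)] inner[of z z] by (simp add: z)
    show "z $ 1 \<le> 1 / 2" using y(2) inner[of e1 z] f(2) by (simp add: z)
  qed (rule h)
  then show ?thesis using inner[of m z] by (simp add: m z)
qed

lemma cell600_hull: "cell600 = convex hull verts"
  by (simp add: cell600_def verts_def)

text \<open>A face of the convex hull of a finite set is the convex hull of the points of the set that it
contains.\<close>

lemma face_of_hull_supporting: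
  fixes S :: "'a::euclidean_space set"
  assumes "finite S" "\<And>z. z \<in> S \<Longrightarrow> n \<bullet> z \<le> h"
  shows "convex hull {z \<in> S. n \<bullet> z = h} face_of convex hull S"
proof -
  let ?F = "convex hull S \<inter> {x. n \<bullet> x = h}"
  have "convex hull S \<subseteq> {x. n \<bullet> x \<le> h}"
    using assms(2) by (intro hull_minimal convex_halfspace_le) auto
  then have face: "?F face_of convex hull S"
    by (intro face_of_Int_supporting_hyperplane_le convex_convex_hull) auto
  then obtain S' where S': "S' \<subseteq> S" "?F = convex hull S'"
    using face_of_convex_hull_subset[OF finite_imp_compact[OF assms(1)]] by metis
  have "S' \<subseteq> ?F" unfolding S'(2) by (rule hull_subset)
  then have "S' \<subseteq> {z \<in> S. n \<bullet> z = h}" using S'(1) by blast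
  then have "?F \<subseteq> convex hull {z \<in> S. n \<bullet> z = h}"
    unfolding S'(2) by (rule hull_mono)
  moreover have "convex hull {z \<in> S. n \<bullet> z = h} \<subseteq> ?F"
    by (intro hull_minimal convex_Int convex_convex_hull convex_hyperplane) (auto intro: hull_inc)
  ultimately show ?thesis using face by simp
qed

lemma golden_half: "1 / 2 < golden / 2" "golden / 2 < 1"
  using golden_bounds by auto

text \<open>The functional \<open>x\<close> attains its maximum over the vertices at \<open>x\<close> only.\<close>

lemma polytope_vertices_cell600: "polytope_vertices cell600 = verts"
proof
  show "polytope_vertices cell600 \<subseteq> verts"
    by (auto simp: polytope_vertices_def cell600_hull dest: extreme_point_of_convex_hull)
  show "verts \<subseteq> polytope_vertices cell600"
  proof
    fix x assume x: "x \<in> verts"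
    have less: "x \<bullet> z < 1" if "z \<in> verts" "z \<noteq> x" for z
      using inner_cases[OF x that(1)] that(2) golden_half by auto
    have "{z \<in> verts. x \<bullet> z = 1} = {x}"
      using less norm_verts x by force
    moreover have "convex hull {z \<in> verts. x \<bullet> z = 1} face_of convex hull verts"
      by (rule face_of_hull_supporting[OF finite_verts]) (use less norm_verts x in force)
    ultimately show "x \<in> polytope_vertices cell600"
      by (simp add: polytope_vertices_def cell600_hull face_of_singleton)
  qed
qed

text \<open>The functional \<open>x + y\<close> has the value \<open>1 + \<phi>/2\<close> at \<open>x\<close> and \<open>y\<close>.  At any other vertex both inner
products are at most \<open>\<phi>/2\<close>, and \<open>\<phi> < 1 + \<phi>/2\<close>.\<close>

lemma edge_of_cell600:
  assumes xy: "x \<in> verts" "y \<in> verts" "x \<bullet> y = golden / 2"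
  shows "closed_segment x y edge_of cell600"
proof -
  have ne: "x \<noteq> y" using xy norm_verts golden_half by auto
  have sum: "(x + y) \<bullet> z < 1 + golden / 2" if z: "z \<in> verts" "z \<noteq> x" "z \<noteq> y" for z
    using inner_cases[OF xy(1) z(1)] inner_cases[OF xy(2) z(1)] z golden_half
    by (auto simp: inner_add_left)
  have at: "(x + y) \<bullet> x = 1 + golden / 2" "(x + y) \<bullet> y = 1 + golden / 2"
    using xy(3) norm_verts[OF xy(1)] norm_verts[OF xy(2)] inner_commute[of y x]
    by (simp_all add: inner_add_left)
  have "{z \<in> verts. (x + y) \<bullet> z = 1 + golden / 2} = {x, y}"
    using sum at xy by force
  moreover have "convex hull {z \<in> verts. (x + y) \<bullet> z = 1 + golden / 2} face_of convex hull verts"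
    by (rule face_of_hull_supporting[OF finite_verts]) (use sum at in force)
  ultimately have "closed_segment x y face_of cell600"
    by (simp add: cell600_hull segment_convex_hull)
  moreover have "aff_dim (closed_segment x y) = 1"
    using ne by (simp add: segment_convex_hull aff_dim_convex_hull aff_dim_2)
  ultimately show ?thesis by (simp add: edge_of_def)
qed

lemma card_verts: "card verts = 120"
proof -
  have "inj_on vec_of_code (set codes)" by (rule inj_onI) simp
  then show ?thesis
    unfolding verts_codes by (simp add: card_image distinct_card[OF distinct_codes] length_codes)
qed

lemma uminus_verts: "x \<in> verts \<Longrightarrow> - x \<in> verts"
  using vert_isometry_uminus by (auto simp: vert_isometry_def)

text \<open>Every face of a polyhedron is exposed by some functional, and \<open>not_supporting\<close> excludes a functional
that is maximal at two vertices with inner product at most \<open>1/2\<close>.  The maximum \<open>h\<close> is positive: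
otherwise the functional would be constant on the centrally symmetric vertex set, and all
120 vertices would lie on the segment.\<close>

lemma edge_of_cell600_inner:
  assumes e: "closed_segment x y edge_of cell600"
  shows "x \<in> verts" "y \<in> verts" "x \<bullet> y = golden / 2"
proof -
  let ?s = "closed_segment x y"
  have face: "?s face_of cell600" and dim: "aff_dim ?s = 1" using e by (auto simp: edge_of_def)
  have ext: "z extreme_point_of ?s \<longleftrightarrow> z \<in> verts \<and> z \<in> ?s" for z
    using extreme_point_of_face[OF face, of z] polytope_vertices_cell600
    by (auto simp: polytope_vertices_def)
  show x: "x \<in> verts" and y: "y \<in> verts"
    using ext[of x] ext[of y] by (auto simp: extreme_point_of_segment)
  have "x \<noteq> y" using dim by auto
  show "x \<bullet> y = golden / 2"
  proof (rule ccontr)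
    assume "x \<bullet> y \<noteq> golden / 2"
    then have small: "x \<bullet> y \<le> 1 / 2" using inner_cases[OF x y \<open>x \<noteq> y\<close>] by blast
    have "polyhedron cell600" unfolding cell600_hull using finite_verts by (rule polyhedron_convex_hull)
    then have "?s exposed_face_of cell600" using face by (simp add: exposed_face_of_polyhedron)
    then obtain n h where le: "cell600 \<subseteq> {z. n \<bullet> z \<le> h}" and s: "?s = cell600 \<inter> {z. n \<bullet> z = h}"
      unfolding exposed_face_of_def by blast
    have verts_P: "verts \<subseteq> cell600" unfolding cell600_hull by (rule hull_subset)
    have le': "n \<bullet> z \<le> h" if "z \<in> verts" for z using le verts_P that by blast
    have nx: "n \<bullet> x = h" and ny: "n \<bullet> y = h" using s by auto
    have "h > 0"
    proof (rule ccontr)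
      assume "\<not> h > 0"
      then have "n \<bullet> z = h" if "z \<in> verts" for z
        using le'[OF that] le'[OF uminus_verts[OF that]] le'[OF uminus_verts[OF x]] nx by simp
      then have "verts \<subseteq> ?s" unfolding s using verts_P by blast
      then have "verts \<subseteq> {x, y}" using ext by (auto simp: extreme_point_of_segment)
      then have "card verts \<le> card {x, y}" by (intro card_mono) simp_all
      also have "\<dots> \<le> 2" by (simp add: card_insert_if)
      finally show False by (simp add: card_verts)
    qed
    then show False using not_supporting[OF x nx _ le' y small] ny by blast
  qed
qed

abbreviation E600 :: "(real^4) set set" where "E600 \<equiv> polytope_edges cell600"

lemma E600_iff: "{x, y} \<in> E600 \<longleftrightarrow> x \<in> verts \<and> y \<in> verts \<and> x \<bullet> y = golden / 2"
proof
  assume "{x, y} \<in> E600"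
  then obtain a b where ab: "{x, y} = {a, b}" "closed_segment a b edge_of cell600"
    by (auto simp: polytope_edges_def)
  then show "x \<in> verts \<and> y \<in> verts \<and> x \<bullet> y = golden / 2"
    using edge_of_cell600_inner[OF ab(2)] by (auto simp: doubleton_eq_iff inner_commute)
qed (use edge_of_cell600 in \<open>auto simp: polytope_edges_def\<close>)

section \<open>The moves and their orbit of states\<close>

definition blocks :: "code list list" where "blocks = rows @ map (map cneg) rows"

lemma length_blocks: "length rows = 5" "length blocks = 10"
  by (simp_all add: blocks_def rows_def Let_def)

lemma concat_blocks: "concat blocks = codes"
  by (simp add: blocks_def codes_def Let_def map_concat)

lemma distinct_concat_nth:
  "distinct (concat xs) \<Longrightarrow> i < length xs \<Longrightarrow> j < length xs \<Longrightarrow> x \<in> set (xs ! i) \<Longrightarrow> x \<in> set (xs ! j) \<Longrightarrow> i = j"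
proof (induction xs arbitrary: i j)
  case (Cons y ys)
  have "x \<notin> set (ys ! k)" if "x \<in> set y" "k < length ys" for k
  proof
    assume "x \<in> set (ys ! k)"
    moreover have "ys ! k \<in> set ys" using that(2) by (rule nth_mem)
    ultimately have "x \<in> set y \<inter> set (concat ys)" using that(1) by auto
    then show False using Cons.prems(1) unfolding concat.simps distinct_append by blast
  qed
  then show ?case using Cons by (cases i; cases j) auto
qed simp

text \<open>Block \<open>k\<close> and block \<open>k + 5\<close> are antipodal to each other and together form the coset \<open>k\<close>, for \<open>k < 5\<close>.
So \<open>block_index x mod 5\<close> is the coset of \<open>x\<close>, and whether \<open>block_index x < 5\<close> tells in which half it lies.\<close>

definition block_index :: "real^4 \<Rightarrow> nat" where "block_index x = (THE k. k < 10 \<and> x \<in> vec_of_code ` set (blocks ! k))"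

lemma block_index_eq: "k < 10 \<Longrightarrow> x \<in> vec_of_code ` set (blocks ! k) \<Longrightarrow> block_index x = k"
  unfolding block_index_def
proof (rule the_equality)
  assume k: "k < 10" "x \<in> vec_of_code ` set (blocks ! k)"
  then show "k < 10 \<and> x \<in> vec_of_code ` set (blocks ! k)" ..
  fix l assume l: "l < 10 \<and> x \<in> vec_of_code ` set (blocks ! l)"
  obtain c where "c \<in> set (blocks ! k)" "x = vec_of_code c" using k by blast
  moreover obtain d where "d \<in> set (blocks ! l)" "x = vec_of_code d" using l by blast
  ultimately have "c \<in> set (blocks ! k)" "c \<in> set (blocks ! l)" by simp_all
  then show "l = k"
    using distinct_concat_nth[of blocks l k c] distinct_codes k(1) l
    by (simp add: concat_blocks length_blocks)
qed

lemma block_index: "x \<in> verts \<Longrightarrow> block_index x < 10 \<and> x \<in> vec_of_code ` set (blocks ! block_index x)"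
proof -
  assume "x \<in> verts"
  then obtain c where c: "c \<in> set (concat blocks)" "x = vec_of_code c" by (auto simp: verts_codes concat_blocks)
  then obtain b where "b \<in> set blocks" "c \<in> set b" by auto
  then obtain k where k: "k < 10" "c \<in> set (blocks ! k)"
    unfolding in_set_conv_nth[of b] length_blocks by blast
  then have "block_index x = k" using c(2) by (intro block_index_eq) auto
  then show ?thesis using k c(2) by simp
qed

lemma block_verts: "k < 10 \<Longrightarrow> vec_of_code ` set (blocks ! k) \<subseteq> verts"
  unfolding verts_codes concat_blocks[symmetric] by (auto simp: length_blocks intro!: imageI bexI[of _ "blocks ! k"])

text \<open>The move at a vertex is its whole coset.  A state chooses one half of each coset, so applying a move
exchanges the two halves of one coset, and the orbit has 32 elements.\<close>

definition move600 :: "real^4 \<Rightarrow> (real^4) set" where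
  "move600 v = {x \<in> verts. block_index x mod 5 = block_index v mod 5}"

definition state600 :: "(nat \<Rightarrow> bool) \<Rightarrow> (real^4) set" where
  "state600 s = {x \<in> verts. s (block_index x mod 5) \<longleftrightarrow> block_index x < 5}"

lemma state600_move: "sym_diff (move600 v) (state600 s) = state600 (s(block_index v mod 5 := \<not> s (block_index v mod 5)))"
  by (auto simp: move600_def state600_def)

lemma state600_compl: "verts - state600 s = state600 (\<lambda>i. \<not> s i)"
  by (auto simp: state600_def)

fun cflip :: "bool \<Rightarrow> code list \<Rightarrow> code list" where
  "cflip True r = r" | "cflip False r = map cneg r"

definition cstate :: "bool list \<Rightarrow> code list" where "cstate bs = concat (map2 cflip bs rows)"

lemma state600_cstate: "state600 s = vec_of_code ` set (cstate [s 0, s 1, s 2, s 3, s 4])"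
proof -
  have rows: "rows = map (\<lambda>i. blocks ! i) [0..<5]" 
    by (rule nth_equalityI) (simp_all add: length_blocks blocks_def nth_append)
  have neg: "map cneg (blocks ! i) = blocks ! (i + 5)" if "i < 5" for i
    using that by (simp add: blocks_def nth_append length_blocks)
  have up: "[0..<5] = [0, 1, 2, 3, 4::nat]" by (simp add: upt_rec)
  have flip: "cflip b (blocks ! i) = blocks ! (if b then i else i + 5)" if "i < 5" for b i
    using neg[OF that] by (cases b) simp_all
  have "set (cstate [s 0, s 1, s 2, s 3, s 4]) = (\<Union>i\<in>{0, 1, 2, 3, 4}. set (blocks ! (if s i then i else i + 5)))"
    unfolding cstate_def rows up by (simp add: flip)
  also have "{0, 1, 2, 3, 4} = {..<5::nat}" by auto
  finally have set: "vec_of_code ` set (cstate [s 0, s 1, s 2, s 3, s 4]) = (\<Union>i<5. vec_of_code ` set (blocks ! (if s i then i else i + 5)))"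
    by (simp add: image_UN)
  show ?thesis unfolding set
  proof (intro equalityI subsetI)
    fix x assume x: "x \<in> state600 s"
    let ?i = "block_index x mod 5"
    have "block_index x < 10" "x \<in> vec_of_code ` set (blocks ! block_index x)" "s ?i \<longleftrightarrow> block_index x < 5"
      using block_index[of x] x unfolding state600_def by blast+
    moreover from this(1) have "?i = (if block_index x < 5 then block_index x else block_index x - 5)"
      by (simp add: le_mod_geq)
    moreover from calculation have "(if s ?i then ?i else ?i + 5) = block_index x"
      by (cases "block_index x < 5") simp_all
    ultimately show "x \<in> (\<Union>i<5. vec_of_code ` set (blocks ! (if s i then i else i + 5)))"
      by (intro UN_I[of ?i]) (simp_all only: lessThan_iff mod_less_divisor zero_less_numeral)
  next
    fix x assume "x \<in> (\<Union>i<5. vec_of_code ` set (blocks ! (if s i then i else i + 5)))"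
    then obtain i where i: "i < 5" "x \<in> vec_of_code ` set (blocks ! (if s i then i else i + 5))" by blast
    then have "block_index x = (if s i then i else i + 5)" by (intro block_index_eq) auto
    moreover have "x \<in> verts" using i block_verts[of "if s i then i else i + 5"] by (auto split: if_splits)
    ultimately show "x \<in> state600 s" using i(1) by (auto simp: state600_def)
  qed
qed

section \<open>Connectivity of the states\<close>

lemma partition_measure: "length (filter P xs) + 2 * length (filter (\<lambda>x. \<not> P x) xs) \<le> 2 * length xs"
  using sum_length_filter_compl[of P xs] by simp

text \<open>Graph search: the elements of \<open>rest\<close> that cannot be reached from \<open>front\<close>.  Each round removes all
neighbours of the first element of \<open>front\<close> from \<open>rest\<close>, so few adjacency tests are evaluated.\<close>

function unreached :: "('a \<Rightarrow> 'a \<Rightarrow> bool) \<Rightarrow> 'a list \<Rightarrow> 'a list \<Rightarrow> 'a list" where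
  "unreached adj [] rest = rest"
| "unreached adj (x # front) rest =
    (let ab = List.partition (adj x) rest in unreached adj (fst ab @ front) (snd ab))"
  by pat_completeness auto
termination by (relation "Wellfounded.measure (\<lambda>(_, f, r). length f + 2 * length r)")
  (auto simp: o_def less_Suc_eq_le intro: partition_measure)

lemma unreached_Nil:
  assumes "unreached adj front rest = []" "set front \<subseteq> S" "set rest \<subseteq> S" "y \<in> set front \<union> set rest"
  shows "\<exists>x\<in>set front. (x, y) \<in> {(p, q). p \<in> S \<and> q \<in> S \<and> adj p q}\<^sup>*"
  using assms
proof (induction adj front rest rule: unreached.induct)
  case (2 adj x front rest)
  let ?R = "{(p, q). p \<in> S \<and> q \<in> S \<and> adj p q}"
  let ?a = "filter (adj x) rest" and ?b = "filter (Not \<circ> adj x) rest"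
  show ?case
  proof (cases "y \<in> insert x (set front)")
    case True
    then show ?thesis by auto
  next
    case False
    then have "y \<in> set (?a @ front) \<union> set ?b" using "2.prems"(4) by auto
    moreover have "unreached adj (?a @ front) ?b = []" using "2.prems"(1) by simp
    moreover have "set (?a @ front) \<subseteq> S" "set ?b \<subseteq> S" using "2.prems"(2,3) by auto
    ultimately have "\<exists>z\<in>set (?a @ front). (z, y) \<in> ?R\<^sup>*"
      using "2.IH"[OF HOL.refl] by (simp only: partition_filter_conv fst_conv snd_conv)
    then obtain z where z: "z \<in> set (?a @ front)" "(z, y) \<in> ?R\<^sup>*" by blast
    then consider "z \<in> set ?a" | "z \<in> set front" by auto
    then show ?thesis
    proof cases
      case 1
      then have "(x, z) \<in> ?R" using "2.prems" by auto
      then show ?thesis using z(2) by (auto intro: converse_rtrancl_into_rtrancl)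
    qed (use z in auto)
  qed
qed auto

definition cadj :: "code \<Rightarrow> code \<Rightarrow> bool" where "cadj u v \<longleftrightarrow> cdot u v = (0, 2)"

definition cconn :: "code list \<Rightarrow> bool" where "cconn xs \<longleftrightarrow> unreached cadj [hd xs] (tl xs) = []"

lemma connected_cconn:
  assumes "cconn xs" "xs \<noteq> []" "set xs \<subseteq> set codes"
  shows "induced_connected E600 (vec_of_code ` set xs)"
proof -
  let ?T = "vec_of_code ` set xs"
  let ?R = "{(p, q). p \<in> set xs \<and> q \<in> set xs \<and> cadj p q}" and ?Q = "{(x, y). x \<in> ?T \<and> y \<in> ?T \<and> {x, y} \<in> E600}"
  have step: "(vec_of_code p, vec_of_code q) \<in> ?Q" if "(p, q) \<in> ?R" for p q
    using that assms(3) by (auto simp: E600_iff cadj_def vec_of_code_inner zphi_val.simps verts_codes)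
  have lift: "(vec_of_code p, vec_of_code q) \<in> ?Q\<^sup>*" if "(p, q) \<in> ?R\<^sup>*" for p q
    using that
  proof (induction rule: rtrancl_induct)
    case (step y z)
    then show ?case using \<open>\<And>p q. (p, q) \<in> ?R \<Longrightarrow> (vec_of_code p, vec_of_code q) \<in> ?Q\<close> by (meson rtrancl.rtrancl_into_rtrancl)
  qed simp
  have from_hd: "(vec_of_code (hd xs), vec_of_code q) \<in> ?Q\<^sup>*" if "q \<in> set xs" for q
  proof -
    have "q \<in> set [hd xs] \<union> set (tl xs)" using that assms(2) by (cases xs) auto
    moreover have "set (tl xs) \<subseteq> set xs" "set [hd xs] \<subseteq> set xs" using assms(2) by (auto dest: list.set_sel(2))
    ultimately have "(hd xs, q) \<in> ?R\<^sup>*"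
      using unreached_Nil[of cadj "[hd xs]" "tl xs" "set xs" q] assms(1) by (simp add: cconn_def)
    then show ?thesis by (rule lift)
  qed
  have "sym ?Q" by (auto simp: sym_def insert_commute)
  then have "sym (?Q\<^sup>*)" by (rule sym_rtrancl)
  then have to_hd: "(vec_of_code q, vec_of_code (hd xs)) \<in> ?Q\<^sup>*" if "q \<in> set xs" for q
    using from_hd[OF that] by (rule symD)
  show ?thesis
    unfolding induced_connected_def using rtrancl_trans[OF to_hd from_hd] by blast
qed

text \<open>Isometries of the vertex set act on the graph, because adjacency is a condition on inner products.\<close>

lemma connected_isometry:
  assumes f: "vert_isometry f" and T: "T \<subseteq> verts" "induced_connected E600 T"
  shows "induced_connected E600 (f ` T)"
  unfolding induced_connected_def
proof (intro ballI)
  let ?R = "\<lambda>T. {(x, y). x \<in> T \<and> y \<in> T \<and> {x, y} \<in> E600}"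
  fix u v assume "u \<in> f ` T" "v \<in> f ` T"
  then obtain a b where ab: "a \<in> T" "b \<in> T" "u = f a" "v = f b" by blast
  have f_verts: "f x \<in> verts" if "x \<in> verts" for x using f that by (auto simp: vert_isometry_def)
  have "(a, b) \<in> (?R T)\<^sup>*" using T(2) ab unfolding induced_connected_def by blast
  then have "(f a, f b) \<in> (?R (f ` T))\<^sup>*"
  proof (induction rule: rtrancl_induct)
    case (step y z)
    then have "(f y, f z) \<in> ?R (f ` T)"
      using vert_isometry_inner[OF f] f_verts by (auto simp: E600_iff)
    then show ?case using step.IH by (rule rtrancl_into_rtrancl[rotated])
  qed simp
  then show "(u, v) \<in> (?R (f ` T))\<^sup>*" by (simp add: ab)
qed

text \<open>Up to cyclic shift and complement there are only four subsets of a five-element set, in the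
cyclic order of the cosets.\<close>

lemma cconn_states:
  "cconn (cstate [True, True, True, True, True])"
  "cconn (cstate [False, True, True, True, True])"
  "cconn (cstate [False, False, True, True, True])"
  "cconn (cstate [False, True, False, True, True])"
  by code_simp+

lemma set_cflip: "vec_of_code ` set (cflip b r) = (if b then vec_of_code ` set r else uminus ` vec_of_code ` set r)"
  by (cases b) (simp_all add: image_image)

lemma cstate_verts:
  assumes "length bs = 5"
  shows "vec_of_code ` set (cstate bs) \<subseteq> verts" "set (cstate bs) \<subseteq> set codes" "cstate bs \<noteq> []"
proof -
  obtain a b c d e where bs: "bs = [a, b, c, d, e]"
    using assms by (auto simp: length_Suc_conv numeral_eq_Suc)
  have block: "set (cflip b r) \<subseteq> set codes" if "r \<in> set rows" for b r
    using that by (cases b) (auto simp: codes_def Let_def)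
  obtain r0 r1 r2 r3 r4 where rows: "rows = [r0, r1, r2, r3, r4]"
    by (simp add: rows_def Let_def)
  show 1: "set (cstate bs) \<subseteq> set codes"
    using block[of r0 a] block[of r1 b] block[of r2 c] block[of r3 d] block[of r4 e]
    by (simp add: cstate_def bs rows)
  then show "vec_of_code ` set (cstate bs) \<subseteq> verts" unfolding verts_codes by (rule image_mono)
  have "cflip a row0 \<noteq> []" by (cases a) (simp_all add: row0_def)
  then show "cstate bs \<noteq> []" unfolding cstate_def bs by (simp add: rows_def Let_def)
qed

lemma rot_row:
  assumes "r \<in> set rows"
  shows "rot ` vec_of_code ` set (cflip b r) = vec_of_code ` set (cflip b (map crot r))"
proof -
  have "rot (vec_of_code c) = vec_of_code (crot c)" if "c \<in> set r" for c
    using rot_vec_of_code even_codes that assms by auto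
  then have "rot ` vec_of_code ` set r = vec_of_code ` crot ` set r" by (auto simp: image_image)
  moreover have "rot ` uminus ` A = uminus ` rot ` A" for A
    by (simp add: image_image linear_neg[OF linear_rot])
  ultimately show ?thesis by (simp add: set_cflip)
qed

lemma cstate_rot: "rot ` vec_of_code ` set (cstate [a, b, c, d, e]) = vec_of_code ` set (cstate [e, a, b, c, d])"
proof -
  define r0 r1 r2 r3 r4 where r: "r0 = row0" "r1 = map crot r0" "r2 = map crot r1" "r3 = map crot r2" "r4 = map crot r3"
  have rows: "rows = [r0, r1, r2, r3, r4]" by (simp add: rows_def Let_def r)
  have r5: "map crot r4 = r0" using rot5 by (simp add: rows r(1))
  have "rot ` vec_of_code ` set (cstate [a, b, c, d, e]) =
      rot ` vec_of_code ` set (cflip a r0) \<union> rot ` vec_of_code ` set (cflip b r1) \<union> rot ` vec_of_code ` set (cflip c r2) \<union>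
      rot ` vec_of_code ` set (cflip d r3) \<union> rot ` vec_of_code ` set (cflip e r4)"
    by (simp add: cstate_def rows image_Un Un_assoc)
  also have "\<dots> = vec_of_code ` set (cflip a r1) \<union> vec_of_code ` set (cflip b r2) \<union> vec_of_code ` set (cflip c r3) \<union>
      vec_of_code ` set (cflip d r4) \<union> vec_of_code ` set (cflip e r0)"
    using rot_row[of r0 a] rot_row[of r1 b] rot_row[of r2 c] rot_row[of r3 d] rot_row[of r4 e]
    by (simp add: rows r(2-5)[symmetric] r5)
  also have "\<dots> = vec_of_code ` set (cstate [e, a, b, c, d])"
    by (simp add: cstate_def rows image_Un Un_ac)
  finally show ?thesis .
qed

lemma cstate_uminus: "uminus ` vec_of_code ` set (cstate [a, b, c, d, e]) = vec_of_code ` set (cstate [\<not> a, \<not> b, \<not> c, \<not> d, \<not> e])"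
proof -
  have flip: "uminus ` vec_of_code ` set (cflip b r) = vec_of_code ` set (cflip (\<not> b) r)" for b r
    by (cases b) (simp_all add: image_image)
  have "rows = [rows!0, rows!1, rows!2, rows!3, rows!4]"
    by (simp add: rows_def Let_def)
  then obtain r0 r1 r2 r3 r4 where rows: "rows = [r0, r1, r2, r3, r4]" by blast
  show ?thesis by (simp add: cstate_def rows image_Un flip)
qed

text \<open>\<open>rot\<close> shifts the five choices cyclically and the antipodal map reverses all of them, so that the
four states that have been searched represent all 32.\<close>

lemma connected_states: "induced_connected E600 (vec_of_code ` set (cstate [a, b, c, d, e]))"
proof -
  define P where "P a b c d e = induced_connected E600 (vec_of_code ` set (cstate [a, b, c, d, e]))" for a b c d e
  have base: "P True True True True True" "P False True True True True"
    "P False False True True True" "P False True False True True"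
    unfolding P_def by (intro connected_cconn cconn_states cstate_verts; simp)+
  have rot: "P e a b c d" if "P a b c d e" for a b c d e
    using connected_isometry[OF vert_isometry_rot cstate_verts(1), of "[a, b, c, d, e]"] that
    by (simp add: P_def cstate_rot)
  have neg: "P (\<not> a) (\<not> b) (\<not> c) (\<not> d) (\<not> e)" if "P a b c d e" for a b c d e
    using connected_isometry[OF vert_isometry_uminus cstate_verts(1), of "[a, b, c, d, e]"] that
    by (simp add: P_def cstate_uminus)
  note few = base base[THEN rot] base[THEN rot, THEN rot] base[THEN rot, THEN rot, THEN rot]
    base[THEN rot, THEN rot, THEN rot, THEN rot]
  note many = few[THEN neg, simplified]
  have "P a b c d e"
    by (cases a; cases b; cases c; cases d; cases e) (simp_all only: few many)
  then show ?thesis by (simp add: P_def)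
qed

text \<open>The complement of a state is again a state: it makes the opposite choice in every coset.\<close>

lemma state600_legal: "legal_state verts E600 (state600 s)"
proof -
  have "state600 s \<noteq> {}" "induced_connected E600 (state600 s)" for s
    using connected_states cstate_verts(3) by (simp_all add: state600_cstate)
  moreover have "state600 s \<subseteq> verts" by (auto simp: state600_def)
  ultimately show ?thesis
    unfolding legal_state_def state600_compl by blast
qed

lemma rows_nonadjacent:
  "list_all (\<lambda>r. list_all (\<lambda>c. list_all (\<lambda>c'. cdot c c' \<noteq> (0, 2) \<and> cdot c c' \<noteq> (0, -2)) r) r) rows"
  by code_simp

text \<open>Two vertices of the same 24-cell enclose an angle of at least 60 degrees.  On the chosen halves,
this is a finite check for the inner products \<open>\<phi>/2\<close> and \<open>-\<phi>/2\<close>.\<close>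

lemma same_class_nonadjacent:
  assumes "x \<in> verts" "y \<in> verts" "block_index x mod 5 = block_index y mod 5"
  shows "x \<bullet> y \<noteq> golden / 2"
proof -
  have row: "\<exists>c\<in>set (rows ! (block_index x mod 5)). x = vec_of_code c \<or> x = - vec_of_code c" if x: "x \<in> verts" for x
  proof (cases "block_index x < 5")
    case True
    then show ?thesis using block_index[OF x] by (auto simp: blocks_def nth_append length_blocks)
  next
    case False
    then have "block_index x mod 5 = block_index x - 5" using block_index[OF x] by (auto simp: mod_if)
    moreover have lt: "block_index x - 5 < length rows" using conjunct1[OF block_index[OF x]] unfolding length_blocks by arith
    have "blocks ! block_index x = map (map cneg) rows ! (block_index x - 5)"
      using False by (simp add: blocks_def nth_append length_blocks)
    then have "blocks ! block_index x = map cneg (rows ! (block_index x - 5))" unfolding nth_map[OF lt] .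
    moreover obtain d where "d \<in> set (blocks ! block_index x)" "x = vec_of_code d" using block_index[OF x] by blast
    ultimately have "d \<in> cneg ` set (rows ! (block_index x mod 5))" "x = vec_of_code d"
      by (simp_all only: set_map)
    then obtain c where "c \<in> set (rows ! (block_index x mod 5))" "x = vec_of_code (cneg c)" by blast
    then show ?thesis unfolding vec_of_code_cneg by blast
  qed
  let ?i = "block_index x mod 5"
  obtain c d where cd: "c \<in> set (rows ! ?i)" "x = vec_of_code c \<or> x = - vec_of_code c" "d \<in> set (rows ! ?i)" "y = vec_of_code d \<or> y = - vec_of_code d"
    using row[OF assms(1)] row[OF assms(2)] assms(3) by auto
  have "rows ! ?i \<in> set rows" by (simp add: length_blocks)
  then have "cdot c d \<noteq> (0, 2)" "cdot c d \<noteq> (0, -2)"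
    using rows_nonadjacent cd(1,3) unfolding list_all_iff by blast+
  then have "zphi_val (cdot c d) \<noteq> zphi_val (0, 2)" "zphi_val (cdot c d) \<noteq> zphi_val (0, -2)" by simp_all
  then show ?thesis using cd(2,4) by (auto simp: vec_of_code_inner zphi_val.simps)
qed

theorem legal_system_600: "legal_system verts E600 move600"
proof -
  have sys: "system_of_moves verts E600 move600"
    unfolding system_of_moves_def move_at_def move600_def
    using same_class_nonadjacent by (auto simp: E600_iff)
  interpret Z: comm_group "Z2_power verts" by (rule comm_group_Z2_power)
  have orbit_states: "\<exists>s'. sym_diff A (state600 s) = state600 s'" if "A \<in> generate (Z2_power verts) (move600 ` verts)" for A s
    using that
  proof (induction arbitrary: s rule: generate.induct)
    case one
    show ?case by (auto simp: Z2_power_def)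
  next
    case (incl A)
    then obtain v where v: "A = move600 v" by blast
    show ?case unfolding v state600_move by blast
  next
    case (inv A)
    then obtain v where v: "v \<in> verts" "A = move600 v" by blast
    have "inv\<^bsub>Z2_power verts\<^esub> A = A"
      by (rule Z.inv_equality) (auto simp: Z2_power_def v move600_def)
    then have "sym_diff (inv\<^bsub>Z2_power verts\<^esub> A) (state600 s) = state600 (s(block_index v mod 5 := \<not> s (block_index v mod 5)))"
      by (simp only: v(2) state600_move)
    then show ?case by blast
  next
    case (eng A B)
    obtain s' where "sym_diff B (state600 s) = state600 s'" using eng.IH(2) by blast
    moreover obtain s'' where "sym_diff A (state600 s') = state600 s''" using eng.IH(1) by blast
    moreover have "sym_diff (sym_diff A B) (state600 s) = sym_diff A (sym_diff B (state600 s))" by blast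
    ultimately have "sym_diff (sym_diff A B) (state600 s) = state600 s''" by simp
    then show ?case by (auto simp: Z2_power_def)
  qed
  have "legal_state verts E600 T"
    if T: "T \<in> orbit (moves_group verts move600) (\<lambda>A S. sym_diff A S) (state600 (\<lambda>_. True))" for T
  proof -
    obtain A where "A \<in> generate (Z2_power verts) (move600 ` verts)" "T = sym_diff A (state600 (\<lambda>_. True))"
      using T by (auto simp: orbit_def moves_group_def)
    then obtain s where "T = state600 s" using orbit_states by blast
    then show ?thesis using state600_legal by simp
  qed
  then show ?thesis
    unfolding legal_system_def using sys by (intro conjI exI[of _ "state600 (\<lambda>_. True)"]) (auto simp: state600_def)
qed

section \<open>Peak reduction in a Cayley graph\<close>

definition level_edges :: "('g, 'x) monoid_scheme \<Rightarrow> ('a \<Rightarrow> 'g) \<Rightarrow> 'a set \<Rightarrow> ('g \<Rightarrow> int) \<Rightarrow> int \<Rightarrow> int \<Rightarrow> ('g \<times> 'g) set" where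
  "level_edges G \<gamma> V h a b = {(g, \<gamma> v \<otimes>\<^bsub>G\<^esub> g) |g v. g \<in> carrier G \<and> v \<in> V \<and>
     a \<le> h g \<and> h g \<le> b \<and> a \<le> h (\<gamma> v \<otimes>\<^bsub>G\<^esub> g) \<and> h (\<gamma> v \<otimes>\<^bsub>G\<^esub> g) \<le> b}"

lemma level_edges_mono: "a' \<le> a \<Longrightarrow> b \<le> b' \<Longrightarrow> level_edges G \<gamma> V h a b \<subseteq> level_edges G \<gamma> V h a' b'"
  unfolding level_edges_def by fastforce

lemma level_edges_uminus: "level_edges G \<gamma> V (\<lambda>g. - h g) (- b) (- a) = level_edges G \<gamma> V h a b"
  unfolding level_edges_def by auto

lemma level_edgesI:
  "g \<in> carrier G \<Longrightarrow> v \<in> V \<Longrightarrow> a \<le> h g \<Longrightarrow> h g \<le> b \<Longrightarrow> a \<le> h (\<gamma> v \<otimes>\<^bsub>G\<^esub> g) \<Longrightarrow> h (\<gamma> v \<otimes>\<^bsub>G\<^esub> g) \<le> b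
    \<Longrightarrow> (g, \<gamma> v \<otimes>\<^bsub>G\<^esub> g) \<in> level_edges G \<gamma> V h a b"
  unfolding level_edges_def by blast

text \<open>\<open>D g\<close> is the set of generators that lower the height \<open>h\<close> at \<open>g\<close>.  A path that enters and leaves a vertex
\<open>y\<close> of maximal height \<open>b\<close> does so through two elements of \<open>D y\<close>.  These are joined by a chain of adjacent
elements of \<open>D y\<close>, and adjacent generators \<open>p, q\<close> commute, so \<open>p y\<close> and \<open>q y\<close> are joined through
\<open>q p y = p q y\<close> at height \<open>b - 2\<close>.  Following the chain avoids the peak.  Applied to \<open>- h\<close>, the lemma
removes valleys as well.\<close>

lemma peak_reduction:
  fixes G (structure)
  assumes G: "group G" and \<gamma>: "\<And>v. v \<in> V \<Longrightarrow> \<gamma> v \<in> carrier G"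
    and inv: "\<And>v. v \<in> V \<Longrightarrow> \<gamma> v \<otimes> \<gamma> v = \<one>"
    and comm: "\<And>u v. u \<in> V \<Longrightarrow> v \<in> V \<Longrightarrow> {u, v} \<in> E \<Longrightarrow> \<gamma> u \<otimes> \<gamma> v = \<gamma> v \<otimes> \<gamma> u"
    and D: "\<And>g. g \<in> carrier G \<Longrightarrow> D g \<subseteq> V" "\<And>g. g \<in> carrier G \<Longrightarrow> induced_connected E (D g)"
    and h: "\<And>g v. g \<in> carrier G \<Longrightarrow> v \<in> V \<Longrightarrow> h (\<gamma> v \<otimes> g) = (if v \<in> D g then h g - 1 else h g + 1)"
    and D_adj: "\<And>g u v. g \<in> carrier G \<Longrightarrow> u \<in> V \<Longrightarrow> v \<in> V \<Longrightarrow> {u, v} \<in> E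
        \<Longrightarrow> u \<in> D (\<gamma> v \<otimes> g) \<longleftrightarrow> u \<in> D g"
    and ab: "a + 2 \<le> b" and g: "g \<in> carrier G" "h g < b"
    and path: "(g, g') \<in> (level_edges G \<gamma> V h a b)\<^sup>*" and g': "h g' < b"
  shows "(g, g') \<in> (level_edges G \<gamma> V h a (b - 1))\<^sup>*"
proof -
  interpret group G by (rule G)
  let ?r = "level_edges G \<gamma> V h a (b - 1)"
  have undo: "\<gamma> v \<otimes> (\<gamma> v \<otimes> x) = x" if "v \<in> V" "x \<in> carrier G" for v x
    using inv[OF that(1)] that \<gamma> by (simp flip: m_assoc)
  have "x \<in> carrier G \<and> (h x < b \<longrightarrow> (g, x) \<in> ?r\<^sup>*) \<and> (h x = b \<longrightarrow> (\<forall>v\<in>D x. (g, \<gamma> v \<otimes> x) \<in> ?r\<^sup>*))"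
    if "(g, x) \<in> (level_edges G \<gamma> V h a b)\<^sup>*" for x
    using that
  proof (induction rule: rtrancl_induct)
    case base
    then show ?case using g by simp
  next
    case (step x y)
    then obtain u where u: "u \<in> V" and y: "y = \<gamma> u \<otimes> x" and x: "x \<in> carrier G"
      and bounds: "a \<le> h x" "h x \<le> b" "a \<le> h y" "h y \<le> b"
      by (auto simp: level_edges_def)
    have yG: "y \<in> carrier G" using u x y \<gamma> by simp
    have xy: "x = \<gamma> u \<otimes> y" using undo[OF u x] y by simp
    consider "h x < b" "h y < b" | "h x < b" "h y = b" | "h x = b"
      using bounds by linarith
    then show ?case
    proof cases
      case 1
      then have "(x, y) \<in> ?r"
        unfolding y using bounds u x y by (intro level_edgesI) auto
      moreover have "(g, x) \<in> ?r\<^sup>*" using step.IH 1 by blast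
      ultimately show ?thesis using yG 1 by (auto intro: rtrancl_into_rtrancl)
    next
      case 2
      have uD: "u \<in> D y"
        using h[OF yG u] 2 xy by (auto split: if_splits)
      have "(g, \<gamma> v \<otimes> y) \<in> ?r\<^sup>*" if "v \<in> D y" for v
      proof -
        have "(u, v) \<in> {(p, q). p \<in> D y \<and> q \<in> D y \<and> {p, q} \<in> E}\<^sup>*"
          using D(2)[OF yG] uD that unfolding induced_connected_def by blast
        then show ?thesis
        proof (induction rule: rtrancl_induct)
          case base
          then show ?case using step.IH 2 xy by simp
        next
          case (step p q)
          then have pq: "p \<in> D y" "q \<in> D y" "{p, q} \<in> E" "p \<in> V" "q \<in> V"
            using D(1)[OF yG] by auto
          have car: "\<gamma> p \<otimes> y \<in> carrier G" "\<gamma> q \<otimes> y \<in> carrier G"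
            using pq yG \<gamma> by auto
          have hp: "h (\<gamma> p \<otimes> y) = b - 1" "h (\<gamma> q \<otimes> y) = b - 1"
            using h[OF yG] pq 2 by auto
          have "q \<in> D (\<gamma> p \<otimes> y)"
            using D_adj[OF yG \<open>q \<in> V\<close> \<open>p \<in> V\<close>] pq by (simp add: insert_commute)
          then have hq: "h (\<gamma> q \<otimes> (\<gamma> p \<otimes> y)) = b - 2"
            using h[OF car(1) \<open>q \<in> V\<close>] hp by simp
          have swap: "\<gamma> q \<otimes> (\<gamma> p \<otimes> y) = \<gamma> p \<otimes> (\<gamma> q \<otimes> y)"
            using comm[OF \<open>p \<in> V\<close> \<open>q \<in> V\<close> pq(3)] pq yG \<gamma> by (simp flip: m_assoc)
          have 1: "(\<gamma> p \<otimes> y, \<gamma> q \<otimes> (\<gamma> p \<otimes> y)) \<in> ?r"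
            using ab hp hq pq car by (intro level_edgesI) auto
          have "\<gamma> q \<otimes> y = \<gamma> p \<otimes> (\<gamma> q \<otimes> (\<gamma> p \<otimes> y))"
            unfolding swap using undo pq car by simp
          moreover have "(\<gamma> q \<otimes> (\<gamma> p \<otimes> y), \<gamma> p \<otimes> (\<gamma> q \<otimes> (\<gamma> p \<otimes> y))) \<in> ?r"
            using ab hp hq pq car \<gamma> by (intro level_edgesI) (auto simp flip: calculation)
          ultimately have "(\<gamma> q \<otimes> (\<gamma> p \<otimes> y), \<gamma> q \<otimes> y) \<in> ?r" by simp
          then show ?case using step.IH 1 by (meson rtrancl.rtrancl_into_rtrancl)
        qed
      qed
      then show ?thesis using yG 2 by simp
    next
      case 3
      then have "u \<in> D x" "h y = b - 1"
        using h[OF x u] y bounds by (auto split: if_splits)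
      then show ?thesis using step.IH 3 y yG by auto
    qed
  qed
  from this[OF path] g' show ?thesis by simp
qed

section \<open>Legal systems and fibering\<close>

lemma int_subgroup_multiples:
  fixes H :: "int set"
  assumes diff: "\<And>x y. x \<in> H \<Longrightarrow> y \<in> H \<Longrightarrow> x - y \<in> H" and pos: "x \<in> H" "x > 0"
  obtains d where "d > 0" "d \<in> H" "\<And>y. y \<in> H \<Longrightarrow> d dvd y"
proof -
  define n where "n = (LEAST n. n > 0 \<and> int n \<in> H)"
  have ex: "nat x > 0 \<and> int (nat x) \<in> H" using pos by simp
  have n: "n > 0" "int n \<in> H" using LeastI[of "\<lambda>n. n > 0 \<and> int n \<in> H", OF ex] by (auto simp: n_def)
  have least: "n \<le> k" if "k > 0" "int k \<in> H" for k
    unfolding n_def using that by (intro Least_le) simp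
  have zero: "0 \<in> H" using diff[OF n(2) n(2)] by simp
  have neg: "- y \<in> H" if "y \<in> H" for y using diff[OF zero that] by simp
  have mult: "int k * int n \<in> H" for k
  proof (induction k)
    case (Suc k)
    then show ?case using diff[OF Suc neg[OF n(2)]] by (simp add: algebra_simps)
  qed (simp add: zero)
  have mult': "k * int n \<in> H" for k
  proof (cases "k \<ge> 0")
    case True
    then show ?thesis using mult[of "nat k"] by simp
  next
    case False
    then show ?thesis using neg[OF mult[of "nat (- k)"]] by simp
  qed
  have "int n dvd y" if "y \<in> H" for y
  proof (rule ccontr)
    assume "\<not> int n dvd y"
    then have "y mod int n \<noteq> 0" by (metis mod_0_imp_dvd)
    moreover have "y mod int n \<ge> 0" using n(1) by simp
    ultimately have "y mod int n > 0" by linarith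
    moreover have "y mod int n \<in> H"
      using diff[OF that mult'[of "y div int n"]] by (simp add: minus_div_mult_eq_mod)
    moreover have "y mod int n < int n" using n(1) by simp
    ultimately show False using least[of "nat (y mod int n)"] by (simp add: zless_nat_eq_int_zless)
  qed
  then show ?thesis using that[of "int n"] n by simp
qed

text \<open>A generator acts on pairs of a state and a height.  It raises the height if it belongs to
the state and lowers it otherwise; the move contains \<open>v\<close>, so a second application undoes the first.\<close>

definition move_step :: "('a \<Rightarrow> 'a set) \<Rightarrow> 'a \<Rightarrow> 'a set \<times> int \<Rightarrow> 'a set \<times> int" where
  "move_step m v = (\<lambda>(S, n). (sym_diff S (m v), n + (if v \<in> S then 1 else - 1)))"

text \<open>The elements that act trivially on states form a subgroup \<open>H\<close> of finite index, since the moves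
generate a finite elementary abelian group.  On \<open>H\<close> the height is a homomorphism to the integers.
Legality makes the generators in the state, and those outside it, span connected subgraphs,
so peak reduction from above and from below connects the elements of height 0 or 1.  The kernel acts
on this level set with finitely many orbits, which makes it finitely generated.\<close>

lemma fibering:
  fixes G (structure)
  assumes G: "group G" and V: "finite V" and \<gamma>: "\<And>v. v \<in> V \<Longrightarrow> \<gamma> v \<in> carrier G"
    and gen: "carrier G = generate G (\<gamma> ` V)"
    and involution: "\<And>v. v \<in> V \<Longrightarrow> \<gamma> v \<otimes> \<gamma> v = \<one>"
    and comm: "\<And>u v. u \<in> V \<Longrightarrow> v \<in> V \<Longrightarrow> {u, v} \<in> E \<Longrightarrow> \<gamma> u \<otimes> \<gamma> v = \<gamma> v \<otimes> \<gamma> u"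
    and act_one: "act \<one> = id"
    and act_mult: "\<And>x y. x \<in> carrier G \<Longrightarrow> y \<in> carrier G \<Longrightarrow> act (x \<otimes> y) = act x \<circ> act y"
    and act_gen: "\<And>v. v \<in> V \<Longrightarrow> act (\<gamma> v) = move_step m v"
    and legal: "legal_system V E m"
  shows "virtually_algebraically_fibers G"
proof -
  interpret group G by (rule G)
  obtain S0 where S0: "S0 \<subseteq> V" and moves: "system_of_moves V E m"
    and orbit: "\<And>T. T \<in> orbit (moves_group V m) (\<lambda>A S. sym_diff A S) S0 \<Longrightarrow> legal_state V E T"
    using legal unfolding legal_system_def by blast
  have m: "m v \<subseteq> V" "v \<in> m v" "{u, v} \<in> E \<Longrightarrow> u \<notin> m v" if "v \<in> V" for u v
    using moves that unfolding system_of_moves_def move_at_def by auto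
  let ?M = "generate (Z2_power V) (m ` V)"
  define \<mu> where "\<mu> g = fst (act g ({}, 0))" for g
  define c where "c g S = snd (act g (S, 0))" for g S
  have "\<exists>A f. A \<in> ?M \<and> (\<forall>S n. act g (S, n) = (sym_diff S A, n + f S))" if "g \<in> carrier G" for g
    using that unfolding gen
  proof (induction rule: generate.induct)
    case one
    show ?case
      by (intro exI[of _ "{}"] exI[of _ "\<lambda>_. 0"])
        (use generate.one[of "Z2_power V"] in \<open>simp add: act_one Z2_power_def\<close>)
  next
    case (incl x)
    then obtain v where v: "v \<in> V" "x = \<gamma> v" by blast
    then show ?case
      by (intro exI[of _ "m v"] exI[of _ "\<lambda>S. if v \<in> S then 1 else - 1"])
        (auto simp: act_gen move_step_def intro: generate.incl)
  next
    case (inv x)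
    then obtain v where v: "v \<in> V" "x = \<gamma> v" by blast
    then have "inv x = \<gamma> v" using involution \<gamma> by (simp add: inv_equality)
    with v show ?case
      by (intro exI[of _ "m v"] exI[of _ "\<lambda>S. if v \<in> S then 1 else - 1"])
        (auto simp: act_gen move_step_def intro: generate.incl)
  next
    case (eng x y)
    then obtain A f B k where A: "A \<in> ?M" "\<And>S n. act x (S, n) = (sym_diff S A, n + f S)"
      and B: "B \<in> ?M" "\<And>S n. act y (S, n) = (sym_diff S B, n + k S)" by blast
    have "sym_diff A B \<in> ?M"
      using generate.eng[OF A(1) B(1)] by (simp add: Z2_power_def)
    moreover have "act (x \<otimes> y) = act x \<circ> act y"
      using eng gen by (intro act_mult) auto
    moreover have "sym_diff (sym_diff S B) A = sym_diff S (sym_diff A B)" for S by blast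
    ultimately show ?case
      by (intro exI[of _ "sym_diff A B"] exI[of _ "\<lambda>S. k S + f (sym_diff S B)"]) (simp add: A B)
  qed
  note act_ex = this
  have act_form: "(\<forall>S n. act g (S, n) = (sym_diff S (\<mu> g), n + c g S)) \<and> \<mu> g \<in> ?M" if g: "g \<in> carrier G" for g
  proof -
    obtain A f where A: "A \<in> ?M" "\<And>S n. act g (S, n) = (sym_diff S A, n + f S)"
      using act_ex[OF g] by blast
    then have "\<mu> g = A" "c g S = f S" for S by (simp_all add: \<mu>_def c_def)
    with A show ?thesis by simp
  qed
  then have act: "\<And>g S n. g \<in> carrier G \<Longrightarrow> act g (S, n) = (sym_diff S (\<mu> g), n + c g S)"
    and \<mu>_M: "\<And>g. g \<in> carrier G \<Longrightarrow> \<mu> g \<in> ?M"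
    by blast+
  have M_V: "?M \<subseteq> Pow V"
    using group.generate_in_carrier[OF comm_group.axioms(2)[OF comm_group_Z2_power], of "m ` V" V] m(1)
    by (auto simp: Z2_power_def)
  have \<mu>_V: "\<mu> g \<subseteq> V" if "g \<in> carrier G" for g
    using \<mu>_M[OF that] M_V by blast
  have act2: "act (x \<otimes> y) (S, n) = (sym_diff (sym_diff S (\<mu> y)) (\<mu> x), n + c y S + c x (sym_diff S (\<mu> y)))"
    if "x \<in> carrier G" "y \<in> carrier G" for x y S n
    using act act_mult that by simp
  have \<mu>_mult: "\<mu> (x \<otimes> y) = sym_diff (\<mu> x) (\<mu> y)" if "x \<in> carrier G" "y \<in> carrier G" for x y
    using act2[OF that, of "{}" 0] unfolding \<mu>_def[of "x \<otimes> y"] by auto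
  have c_mult: "c (x \<otimes> y) S = c y S + c x (sym_diff S (\<mu> y))" if "x \<in> carrier G" "y \<in> carrier G" for x y S
    using act2[OF that, of S 0] unfolding c_def[of "x \<otimes> y"] by simp
  have \<mu>_one: "\<mu> \<one> = {}" and c_one: "c \<one> S = 0" for S
    by (simp_all add: \<mu>_def c_def act_one)
  have \<mu>_gen: "\<mu> (\<gamma> v) = m v" and c_gen: "c (\<gamma> v) S = (if v \<in> S then 1 else - 1)" if "v \<in> V" for v S
    using that by (simp_all add: \<mu>_def c_def act_gen move_step_def)
  define \<sigma> where "\<sigma> g = sym_diff S0 (\<mu> g)" for g
  define h where "h g = c g S0" for g
  have \<sigma>_legal: "legal_state V E (\<sigma> g)" if "g \<in> carrier G" for g
  proof (rule orbit)
    have "\<sigma> g = sym_diff (\<mu> g) S0" by (auto simp: \<sigma>_def)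
    then show "\<sigma> g \<in> Group_Action.orbit (moves_group V m) (\<lambda>A S. sym_diff A S) S0"
      using \<mu>_M[OF that] by (auto simp: orbit_def moves_group_def)
  qed
  have \<sigma>_V: "\<sigma> g \<subseteq> V" if "g \<in> carrier G" for g
    using \<sigma>_legal[OF that] by (simp add: legal_state_def)
  have \<sigma>_step: "\<sigma> (\<gamma> v \<otimes> g) = sym_diff (\<sigma> g) (m v)" if "v \<in> V" "g \<in> carrier G" for v g
    using that \<gamma> by (auto simp: \<sigma>_def \<mu>_mult \<mu>_gen)
  have h_step: "h (\<gamma> v \<otimes> g) = (if v \<in> \<sigma> g then h g + 1 else h g - 1)" if "v \<in> V" "g \<in> carrier G" for v g
    using that \<gamma> by (simp add: \<sigma>_def h_def c_mult c_gen)
  have \<sigma>_adj: "u \<in> \<sigma> (\<gamma> v \<otimes> g) \<longleftrightarrow> u \<in> \<sigma> g" if "g \<in> carrier G" "u \<in> V" "v \<in> V" "{u, v} \<in> E" for g u v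
    using m(3)[of v u] that \<sigma>_step by auto
  let ?r = "level_edges G \<gamma> V h"

  \<comment> \<open>The state consists of the generators that raise the height, its complement of those that lower it.\<close>
  have down: "(g, g') \<in> (?r a (b - 1))\<^sup>*"
    if "a + 2 \<le> b" "g \<in> carrier G" "h g < b" "(g, g') \<in> (?r a b)\<^sup>*" "h g' < b" for a b g g'
  proof (rule peak_reduction[where E = E and D = "\<lambda>g. V - \<sigma> g", OF G \<gamma> involution comm _ _ _ _ that])
    show "induced_connected E (V - \<sigma> g)" if "g \<in> carrier G" for g
      using \<sigma>_legal[OF that] by (simp add: legal_state_def)
  qed (auto simp: h_step \<sigma>_adj)
  have up: "(g, g') \<in> (?r (a + 1) b)\<^sup>*"
    if "a + 2 \<le> b" "g \<in> carrier G" "a < h g" "(g, g') \<in> (?r a b)\<^sup>*" "a < h g'" for a b g g'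
  proof -
    have "(g, g') \<in> (level_edges G \<gamma> V (\<lambda>g. - h g) (- b) (- a - 1))\<^sup>*"
    proof (rule peak_reduction[where E = E and D = \<sigma>, OF G \<gamma> involution comm])
      show "induced_connected E (\<sigma> g)" if "g \<in> carrier G" for g
        using \<sigma>_legal[OF that] by (simp add: legal_state_def)
      show "(g, g') \<in> (level_edges G \<gamma> V (\<lambda>g. - h g) (- b) (- a))\<^sup>*"
        using that by (simp add: level_edges_uminus)
    qed (use that in \<open>auto simp: h_step \<sigma>_adj dest: \<sigma>_V\<close>)
    then show ?thesis
      using level_edges_uminus[of G \<gamma> V h b "a + 1"] by simp
  qed
  have shrink_up: "(g, g') \<in> (?r a 1)\<^sup>*"
    if "g \<in> carrier G" "h g \<in> {0, 1}" "h g' \<in> {0, 1}" "a \<le> 0" "(g, g') \<in> (?r a (1 + int k))\<^sup>*" for g g' a k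
    using that(5)
  proof (induction k)
    case (Suc k)
    have "(g, g') \<in> (?r a (1 + int (Suc k) - 1))\<^sup>*"
      by (rule down) (use that Suc.prems in auto)
    then show ?case using Suc.IH by simp
  qed simp
  have shrink_down: "(g, g') \<in> (?r 0 1)\<^sup>*"
    if "g \<in> carrier G" "h g \<in> {0, 1}" "h g' \<in> {0, 1}" "(g, g') \<in> (?r (- int k) 1)\<^sup>*" for g g' k
    using that(4)
  proof (induction k)
    case (Suc k)
    have "(g, g') \<in> (?r (- int (Suc k) + 1) 1)\<^sup>*"
      by (rule up) (use that Suc.prems in auto)
    then show ?case using Suc.IH by simp
  qed simp
  have edge_path: "\<exists>k. (x, \<gamma> v \<otimes> x) \<in> (?r (- int k) (1 + int k))\<^sup>*" if "v \<in> V" "x \<in> carrier G" for v x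
  proof -
    define k where "k = nat \<bar>h x\<bar> + 1"
    have "(x, \<gamma> v \<otimes> x) \<in> ?r (- int k) (1 + int k)"
      using that by (intro level_edgesI) (auto simp: h_step k_def)
    then show ?thesis by blast
  qed
  have bounded_path: "\<forall>x\<in>carrier G. \<exists>k. (x, g \<otimes> x) \<in> (?r (- int k) (1 + int k))\<^sup>*"
    if "g \<in> generate G (\<gamma> ` V)" for g
    using that
  proof (induction rule: generate.induct)
    case one
    then show ?case by auto
  next
    case (incl y)
    then obtain v where v: "v \<in> V" "y = \<gamma> v" by blast
    show ?case
    proof
      fix x assume x: "x \<in> carrier G"
      show "\<exists>k. (x, y \<otimes> x) \<in> (?r (- int k) (1 + int k))\<^sup>*"
        using edge_path[OF v(1) x] v(2) by simp
    qed
  next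
    case (inv y)
    then obtain v where v: "v \<in> V" "y = \<gamma> v" by blast
    then have "inv y = \<gamma> v" using involution \<gamma> by (simp add: inv_equality)
    show ?case
    proof
      fix x assume x: "x \<in> carrier G"
      show "\<exists>k. (x, inv y \<otimes> x) \<in> (?r (- int k) (1 + int k))\<^sup>*"
        using edge_path[OF v(1) x] \<open>inv y = \<gamma> v\<close> by simp
    qed
  next
    case (eng y z)
    show ?case
    proof
      fix x assume x: "x \<in> carrier G"
      have yz: "y \<in> carrier G" "z \<in> carrier G" using eng.hyps gen by auto
      obtain k where k: "(x, z \<otimes> x) \<in> (?r (- int k) (1 + int k))\<^sup>*"
        using eng.IH(2) x by blast
      obtain l where l: "(z \<otimes> x, y \<otimes> (z \<otimes> x)) \<in> (?r (- int l) (1 + int l))\<^sup>*"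
        using eng.IH(1) x yz by blast
      let ?n = "max k l"
      have "?r (- int k) (1 + int k) \<subseteq> ?r (- int ?n) (1 + int ?n)"
        "?r (- int l) (1 + int l) \<subseteq> ?r (- int ?n) (1 + int ?n)"
        by (intro level_edges_mono; simp)+
      then have "(x, z \<otimes> x) \<in> (?r (- int ?n) (1 + int ?n))\<^sup>*"
        "(z \<otimes> x, y \<otimes> (z \<otimes> x)) \<in> (?r (- int ?n) (1 + int ?n))\<^sup>*"
        using k l rtrancl_mono by blast+
      then have "(x, y \<otimes> (z \<otimes> x)) \<in> (?r (- int ?n) (1 + int ?n))\<^sup>*"
        by (rule rtrancl_trans)
      then show "\<exists>k. (x, y \<otimes> z \<otimes> x) \<in> (?r (- int k) (1 + int k))\<^sup>*"
        using yz x by (auto simp: m_assoc)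
    qed
  qed
  have level_path: "(\<one>, g) \<in> (?r 0 1)\<^sup>*" if g: "g \<in> carrier G" "h g \<in> {0, 1}" for g
  proof -
    have h1: "h \<one> = 0" by (simp add: h_def c_one)
    have "g \<in> generate G (\<gamma> ` V)" using g(1) gen by simp
    then obtain k where "(\<one>, g \<otimes> \<one>) \<in> (?r (- int k) (1 + int k))\<^sup>*"
      using bounded_path one_closed by blast
    then have "(\<one>, g) \<in> (?r (- int k) (1 + int k))\<^sup>*"
      using g(1) by simp
    then have "(\<one>, g) \<in> (?r (- int k) 1)\<^sup>*"
      using g h1 by (intro shrink_up) auto
    then show ?thesis using g h1 by (intro shrink_down) auto
  qed

  \<comment> \<open>States change by symmetric difference, so the kernel of the action is the stabiliser of any one state.\<close>
  define H where "H = {g \<in> carrier G. \<mu> g = {}}"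
  have \<mu>_inv: "\<mu> (inv g) = \<mu> g" if "g \<in> carrier G" for g
  proof -
    have "sym_diff (\<mu> (inv g)) (\<mu> g) = {}" using \<mu>_mult[of "inv g" g] that by (simp add: \<mu>_one)
    then show ?thesis by blast
  qed
  have subH: "subgroup H G"
    by (rule subgroupI) (auto simp: H_def \<mu>_one \<mu>_inv \<mu>_mult intro: exI[of _ \<one>])
  have coset: "H #> g = {x \<in> carrier G. \<mu> x = \<mu> g}" if g: "g \<in> carrier G" for g
  proof (intro equalityI subsetI)
    fix x assume "x \<in> H #> g"
    then show "x \<in> {x \<in> carrier G. \<mu> x = \<mu> g}"
      using g by (auto simp: r_coset_def H_def \<mu>_mult)
  next
    fix x assume x: "x \<in> {x \<in> carrier G. \<mu> x = \<mu> g}"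
    then have "x \<otimes> inv g \<in> H" using g by (auto simp: H_def \<mu>_mult \<mu>_inv)
    moreover have "x = (x \<otimes> inv g) \<otimes> g" using x g by (simp add: m_assoc)
    ultimately show "x \<in> H #> g" unfolding r_coset_def by blast
  qed
  have "rcosets H \<subseteq> (\<lambda>A. {x \<in> carrier G. \<mu> x = A}) ` Pow V"
    using coset \<mu>_V by (auto simp: RCOSETS_def)
  then have index: "finite (rcosets H)"
    using V by (meson finite_Pow_iff finite_imageI finite_subset)
  have h_mult: "h (x \<otimes> y) = h x + h y" if "x \<in> carrier G" "y \<in> H" for x y
    using that by (simp add: h_def c_mult H_def)
  have h_one: "h \<one> = 0" by (simp add: h_def c_one)
  have quot: "inv x \<otimes> y \<in> H \<and> h (inv x \<otimes> y) = h y - h x"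
    if "x \<in> carrier G" "y \<in> carrier G" "\<mu> x = \<mu> y" for x y
  proof
    show k: "inv x \<otimes> y \<in> H" using that by (simp add: H_def \<mu>_mult \<mu>_inv)
    have "h y = h (x \<otimes> (inv x \<otimes> y))" using that by (simp flip: m_assoc)
    also have "\<dots> = h x + h (inv x \<otimes> y)" using that k by (simp add: h_mult)
    finally show "h (inv x \<otimes> y) = h y - h x" by simp
  qed
  have H_car: "x \<in> carrier G" if "x \<in> H" for x using that by (simp add: H_def)
  have H_\<mu>: "\<mu> x = {}" if "x \<in> H" for x using that by (simp add: H_def)
  have one_H: "\<one> \<in> H" using subH by (rule subgroup.one_closed)

  \<comment> \<open>States are nonempty, so the height can be raised for ever while only finitely many states occur;
    two elements with the same state and different heights differ by an element of positive height.\<close>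
  have climb: "\<exists>g\<in>carrier G. h g = int n" for n
  proof (induction n)
    case 0
    then show ?case using h_one by auto
  next
    case (Suc n)
    then obtain g where g: "g \<in> carrier G" "h g = int n" by blast
    obtain v where v: "v \<in> \<sigma> g" using \<sigma>_legal[OF g(1)] by (auto simp: legal_state_def)
    then have "v \<in> V" using \<sigma>_V[OF g(1)] by blast
    then have "h (\<gamma> v \<otimes> g) = int (Suc n)" "\<gamma> v \<otimes> g \<in> carrier G"
      using g v \<gamma> by (simp_all add: h_step)
    then show ?case by blast
  qed
  then obtain r where r: "\<And>n. r n \<in> carrier G" "\<And>n. h (r n) = int n" by metis
  have "\<not> inj (\<lambda>n. \<mu> (r n))"
  proof
    assume "inj (\<lambda>n. \<mu> (r n))"
    moreover have "range (\<lambda>n. \<mu> (r n)) \<subseteq> Pow V" using r \<mu>_V by blast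
    ultimately show False using V by (meson finite_Pow_iff finite_subset finite_imageD infinite_UNIV_nat)
  qed
  then obtain i j where "\<mu> (r i) = \<mu> (r j)" "i < j"
    unfolding inj_def by (metis nat_neq_iff)
  then have "inv (r i) \<otimes> r j \<in> H" "h (inv (r i) \<otimes> r j) > 0"
    using quot[of "r i" "r j"] r by auto
  then have pos: "h (inv (r i) \<otimes> r j) \<in> h ` H" "h (inv (r i) \<otimes> r j) > 0" by auto
  have diff: "x - y \<in> h ` H" if "x \<in> h ` H" "y \<in> h ` H" for x y
  proof -
    obtain p q where "p \<in> H" "x = h p" "q \<in> H" "y = h q" using \<open>x \<in> h ` H\<close> \<open>y \<in> h ` H\<close> by blast
    then show ?thesis using quot[of q p] H_car H_\<mu> by (metis imageI)
  qed
  obtain d where d: "d > 0" "d \<in> h ` H" "\<And>y. y \<in> h ` H \<Longrightarrow> d dvd y"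
    using int_subgroup_multiples[OF diff pos] by metis
  define f where "f g = h g div d" for g
  have dvd: "d dvd h g" if "g \<in> H" for g using d(3) that by blast
  have f_epi: "f \<in> epi (G\<lparr>carrier := H\<rparr>) integer_group"
  proof -
    have "f (x \<otimes> y) = f x + f y" if "x \<in> H" "y \<in> H" for x y
      using that dvd H_car by (simp add: f_def h_mult div_plus_div_distrib_dvd_left)
    then have hom: "f \<in> hom (G\<lparr>carrier := H\<rparr>) integer_group"
      by (simp add: hom_def integer_group_def)
    have mult_ex: "\<exists>g\<in>H. h g = int n * d" for n
    proof (induction n)
      case 0
      then show ?case using one_H h_one by auto
    next
      case (Suc n)
      then obtain g p where "g \<in> H" "h g = int n * d" "p \<in> H" "h p = d" using d(2) by auto
      then have "g \<otimes> p \<in> H" "h (g \<otimes> p) = int (Suc n) * d"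
        using subH H_car by (auto simp: h_mult subgroup.m_closed algebra_simps)
      then show ?case by blast
    qed
    have "z \<in> f ` H" for z
    proof -
      obtain g p where g: "g \<in> H" "h g = int (nat z) * d" and p: "p \<in> H" "h p = int (nat (- z)) * d"
        using mult_ex by metis
      have "inv p \<otimes> g \<in> H" "h (inv p \<otimes> g) = h g - h p"
        using quot[of p g] g p H_car H_\<mu> by auto
      moreover have "h g - h p = z * d"
        unfolding g p by (simp flip: left_diff_distrib)
      ultimately have "inv p \<otimes> g \<in> H" "f (inv p \<otimes> g) = z" using d(1) by (simp_all add: f_def)
      then show ?thesis by blast
    qed
    then have "f ` H = UNIV" by blast
    with hom show ?thesis by (simp add: epi_def)
  qed
  define N where "N = {g \<in> H. h g = 0}"
  have kernel: "kernel (G\<lparr>carrier := H\<rparr>) integer_group f = N"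
    using dvd d(1) by (auto simp: kernel_def N_def f_def dvd_div_eq_0_iff)
  have N_car: "x \<in> carrier G" if "x \<in> N" for x using that by (simp add: N_def H_def)
  have subN: "subgroup N G"
  proof (rule subgroupI)
    show "inv x \<in> N" if "x \<in> N" for x
      using that quot[of x \<one>] H_car H_\<mu> h_one by (auto simp: N_def \<mu>_one)
  qed (use subH one_H h_one H_car in \<open>auto simp: N_def h_mult subgroup.m_closed\<close>)

  \<comment> \<open>Each pair of a state and a height has a fixed representative, the neutral element for the initial
    pair.  Along a path in the level set, the kernel component \<open>\<nu>\<close> changes by a quotient of neighbouring
    representatives, and there are finitely many of these.\<close>
  define R where "R A e = (if A = {} \<and> e = 0 then \<one> else SOME x. x \<in> carrier G \<and> \<mu> x = A \<and> h x = e)" for A and e :: int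
  have R: "R (\<mu> g) (h g) \<in> carrier G \<and> \<mu> (R (\<mu> g) (h g)) = \<mu> g \<and> h (R (\<mu> g) (h g)) = h g"
    if g: "g \<in> carrier G" for g
    using someI[of "\<lambda>x. x \<in> carrier G \<and> \<mu> x = \<mu> g \<and> h x = h g" g] g by (simp add: R_def \<mu>_one h_one)
  define rep where "rep g = R (\<mu> g) (h g)" for g
  have rep: "rep g \<in> carrier G" "\<mu> (rep g) = \<mu> g" "h (rep g) = h g" if "g \<in> carrier G" for g
    using R[OF that] by (simp_all add: rep_def)
  define \<nu> where "\<nu> g = inv (rep g) \<otimes> g" for g
  have \<nu>_N: "\<nu> g \<in> N" if "g \<in> carrier G" for g
    using quot[of "rep g" g] rep[OF that] that by (simp add: \<nu>_def N_def)
  have \<nu>_id: "\<nu> g = g" if "g \<in> N" for g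
    using that by (simp add: \<nu>_def rep_def R_def N_def H_def)
  define reps where "reps = (\<lambda>(A, e). R A e) ` (Pow V \<times> {0, 1})"
  define K where "K = N \<inter> (\<lambda>(p, q, v). inv p \<otimes> (\<gamma> v \<otimes> q)) ` (reps \<times> reps \<times> V)"
  have finK: "finite K"
    unfolding K_def reps_def using V
    by (intro finite_Int disjI2 finite_imageI finite_cartesian_product) simp_all
  have rep_reps: "rep g \<in> reps" if "g \<in> carrier G" "h g \<in> {0, 1}" for g
    using that \<mu>_V[OF that(1)] unfolding reps_def rep_def by blast
  have K_car: "K \<subseteq> carrier G" using N_car by (auto simp: K_def)
  have *: "g \<in> carrier G \<and> \<nu> g \<in> generate G K" if "(\<one>, g) \<in> (?r 0 1)\<^sup>*" for g
    using that
  proof (induction rule: rtrancl_induct)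
    case base
    then show ?case using \<nu>_id one_H h_one by (simp add: N_def generate.one)
  next
    case (step x y)
    from step.hyps(2) obtain v where v: "v \<in> V" "y = \<gamma> v \<otimes> x" and x: "x \<in> carrier G"
      and bounds: "0 \<le> h x" "h x \<le> 1" "0 \<le> h y" "h y \<le> 1"
      unfolding level_edges_def by blast
    then have hx: "h x \<in> {0, 1}" "h y \<in> {0, 1}" by auto
    have y: "y \<in> carrier G" using v x \<gamma> by simp
    let ?k = "inv (rep y) \<otimes> (\<gamma> v \<otimes> rep x)"
    have x_eq: "rep x \<otimes> \<nu> x = x"
      using x rep by (simp add: \<nu>_def flip: m_assoc)
    have "?k \<otimes> \<nu> x = inv (rep y) \<otimes> (\<gamma> v \<otimes> (rep x \<otimes> \<nu> x))"
      using x y v rep \<gamma> N_car[OF \<nu>_N[OF x]] by (simp add: m_assoc)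
    then have eq: "\<nu> y = ?k \<otimes> \<nu> x"
      unfolding x_eq by (simp add: \<nu>_def v)
    then have "?k = \<nu> y \<otimes> inv (\<nu> x)"
      using x y v rep \<gamma> N_car[OF \<nu>_N[OF x]] by (simp add: m_assoc)
    then have "?k \<in> N"
      using \<nu>_N x y subN by (simp add: subgroup.m_closed subgroup.m_inv_closed)
    then have "?k \<in> K"
      unfolding K_def using v(1) rep_reps[OF x hx(1)] rep_reps[OF y hx(2)]
      by (intro IntI image_eqI[of _ _ "(rep y, rep x, v)"]) simp_all
    then show ?case unfolding eq using y step.IH by (auto intro: generate.eng generate.incl)
  qed
  have "N \<subseteq> generate G K"
  proof
    fix g assume g: "g \<in> N"
    then have "(\<one>, g) \<in> (?r 0 1)\<^sup>*" using level_path[of g] N_car by (simp add: N_def)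
    then have "\<nu> g \<in> generate G K" using * by blast
    then show "g \<in> generate G K" using \<nu>_id[OF g] by simp
  qed
  moreover have "generate G K \<subseteq> N"
    by (rule generate_subgroup_incl[OF _ subN]) (simp add: K_def)
  ultimately have "generate G K = N" by blast
  moreover have "K \<subseteq> H" by (auto simp: K_def N_def)
  ultimately show ?thesis
    unfolding virtually_algebraically_fibers_def
    using subH index f_epi finK kernel by blast
qed

section \<open>Homomorphisms from right-angled Coxeter groups\<close>

abbreviation racg_rel :: "'a set \<Rightarrow> 'a set set \<Rightarrow> ('a word \<times> 'a word) set" where
  "racg_rel V E \<equiv> presentation_rel V
     ({([(v, True), (v, True)], []) |v. v \<in> V} \<union>
      {([(u, True), (v, True)], [(v, True), (u, True)]) |u v. {u, v} \<in> E})"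

text \<open>Signs of letters are ignored, because the generators of interest are involutions.\<close>

definition word_prod :: "('g, 'x) monoid_scheme \<Rightarrow> ('a \<Rightarrow> 'g) \<Rightarrow> 'a word \<Rightarrow> 'g" where
  "word_prod G \<gamma> w = foldr (\<lambda>(v, s) g. \<gamma> v \<otimes>\<^bsub>G\<^esub> g) w \<one>\<^bsub>G\<^esub>"

lemma word_prod_simps [simp]:
  "word_prod G \<gamma> [] = \<one>\<^bsub>G\<^esub>"
  "word_prod G \<gamma> ((v, s) # w) = \<gamma> v \<otimes>\<^bsub>G\<^esub> word_prod G \<gamma> w"
  by (simp_all add: word_prod_def)

lemma presentation_rel_lists:
  assumes "(u, w) \<in> presentation_rel X R"
  shows "u \<in> lists (X \<times> UNIV)" "w \<in> lists (X \<times> UNIV)"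
  using assms by induction auto

lemma racg_carrierE:
  assumes "A \<in> carrier (racg V E)"
  obtains w where "w \<in> lists (V \<times> UNIV)" "A = racg_rel V E `` {w}"
  using assms unfolding racg_def presented_group_def partial_object.select_convs
  by (elim quotientE) blast

context group
begin

lemma word_prod_closed:
  assumes "\<And>v. v \<in> V \<Longrightarrow> \<gamma> v \<in> carrier G" "w \<in> lists (V \<times> UNIV)"
  shows "word_prod G \<gamma> w \<in> carrier G"
  using assms(2) by induction (use assms(1) in auto)

lemma word_prod_append:
  assumes "\<And>v. v \<in> V \<Longrightarrow> \<gamma> v \<in> carrier G" "u \<in> lists (V \<times> UNIV)" "w \<in> lists (V \<times> UNIV)"
  shows "word_prod G \<gamma> (u @ w) = word_prod G \<gamma> u \<otimes> word_prod G \<gamma> w"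
  using assms(2)
proof induction
  case Nil
  then show ?case using word_prod_closed[OF assms(1,3)] by simp
next
  case (Cons a u)
  then show ?case
    using assms(1) word_prod_closed[OF assms(1) assms(3)] word_prod_closed[OF assms(1) Cons.hyps(2)]
    by (cases a) (simp add: m_assoc)
qed

lemma word_prod_generates:
  assumes "\<And>v. v \<in> V \<Longrightarrow> \<gamma> v \<in> carrier G" "\<And>v. v \<in> V \<Longrightarrow> \<gamma> v \<otimes> \<gamma> v = \<one>"
  shows "word_prod G \<gamma> ` lists (V \<times> UNIV) = generate G (\<gamma> ` V)"
proof (intro equalityI subsetI)
  fix g assume "g \<in> word_prod G \<gamma> ` lists (V \<times> UNIV)"
  then obtain w where w: "w \<in> lists (V \<times> UNIV)" and g: "g = word_prod G \<gamma> w" by blast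
  from w have "word_prod G \<gamma> w \<in> generate G (\<gamma> ` V)"
  proof induction
    case (Cons a w)
    then show ?case by (cases a) (auto intro: generate.intros)
  qed (simp add: generate.one)
  then show "g \<in> generate G (\<gamma> ` V)" by (simp add: g)
next
  fix g assume "g \<in> generate G (\<gamma> ` V)"
  then show "g \<in> word_prod G \<gamma> ` lists (V \<times> UNIV)"
  proof (induction rule: generate.induct)
    case one
    show ?case by (rule image_eqI[of _ _ "[]"]) simp_all
  next
    case (incl h)
    then obtain v where "v \<in> V" "h = \<gamma> v" by blast
    then show ?case using assms(1) by (intro image_eqI[of _ _ "[(v, True)]"]) simp_all
  next
    case (inv h)
    then obtain v where v: "v \<in> V" "h = \<gamma> v" by blast
    then have "inv h = \<gamma> v" using assms by (simp add: inv_equality)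
    then show ?case using assms(1) v by (intro image_eqI[of _ _ "[(v, True)]"]) simp_all
  next
    case (eng g h)
    then obtain u w where "u \<in> lists (V \<times> UNIV)" "w \<in> lists (V \<times> UNIV)"
      "g = word_prod G \<gamma> u" "h = word_prod G \<gamma> w" by blast
    then show ?case
      using word_prod_append[where \<gamma> = \<gamma> and V = V, OF assms(1)] by (intro image_eqI[of _ _ "u @ w"]) simp_all
  qed
qed

lemma word_prod_racg_rel:
  assumes \<gamma>: "\<And>v. v \<in> V \<Longrightarrow> \<gamma> v \<in> carrier G" "\<And>v. v \<in> V \<Longrightarrow> \<gamma> v \<otimes> \<gamma> v = \<one>"
    and comm: "\<And>u v. u \<in> V \<Longrightarrow> v \<in> V \<Longrightarrow> {u, v} \<in> E \<Longrightarrow> \<gamma> u \<otimes> \<gamma> v = \<gamma> v \<otimes> \<gamma> u"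
    and uw: "(u, w) \<in> racg_rel V E"
  shows "word_prod G \<gamma> u = word_prod G \<gamma> w"
  using uw
proof (induction rule: presentation_rel.induct)
  case (append u u' w w')
  note lists = presentation_rel_lists[OF append.hyps(1)] presentation_rel_lists[OF append.hyps(2)]
  then show ?case using append.IH word_prod_append[where \<gamma> = \<gamma> and V = V, OF \<gamma>(1)] by simp
next
  case (cancel x s)
  then show ?case using \<gamma> by simp
next
  case (relation l r)
  then show ?case using \<gamma> comm by (auto simp del: m_assoc)
qed simp_all

lemma racg_hom:
  assumes \<gamma>: "\<And>v. v \<in> V \<Longrightarrow> \<gamma> v \<in> carrier G" "\<And>v. v \<in> V \<Longrightarrow> \<gamma> v \<otimes> \<gamma> v = \<one>"
    and comm: "\<And>u v. u \<in> V \<Longrightarrow> v \<in> V \<Longrightarrow> {u, v} \<in> E \<Longrightarrow> \<gamma> u \<otimes> \<gamma> v = \<gamma> v \<otimes> \<gamma> u"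
  obtains F where "F \<in> hom (racg V E) G"
    "\<And>w. w \<in> lists (V \<times> UNIV) \<Longrightarrow> F (racg_rel V E `` {w}) = word_prod G \<gamma> w"
proof
  let ?r = "racg_rel V E"
  let ?F = "\<lambda>A. word_prod G \<gamma> (SOME w. w \<in> A)"
  show F: "?F (?r `` {w}) = word_prod G \<gamma> w" if "w \<in> lists (V \<times> UNIV)" for w
  proof -
    have "w \<in> ?r `` {w}" using that by (auto intro: presentation_rel.refl)
    then have "(SOME w'. w' \<in> ?r `` {w}) \<in> ?r `` {w}" by (rule someI)
    then show ?thesis
      using word_prod_racg_rel[OF \<gamma> comm, where u = w and w = "SOME w'. w' \<in> ?r `` {w}"] by simp
  qed
  show "?F \<in> hom (racg V E) G"
  proof (rule homI)
    fix A assume "A \<in> carrier (racg V E)"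
    then obtain a where a: "a \<in> lists (V \<times> UNIV)" "A = ?r `` {a}"
      by (rule racg_carrierE)
    then show "?F A \<in> carrier G" using F word_prod_closed[where \<gamma> = \<gamma> and V = V, OF \<gamma>(1)] by simp
  next
    fix A B assume "A \<in> carrier (racg V E)" "B \<in> carrier (racg V E)"
    then obtain a b where a: "a \<in> lists (V \<times> UNIV)" "A = ?r `` {a}"
      and b: "b \<in> lists (V \<times> UNIV)" "B = ?r `` {b}"
      by (elim racg_carrierE)
    have "A \<otimes>\<^bsub>racg V E\<^esub> B = ?r `` {a @ b}"
      unfolding a(2) b(2) racg_def by (rule presented_group_mult[OF a(1) b(1)])
    then show "?F (A \<otimes>\<^bsub>racg V E\<^esub> B) = ?F A \<otimes> ?F B"
      using F[OF a(1)] F[OF b(1)] F[of "a @ b"] a b word_prod_append[OF \<gamma>(1) a(1) b(1)]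
      by simp
  qed
qed

end

section \<open>Reduced words\<close>

text \<open>The letters of a word that commutations can bring to its front; a word is reduced if no letter
is a descent of what follows it, so that no two equal letters can be brought together and
cancelled.\<close>

fun descents :: "'a set set \<Rightarrow> 'a list \<Rightarrow> 'a set" where
  "descents E [] = {}"
| "descents E (c # t) = insert c {b \<in> descents E t. {b, c} \<in> E}"

fun reduced :: "'a set set \<Rightarrow> 'a list \<Rightarrow> bool" where
  "reduced E [] \<longleftrightarrow> True"
| "reduced E (c # t) \<longleftrightarrow> reduced E t \<and> c \<notin> descents E t"

definition pos_word :: "'a list \<Rightarrow> 'a word" where "pos_word t = map (\<lambda>v. (v, True)) t"

lemma pos_word_lists: "set t \<subseteq> V \<Longrightarrow> pos_word t \<in> lists (V \<times> UNIV)"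
  by (auto simp: pos_word_def)

lemma descents_subset: "descents E t \<subseteq> set t"
  by (induction t) auto

lemma racg_rel_Cons:
  assumes "v \<in> V" "(u, w) \<in> racg_rel V E"
  shows "((v, True) # u, (v, True) # w) \<in> racg_rel V E"
  using presentation_rel.append[OF presentation_rel.refl[of "[(v, True)]"] assms(2)] assms(1) by simp

lemma racg_rel_swap:
  assumes "u \<in> V" "v \<in> V" "{u, v} \<in> E" "w \<in> lists (V \<times> UNIV)"
  shows "((u, True) # (v, True) # w, (v, True) # (u, True) # w) \<in> racg_rel V E"
proof -
  have "([(u, True), (v, True)], [(v, True), (u, True)]) \<in> racg_rel V E"
    using assms by (intro presentation_rel.relation) auto
  from presentation_rel.append[OF this presentation_rel.refl[OF assms(4)]] show ?thesis by simp
qed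

lemma racg_rel_square:
  assumes "v \<in> V" "w \<in> lists (V \<times> UNIV)"
  shows "((v, True) # (v, True) # w, w) \<in> racg_rel V E"
proof -
  have "([(v, True), (v, True)], []) \<in> racg_rel V E"
    using assms by (intro presentation_rel.relation) auto
  from presentation_rel.append[OF this presentation_rel.refl[OF assms(2)]] show ?thesis by simp
qed

lemma descent_to_front:
  assumes "c \<in> descents E t" "set t \<subseteq> V"
  shows "\<exists>t'. length t = Suc (length t') \<and> set t' \<subseteq> V \<and> (pos_word t, pos_word (c # t')) \<in> racg_rel V E"
  using assms
proof (induction t)
  case (Cons d s)
  show ?case
  proof (cases "c = d")
    case True
    then show ?thesis
      using Cons.prems presentation_rel.refl[OF pos_word_lists[OF Cons.prems(2)]] by (intro exI[of _ s]) simp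
  next
    case False
    then have c: "c \<in> descents E s" "{c, d} \<in> E" using Cons.prems by auto
    then obtain s' where s': "length s = Suc (length s')" "set s' \<subseteq> V" "(pos_word s, pos_word (c # s')) \<in> racg_rel V E"
      using Cons by auto
    have cd: "c \<in> V" "d \<in> V" using c descents_subset[of E s] Cons.prems by auto
    have "(pos_word (d # s), pos_word (d # c # s')) \<in> racg_rel V E"
      using racg_rel_Cons[OF cd(2) s'(3)] by (simp add: pos_word_def)
    moreover have "(pos_word (d # c # s'), pos_word (c # d # s')) \<in> racg_rel V E"
      using racg_rel_swap[of d V c E "pos_word s'"] cd c(2) s'(2) pos_word_lists[of s' V] by (simp add: pos_word_def insert_commute)
    ultimately have "(pos_word (d # s), pos_word (c # d # s')) \<in> racg_rel V E"
      by (rule presentation_rel.trans)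
    then show ?thesis using s' cd by (intro exI[of _ "d # s'"]) auto
  qed
qed simp

lemma unreduced_shorten:
  assumes "\<not> reduced E t" "set t \<subseteq> V"
  shows "\<exists>t'. length t' < length t \<and> set t' \<subseteq> V \<and> (pos_word t, pos_word t') \<in> racg_rel V E"
  using assms
proof (induction t)
  case (Cons c t)
  have c: "c \<in> V" "set t \<subseteq> V" using Cons.prems by auto
  show ?case
  proof (cases "reduced E t")
    case True
    then have "c \<in> descents E t" using Cons.prems by simp
    then obtain t' where t': "length t = Suc (length t')" "set t' \<subseteq> V" "(pos_word t, pos_word (c # t')) \<in> racg_rel V E"
      using descent_to_front[OF _ c(2)] by blast
    have "(pos_word (c # t), pos_word (c # c # t')) \<in> racg_rel V E"
      using racg_rel_Cons[OF c(1) t'(3)] by (simp add: pos_word_def)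
    moreover have "(pos_word (c # c # t'), pos_word t') \<in> racg_rel V E"
      using racg_rel_square[OF c(1) pos_word_lists[OF t'(2)]] by (simp add: pos_word_def)
    ultimately have "(pos_word (c # t), pos_word t') \<in> racg_rel V E" by (rule presentation_rel.trans)
    then show ?thesis using t' by (intro exI[of _ t']) auto
  next
    case False
    then obtain t' where t': "length t' < length t" "set t' \<subseteq> V" "(pos_word t, pos_word t') \<in> racg_rel V E"
      using Cons.IH c by blast
    then have "(pos_word (c # t), pos_word (c # t')) \<in> racg_rel V E"
      using racg_rel_Cons[OF c(1) t'(3)] by (simp add: pos_word_def)
    then show ?thesis using t' c by (intro exI[of _ "c # t'"]) auto
  qed
qed simp

lemma reduced_exists:
  assumes "set t \<subseteq> V"
  shows "\<exists>t'. reduced E t' \<and> set t' \<subseteq> V \<and> (pos_word t, pos_word t') \<in> racg_rel V E"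
  using assms
proof (induction "length t" arbitrary: t rule: less_induct)
  case less
  show ?case
  proof (cases "reduced E t")
    case True
    then show ?thesis using less.prems pos_word_lists[of t V] by (blast intro: presentation_rel.refl)
  next
    case False
    then obtain t' where t': "length t' < length t" "set t' \<subseteq> V" "(pos_word t, pos_word t') \<in> racg_rel V E"
      using unreduced_shorten less.prems by blast
    then show ?thesis using less.hyps[OF t'(1,2)] by (blast intro: presentation_rel.trans)
  qed
qed

lemma sign_irrelevant:
  assumes "w \<in> lists (V \<times> UNIV)"
  shows "(w, pos_word (map fst w)) \<in> racg_rel V E"
  using assms
proof induction
  case Nil
  then show ?case by (auto simp: pos_word_def intro: presentation_rel.refl)
next
  case (Cons a w)
  obtain v s where a: "a = (v, s)" by (cases a)
  then have v: "v \<in> V" using Cons by auto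
  have "([(v, s)], [(v, True)]) \<in> racg_rel V E"
  proof (cases s)
    case True
    then show ?thesis using v by (auto intro: presentation_rel.refl)
  next
    case False
    have w: "[(v, False)] \<in> lists (V \<times> UNIV)" using v by simp
    have "([(v, False)], [(v, True), (v, True), (v, False)]) \<in> racg_rel V E"
      using racg_rel_square[OF v w] by (rule presentation_rel.sym)
    moreover have "([(v, True), (v, True), (v, False)], [(v, True)]) \<in> racg_rel V E"
      using presentation_rel.append[OF presentation_rel.refl[of "[(v, True)]" V] presentation_rel.cancel[OF v, of True]] v
      by simp
    ultimately have "([(v, False)], [(v, True)]) \<in> racg_rel V E" by (rule presentation_rel.trans)
    then show ?thesis using False by simp
  qed
  from presentation_rel.append[OF this Cons.IH] show ?case by (simp add: a pos_word_def)
qed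

section \<open>Faithfulness of the reflection representation\<close>

text \<open>Here \<open>y t a\<close> stands for the Lorentz product of the wall \<open>a\<close> with the image of a base point under the
word \<open>t\<close>, and \<open>B\<close> for the Gram matrix of the walls.  The first claim says that the image is still
on the inner side of every wall that is not a descent.  The induction needs control over the
descents as well: the second claim says that a non-adjacent wall \<open>a\<close> compensates for a positive value at
a descent \<open>b\<close>.  Reflecting in \<open>c\<close>, where \<open>y t c < 0\<close>, leaves the values at walls adjacent to \<open>c\<close> fixed,
negates the value at \<open>c\<close>, and lowers all other values by at least \<open>- 2 * y t c\<close>.\<close>

lemma reduced_signs:
  fixes y :: "'a list \<Rightarrow> 'a \<Rightarrow> real" and B :: "'a \<Rightarrow> 'a \<Rightarrow> real"
  assumes y_Nil: "\<And>a. a \<in> V \<Longrightarrow> y [] a < 0"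
    and y_Cons: "\<And>c t a. c \<in> V \<Longrightarrow> a \<in> V \<Longrightarrow> set t \<subseteq> V \<Longrightarrow> y (c # t) a = y t a - 2 * y t c * B c a"
    and diag: "\<And>c. c \<in> V \<Longrightarrow> B c c = 1"
    and adj: "\<And>c a. c \<in> V \<Longrightarrow> a \<in> V \<Longrightarrow> {c, a} \<in> E \<Longrightarrow> B c a = 0"
    and nonadj: "\<And>c a. c \<in> V \<Longrightarrow> a \<in> V \<Longrightarrow> a \<noteq> c \<Longrightarrow> {c, a} \<notin> E \<Longrightarrow> B c a \<le> - 1"
    and t: "reduced E t" "set t \<subseteq> V"
  shows "(\<forall>a\<in>V. a \<notin> descents E t \<longrightarrow> y t a < 0) \<and>
    (\<forall>b\<in>descents E t. \<forall>a\<in>V. a \<noteq> b \<longrightarrow> {a, b} \<notin> E \<longrightarrow> y t a + y t b \<le> 0)"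
  using t
proof (induction t)
  case Nil
  then show ?case using y_Nil by simp
next
  case (Cons c t)
  then have c: "c \<in> V" "c \<notin> descents E t" and t: "set t \<subseteq> V" by auto
  have P: "y t a < 0" if "a \<in> V" "a \<notin> descents E t" for a
    using Cons that by auto
  have Q: "y t a + y t b \<le> 0" if "b \<in> descents E t" "a \<in> V" "a \<noteq> b" "{a, b} \<notin> E" for a b
    using Cons that by auto
  have yc: "y t c < 0" using P c by blast
  have y_adj: "y (c # t) a = y t a" if "a \<in> V" "{c, a} \<in> E" for a
    using y_Cons[OF c(1) that(1) t] adj[OF c(1) that] by simp
  have y_nonadj: "y (c # t) a \<le> y t a + 2 * y t c" if "a \<in> V" "a \<noteq> c" "{c, a} \<notin> E" for a
  proof -
    have "y t c * (- 1) \<le> y t c * B c a"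
      using nonadj[OF c(1) that] yc by (intro mult_left_mono_neg) auto
    then show ?thesis using y_Cons[OF c(1) that(1) t] by linarith
  qed
  have y_c: "y (c # t) c = - y t c"
    using y_Cons[OF c(1) c(1) t] diag[OF c(1)] by simp
  have sum_c: "y t a + y t c \<le> 0" if "a \<in> V" "a \<noteq> c" "{c, a} \<notin> E" for a
  proof (cases "a \<in> descents E t")
    case True
    then show ?thesis using Q[OF True c(1)] that by simp
  next
    case False
    then show ?thesis using P[OF that(1)] yc by simp
  qed
  show ?case
  proof (intro conjI ballI impI)
    fix a assume a: "a \<in> V" "a \<notin> descents E (c # t)"
    show "y (c # t) a < 0"
    proof (cases "{c, a} \<in> E")
      case True
      then have "a \<notin> descents E t" using a by (simp add: insert_commute)
      then show ?thesis using P a y_adj[OF a(1) True] by simp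
    next
      case False
      have "a \<noteq> c" using a by auto
      then show ?thesis using y_nonadj[OF a(1) _ False] sum_c[OF a(1) _ False] yc by simp
    qed
  next
    fix b a assume b: "b \<in> descents E (c # t)" and a: "a \<in> V" "a \<noteq> b" "{a, b} \<notin> E"
    show "y (c # t) a + y (c # t) b \<le> 0"
    proof (cases "b = c")
      case True
      then have "{c, a} \<notin> E" "a \<noteq> c" using a by (auto simp: insert_commute)
      then show ?thesis using y_nonadj[OF a(1)] sum_c[OF a(1)] y_c True by simp
    next
      case False
      then have bt: "b \<in> descents E t" "{c, b} \<in> E" using b by (auto simp: insert_commute)
      then have "b \<in> V" using descents_subset[of E t] t by blast
      have "a \<noteq> c" using a bt(2) by (auto simp: insert_commute)
      then have "y (c # t) a \<le> y t a"
        using y_adj[OF a(1)] y_nonadj[OF a(1)] yc by (cases "{c, a} \<in> E") auto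
      then show ?thesis using Q[OF bt(1) a] y_adj[OF \<open>b \<in> V\<close> bt(2)] by simp
    qed
  qed
qed

section \<open>Reflections in walls\<close>

lemma lorentz_commute: "lorentz x y = lorentz y x"
  by (simp add: lorentz_def inner_commute)

lemma lorentz_linear [simp]:
  "lorentz (x + y) z = lorentz x z + lorentz y z"
  "lorentz (x - y) z = lorentz x z - lorentz y z"
  "lorentz (c *\<^sub>R x) z = c * lorentz x z"
  "lorentz x (y + z) = lorentz x y + lorentz x z"
  "lorentz x (c *\<^sub>R z) = c * lorentz x z"
  by (simp_all add: lorentz_def algebra_simps)

lemma lorentz_sum: "lorentz (\<Sum>i\<in>I. f i) z = (\<Sum>i\<in>I. lorentz (f i) z)"
  by (induction I rule: infinite_finite_induct) (simp_all add: lorentz_def[of 0])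

lemma lorentz_sum_right: "lorentz z (\<Sum>i\<in>I. f i) = (\<Sum>i\<in>I. lorentz z (f i))"
  by (simp only: lorentz_commute[of z] lorentz_sum)

lemma BijGroup_mult_apply:
  assumes "f \<in> carrier (BijGroup S)" "g \<in> carrier (BijGroup S)" "x \<in> S"
  shows "(f \<otimes>\<^bsub>BijGroup S\<^esub> g) x = f (g x)"
  using assms by (simp add: BijGroup_def compose_eq)

lemma BijGroup_closed: "f \<in> carrier (BijGroup S) \<Longrightarrow> x \<in> S \<Longrightarrow> f x \<in> S"
  by (auto simp: BijGroup_def Bij_def bij_betw_def)

lemma BijGroup_eqI:
  assumes "f \<in> carrier (BijGroup S)" "g \<in> carrier (BijGroup S)" "\<And>x. x \<in> S \<Longrightarrow> f x = g x"
  shows "f = g"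
  using assms by (auto simp: BijGroup_def Bij_def intro: extensionalityI)

lemma reflection_square:
  assumes "lorentz e e = 1"
  shows "hyp_reflection e \<otimes>\<^bsub>BijGroup hyp4\<^esub> hyp_reflection e = \<one>\<^bsub>BijGroup hyp4\<^esub>"
proof -
  interpret group "BijGroup hyp4" by (rule group_BijGroup)
  note R = hyp_reflection_Bij[OF assms]
  show ?thesis
  proof (rule BijGroup_eqI)
    fix x :: minkowski assume x: "x \<in> hyp4"
    then show "(hyp_reflection e \<otimes>\<^bsub>BijGroup hyp4\<^esub> hyp_reflection e) x = \<one>\<^bsub>BijGroup hyp4\<^esub> x"
      using BijGroup_closed[OF R x] assms
      by (simp add: BijGroup_mult_apply[OF R R x]) (simp add: hyp_reflection_def BijGroup_def)
  qed (use R in auto)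
qed

lemma reflections_commute:
  assumes e: "lorentz e e = 1" and f: "lorentz f f = 1" and "lorentz e f = 0"
  shows "hyp_reflection e \<otimes>\<^bsub>BijGroup hyp4\<^esub> hyp_reflection f = hyp_reflection f \<otimes>\<^bsub>BijGroup hyp4\<^esub> hyp_reflection e"
proof -
  interpret group "BijGroup hyp4" by (rule group_BijGroup)
  note R = hyp_reflection_Bij[OF e] hyp_reflection_Bij[OF f]
  show ?thesis
  proof (rule BijGroup_eqI)
    fix x :: minkowski assume x: "x \<in> hyp4"
    then show "(hyp_reflection e \<otimes>\<^bsub>BijGroup hyp4\<^esub> hyp_reflection f) x = (hyp_reflection f \<otimes>\<^bsub>BijGroup hyp4\<^esub> hyp_reflection e) x"
      using BijGroup_closed[OF R(1) x] BijGroup_closed[OF R(2) x] assms(3) lorentz_commute[of f e]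
      by (simp add: BijGroup_mult_apply[OF R(1,2) x] BijGroup_mult_apply[OF R(2,1) x])
        (simp add: hyp_reflection_def algebra_simps)
  qed (use R in auto)
qed

text \<open>Surjectivity onto the generated group and the relations are immediate.  For injectivity, every element
has a reduced word, and by \<open>reduced_signs\<close> a nonempty reduced word moves the base point across
the wall of its first letter.\<close>

theorem reflections_racg:
  fixes e :: "'v \<Rightarrow> minkowski"
  assumes unit: "\<And>v. v \<in> V \<Longrightarrow> lorentz (e v) (e v) = 1"
    and adj: "\<And>u v. u \<in> V \<Longrightarrow> v \<in> V \<Longrightarrow> {u, v} \<in> E \<Longrightarrow> lorentz (e u) (e v) = 0"
    and nonadj: "\<And>u v. u \<in> V \<Longrightarrow> v \<in> V \<Longrightarrow> u \<noteq> v \<Longrightarrow> {u, v} \<notin> E \<Longrightarrow> lorentz (e u) (e v) \<le> - 1"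
    and base: "x0 \<in> hyp4" "\<And>v. v \<in> V \<Longrightarrow> lorentz x0 (e v) < 0"
  shows "(BijGroup hyp4)\<lparr>carrier := generate (BijGroup hyp4) ((\<lambda>v. hyp_reflection (e v)) ` V)\<rparr> \<cong> racg V E"
proof -
  let ?B = "BijGroup hyp4" and ?R = "\<lambda>v. hyp_reflection (e v)"
  interpret B: group ?B by (rule group_BijGroup)
  interpret G: group "racg V E" unfolding racg_def by (rule group_presented_group)
  have R: "?R v \<in> carrier ?B" if "v \<in> V" for v using hyp_reflection_Bij[OF unit[OF that]] .
  have RR: "?R v \<otimes>\<^bsub>?B\<^esub> ?R v = \<one>\<^bsub>?B\<^esub>" if "v \<in> V" for v
    using reflection_square[OF unit[OF that]] .
  have RC: "?R u \<otimes>\<^bsub>?B\<^esub> ?R v = ?R v \<otimes>\<^bsub>?B\<^esub> ?R u" if "u \<in> V" "v \<in> V" "{u, v} \<in> E" for u v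
    using reflections_commute unit adj that by blast
  obtain F where F: "F \<in> hom (racg V E) ?B"
    "\<And>w. w \<in> lists (V \<times> UNIV) \<Longrightarrow> F (racg_rel V E `` {w}) = word_prod ?B ?R w"
    using B.racg_hom[where \<gamma> = ?R and V = V and E = E, OF R RR RC] by blast
  define y where "y t a = lorentz (word_prod ?B ?R (pos_word t) x0) (e a)" for t a
  have x0: "word_prod ?B ?R (pos_word []) x0 = x0" using base by (simp add: pos_word_def BijGroup_def)
  have y_Cons: "y (c # t) a = y t a - 2 * y t c * lorentz (e c) (e a)"
    if "c \<in> V" "a \<in> V" "set t \<subseteq> V" for c t a
  proof -
    have w: "word_prod ?B ?R (pos_word t) \<in> carrier ?B"
      using B.word_prod_closed[where \<gamma> = ?R, OF R pos_word_lists[OF that(3)]] by blast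
    have "word_prod ?B ?R (pos_word (c # t)) x0 = ?R c (word_prod ?B ?R (pos_word t) x0)"
      using BijGroup_mult_apply[OF R[OF that(1)] w base(1)] by (simp add: pos_word_def)
    also have "\<dots> = word_prod ?B ?R (pos_word t) x0 - (2 * y t c) *\<^sub>R e c"
      using BijGroup_closed[OF w base(1)] by (simp add: hyp_reflection_def y_def)
    finally show ?thesis by (simp add: y_def)
  qed
  have signs: "y t a < 0" if "reduced E t" "set t \<subseteq> V" "a \<in> V" "a \<notin> descents E t" for t a
    using reduced_signs[where y = y and B = "\<lambda>c a. lorentz (e c) (e a)" and V = V, OF _ y_Cons unit adj _ that(1,2)]
      base x0 nonadj that by (auto simp: y_def)
  have nontrivial: "t = []" if "reduced E t" "set t \<subseteq> V" "word_prod ?B ?R (pos_word t) = \<one>\<^bsub>?B\<^esub>" for t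
  proof (cases t)
    case (Cons c s)
    then have c: "c \<in> V" "reduced E s" "c \<notin> descents E s" "set s \<subseteq> V" using that by auto
    have "y t c = - y s c" using y_Cons[OF c(1,1,4)] unit[OF c(1)] by (simp add: Cons)
    moreover have "y s c < 0" using signs c by blast
    moreover have "y t c = lorentz x0 (e c)" using that(3) base by (simp add: y_def BijGroup_def)
    ultimately show ?thesis using base(2)[OF c(1)] by simp
  qed simp
  have ker: "A = \<one>\<^bsub>racg V E\<^esub>" if car: "A \<in> carrier (racg V E)" and FA: "F A = \<one>\<^bsub>?B\<^esub>" for A
  proof -
    obtain w where w: "w \<in> lists (V \<times> UNIV)" "A = racg_rel V E `` {w}"
      using car by (rule racg_carrierE)
    have "set (map fst w) \<subseteq> V" using w(1) by auto
    then obtain t where t: "reduced E t" "set t \<subseteq> V" "(pos_word (map fst w), pos_word t) \<in> racg_rel V E"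
      using reduced_exists by blast
    have "(w, pos_word t) \<in> racg_rel V E"
      using sign_irrelevant[OF w(1)] t(3) by (rule presentation_rel.trans)
    then have A: "A = racg_rel V E `` {pos_word t}"
      unfolding w(2) by (rule equiv_class_eq[OF equiv_presentation_rel])
    then have "t = []"
      using nontrivial[OF t(1,2)] F(2)[OF pos_word_lists[OF t(2)]] FA by simp
    then show ?thesis by (simp add: A pos_word_def racg_def presented_group_def)
  qed
  interpret F: group_hom "racg V E" ?B F
    by unfold_locales (rule F(1))
  have inj: "inj_on F (carrier (racg V E))"
    unfolding F.inj_on_one_iff using ker by blast
  have "carrier (racg V E) = (\<lambda>w. racg_rel V E `` {w}) ` lists (V \<times> UNIV)"
    unfolding racg_def presented_group_def partial_object.select_convs quotient_def by (rule UNION_singleton_eq_range)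
  then have "F ` carrier (racg V E) = word_prod ?B ?R ` lists (V \<times> UNIV)"
    using F(2) by (simp only: image_image cong: image_cong)
  then have img: "F ` carrier (racg V E) = generate ?B (?R ` V)"
    using B.word_prod_generates[where \<gamma> = ?R and V = V, OF R RR] by simp
  have "F \<in> iso (racg V E) (?B\<lparr>carrier := generate ?B (?R ` V)\<rparr>)"
    using F(1) inj img by (auto simp: iso_def hom_def bij_betw_def)
  then show ?thesis
    using G.iso_sym by (auto simp: is_iso_def)
qed

section \<open>Facets of a hyperbolic polyhedron\<close>

lemma hyp4_lorentz_neg:
  assumes "x \<in> hyp4" "y \<in> hyp4"
  shows "lorentz x y < 0"
proof -
  have less: "norm (fst z) < snd z" if "z \<in> hyp4" for z
  proof (rule power2_less_imp_less)
    have "fst z \<bullet> fst z < snd z * snd z"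
      using that by (simp add: hyp4_def lorentz_def)
    then show "(norm (fst z))\<^sup>2 < (snd z)\<^sup>2"
      by (simp only: power2_norm_eq_inner power2_eq_square[of "snd z"])
    show "0 \<le> snd z" using that by (simp add: hyp4_def)
  qed
  have "fst x \<bullet> fst y \<le> norm (fst x) * norm (fst y)" by (rule norm_cauchy_schwarz)
  also have "\<dots> < snd x * snd y"
    using less[OF assms(1)] less[OF assms(2)] by (intro mult_strict_mono') auto
  finally show ?thesis by (simp add: lorentz_def)
qed

lemma hyp4_normalize:
  assumes "lorentz z z < 0" "snd z > 0"
  obtains c where "c > 0" "c *\<^sub>R z \<in> hyp4"
proof
  let ?c = "1 / sqrt (- lorentz z z)"
  show c: "?c > 0" using assms by simp
  have "?c * ?c = 1 / (- lorentz z z)" using assms(1) by (simp add: real_sqrt_mult_self flip: power2_eq_square add: power_divide)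
  then have "?c * (?c * lorentz z z) = - 1" using assms(1) by (simp add: field_simps)
  then show "?c *\<^sub>R z \<in> hyp4" using c assms by (simp add: hyp4_def)
qed

text \<open>Turns the Lorentz product into the Euclidean one, for which dimensions of hyperplanes are known.\<close>

definition euclidean_dual :: "minkowski \<Rightarrow> minkowski" where "euclidean_dual e = (fst e, - snd e)"

lemma lorentz_dual: "lorentz x e = euclidean_dual e \<bullet> x"
  by (simp add: lorentz_def euclidean_dual_def inner_prod_def inner_commute)

lemma dim_lorentz_hyperplane:
  assumes "lorentz e e = 1"
  shows "dim {x. lorentz x e = 0} = 4"
proof -
  have "euclidean_dual e \<noteq> 0"
    using assms by (auto simp: lorentz_dual)
  then show ?thesis
    using dim_hyperplane[of "euclidean_dual e"] by (simp add: lorentz_dual)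
qed

lemma subspace_lorentz_hyperplane: "subspace {x. lorentz x e = 0}"
  by (simp add: lorentz_dual subspace_hyperplane)

definition polyhedron_of :: "minkowski set \<Rightarrow> minkowski set" where
  "polyhedron_of W = {x \<in> hyp4. \<forall>w\<in>W. lorentz x w \<le> 0}"

lemma tendsto_lorentz_perturb: "((\<lambda>t. lorentz (p + t *\<^sub>R q) w) \<longlongrightarrow> lorentz p w) (at_right 0)"
  by (auto intro!: tendsto_eq_intros)

lemma eventually_timelike:
  assumes "lorentz p p < 0" "snd p > 0"
  shows "\<forall>\<^sub>F t in at_right 0. lorentz (p + t *\<^sub>R q) (p + t *\<^sub>R q) < 0 \<and> snd (p + t *\<^sub>R q) > 0"
proof (rule eventually_conj)
  have "((\<lambda>t. lorentz (p + t *\<^sub>R q) (p + t *\<^sub>R q)) \<longlongrightarrow> lorentz p p) (at_right 0)"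
    by (auto intro!: tendsto_eq_intros)
  then show "\<forall>\<^sub>F t in at_right 0. lorentz (p + t *\<^sub>R q) (p + t *\<^sub>R q) < 0"
    using assms(1) by (rule order_tendstoD(2))
  have "((\<lambda>t. snd (p + t *\<^sub>R q)) \<longlongrightarrow> snd p) (at_right 0)"
    by (auto intro!: tendsto_eq_intros)
  then show "\<forall>\<^sub>F t in at_right 0. snd (p + t *\<^sub>R q) > 0"
    using assms(2) by (rule order_tendstoD(1))
qed

text \<open>Around \<open>p\<close> only the wall \<open>w\<close> is active, so a small perturbation of \<open>p\<close> along any vector of the hyperplane
stays, after rescaling, in the polyhedron.  These perturbations span the hyperplane.\<close>

lemma facet_normal_of_wall:
  assumes W: "finite W" and w: "w \<in> W" "lorentz w w = 1"
    and p: "p \<in> hyp4" "lorentz p w = 0" "\<And>u. u \<in> W \<Longrightarrow> u \<noteq> w \<Longrightarrow> lorentz p u < 0"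
  shows "facet_normal (polyhedron_of W) w"
proof -
  let ?F = "{x \<in> polyhedron_of W. lorentz x w = 0}" and ?H = "{x. lorentz x w = 0}"
  have pF: "p \<in> ?F" using p by (force simp: polyhedron_of_def)
  have "?H \<subseteq> span ?F"
  proof
    fix q assume q: "q \<in> ?H"
    have "\<forall>\<^sub>F t in at_right 0. lorentz (p + t *\<^sub>R q) u < 0" if "u \<in> W" "u \<noteq> w" for u
      using tendsto_lorentz_perturb p(3)[OF that] by (rule order_tendstoD(2))
    then have "\<forall>\<^sub>F t in at_right 0. \<forall>u\<in>W - {w}. lorentz (p + t *\<^sub>R q) u < 0"
      using W by (intro eventually_ball_finite) auto
    moreover have "\<forall>\<^sub>F t in at_right 0. lorentz (p + t *\<^sub>R q) (p + t *\<^sub>R q) < 0 \<and> snd (p + t *\<^sub>R q) > 0"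
      using p(1) by (intro eventually_timelike) (auto simp: hyp4_def)
    moreover have "\<forall>\<^sub>F t in at_right 0. t > (0::real)"
      by (simp add: eventually_at_right_less)
    ultimately have "\<forall>\<^sub>F t in at_right 0. t > 0 \<and> lorentz (p + t *\<^sub>R q) (p + t *\<^sub>R q) < 0 \<and>
        snd (p + t *\<^sub>R q) > 0 \<and> (\<forall>u\<in>W - {w}. lorentz (p + t *\<^sub>R q) u < 0)"
      by eventually_elim auto
    then obtain t where t: "t > 0" "lorentz (p + t *\<^sub>R q) (p + t *\<^sub>R q) < 0"
        "snd (p + t *\<^sub>R q) > 0" "\<forall>u\<in>W - {w}. lorentz (p + t *\<^sub>R q) u < 0"
      using eventually_happens'[OF trivial_limit_at_right_real] by blast
    obtain c where c: "c > 0" "c *\<^sub>R (p + t *\<^sub>R q) \<in> hyp4"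
      using hyp4_normalize[OF t(2,3)] .
    have 0: "lorentz (c *\<^sub>R (p + t *\<^sub>R q)) w = 0" using q p(2) by simp
    have "lorentz (c *\<^sub>R (p + t *\<^sub>R q)) u \<le> 0" if "u \<in> W" for u
    proof (cases "u = w")
      case True
      show ?thesis unfolding True 0 by simp
    next
      case False
      then have "lorentz (p + t *\<^sub>R q) u < 0" using t(4) that by blast
      then show ?thesis unfolding lorentz_linear(3) using c(1) by (simp add: mult_le_0_iff)
    qed
    then have "c *\<^sub>R (p + t *\<^sub>R q) \<in> ?F" using c 0 by (simp add: polyhedron_of_def)
    then have "(1 / c) *\<^sub>R (c *\<^sub>R (p + t *\<^sub>R q)) \<in> span ?F"
      by (intro span_scale span_base)
    then have "p + t *\<^sub>R q \<in> span ?F" using c(1) by simp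
    then have "(1 / t) *\<^sub>R ((p + t *\<^sub>R q) - p) \<in> span ?F"
      by (intro span_scale span_diff[OF _ span_base[OF pF]])
    then show "q \<in> span ?F" using t(1) by simp
  qed
  then have "4 \<le> dim ?F"
    using dim_subset[of ?H "span ?F"] dim_lorentz_hyperplane[OF w(2)] by simp
  moreover have "dim ?F \<le> 4"
    using dim_subset[of ?F ?H] dim_lorentz_hyperplane[OF w(2)] by auto
  ultimately show ?thesis
    using w by (auto simp: facet_normal_def polyhedron_of_def)
qed

text \<open>If the facet lay in none of the walls, then the sum of points of the facet that avoid the single
walls would avoid all of them; it could be pushed beyond the facet without leaving the polyhedron.
So the facet lies in a wall \<open>w\<close>.  As both hyperplanes have the dimension of the facet, they agree
and \<open>e = \<plusminus> w\<close>; the base point decides the sign.\<close>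

lemma wall_of_facet_normal:
  assumes W: "finite W" "W \<noteq> {}" and unit: "\<And>w. w \<in> W \<Longrightarrow> lorentz w w = 1"
    and base: "x0 \<in> hyp4" "\<And>w. w \<in> W \<Longrightarrow> lorentz x0 w < 0"
    and e: "facet_normal (polyhedron_of W) e"
  shows "e \<in> W"
proof -
  let ?P = "polyhedron_of W"
  let ?F = "{x \<in> ?P. lorentz x e = 0}"
  have ee: "lorentz e e = 1" and half: "\<And>x. x \<in> ?P \<Longrightarrow> lorentz x e \<le> 0" and dimF: "dim ?F = 4"
    using e by (auto simp: facet_normal_def)
  have "\<exists>w\<in>W. \<forall>x\<in>?F. lorentz x w = 0"
  proof (rule ccontr)
    assume neg: "\<not> (\<exists>w\<in>W. \<forall>x\<in>?F. lorentz x w = 0)"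
    have "\<exists>x\<in>?F. lorentz x w < 0" if w: "w \<in> W" for w
    proof -
      obtain x where x: "x \<in> ?F" "lorentz x w \<noteq> 0" using neg w by blast
      then have "lorentz x w \<le> 0" using w by (simp add: polyhedron_of_def)
      then show ?thesis using x by (intro bexI[of _ x]) simp_all
    qed
    then have "\<forall>w\<in>W. \<exists>x. x \<in> ?F \<and> lorentz x w < 0" by blast
    from bchoice[OF this] obtain x where x: "\<And>w. w \<in> W \<Longrightarrow> x w \<in> ?F" "\<And>w. w \<in> W \<Longrightarrow> lorentz (x w) w < 0"
      by blast
    have xh: "x w \<in> hyp4" "lorentz (x w) e = 0" if "w \<in> W" for w
      using x(1)[OF that] by (auto simp: polyhedron_of_def)
    have xw: "lorentz (x w) u \<le> 0" if "w \<in> W" "u \<in> W" for w u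
      using x(1)[OF that(1)] that(2) by (auto simp: polyhedron_of_def)
    define s where "s = (\<Sum>w\<in>W. x w)"
    have s_w: "lorentz s u < 0" if "u \<in> W" for u
    proof -
      have "(\<Sum>w\<in>W. lorentz (x w) u) < (\<Sum>w\<in>W. 0)"
      proof (rule sum_strict_mono_ex1[OF W(1)])
        show "\<forall>w\<in>W. lorentz (x w) u \<le> 0" using xw that by blast
        show "\<exists>w\<in>W. lorentz (x w) u < 0" using x(2) that by blast
      qed
      then show ?thesis by (simp add: s_def lorentz_sum)
    qed
    have s_e: "lorentz s e = 0" using xh by (simp add: s_def lorentz_sum)
    have sum_neg: "sum f W < 0" if "\<And>w. w \<in> W \<Longrightarrow> f w < 0" for f :: "minkowski \<Rightarrow> real"
      using sum_strict_mono[OF W, of f "\<lambda>_. 0"] that by simp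
    have "lorentz (x w) s < 0" if "w \<in> W" for w
      unfolding s_def lorentz_sum_right using that xh(1) by (intro sum_neg hyp4_lorentz_neg)
    then have "lorentz s s < 0"
      by (subst (1) s_def) (simp add: lorentz_sum sum_neg)
    moreover have "snd s > 0"
      unfolding s_def snd_sum using W xh by (intro sum_pos) (auto simp: hyp4_def)
    ultimately have "\<forall>\<^sub>F t in at_right 0. lorentz (s + t *\<^sub>R e) (s + t *\<^sub>R e) < 0 \<and> snd (s + t *\<^sub>R e) > 0"
      by (rule eventually_timelike)
    moreover have "\<forall>\<^sub>F t in at_right 0. \<forall>u\<in>W. lorentz (s + t *\<^sub>R e) u < 0"
      using order_tendstoD(2)[OF tendsto_lorentz_perturb s_w] W(1)
      by (intro eventually_ball_finite) auto
    moreover have "\<forall>\<^sub>F t in at_right 0. t > (0::real)"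
      by (simp add: eventually_at_right_less)
    ultimately have "\<forall>\<^sub>F t in at_right 0. t > 0 \<and> lorentz (s + t *\<^sub>R e) (s + t *\<^sub>R e) < 0 \<and>
        snd (s + t *\<^sub>R e) > 0 \<and> (\<forall>u\<in>W. lorentz (s + t *\<^sub>R e) u < 0)"
      by eventually_elim auto
    then obtain t where t: "t > 0" "lorentz (s + t *\<^sub>R e) (s + t *\<^sub>R e) < 0"
        "snd (s + t *\<^sub>R e) > 0" "\<forall>u\<in>W. lorentz (s + t *\<^sub>R e) u < 0"
      using eventually_happens'[OF trivial_limit_at_right_real] by blast
    obtain c where c: "c > 0" "c *\<^sub>R (s + t *\<^sub>R e) \<in> hyp4"
      using hyp4_normalize[OF t(2,3)] .
    have "lorentz (c *\<^sub>R (s + t *\<^sub>R e)) u \<le> 0" if "u \<in> W" for u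
      unfolding lorentz_linear(3) using c(1) t(4) that by (simp add: mult_le_0_iff less_imp_le)
    then have "c *\<^sub>R (s + t *\<^sub>R e) \<in> ?P" using c(2) by (simp add: polyhedron_of_def)
    then have "c * t \<le> 0" using half s_e ee by fastforce
    then show False using c(1) t(1) by (simp add: mult_le_0_iff)
  qed
  then obtain w where w: "w \<in> W" "\<forall>x\<in>?F. lorentz x w = 0" by blast
  have span_eq: "span ?F = {x. lorentz x f = 0}" if "lorentz f f = 1" "\<forall>x\<in>?F. lorentz x f = 0" for f
  proof (rule subspace_dim_equal[OF subspace_span subspace_lorentz_hyperplane])
    show "span ?F \<subseteq> {x. lorentz x f = 0}"
      using that by (intro span_minimal subspace_lorentz_hyperplane) auto
  qed (use dim_lorentz_hyperplane[OF that(1)] dimF in simp)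
  have same: "{x. lorentz x e = 0} = {x. lorentz x w = 0}"
    using span_eq[OF ee] span_eq[OF unit[OF w(1)] w(2)] by auto
  define k where "k = lorentz e w"
  have "lorentz (e - k *\<^sub>R w) w = 0" using unit[OF w(1)] by (simp add: k_def)
  then have "lorentz (e - k *\<^sub>R w) e = 0" using same by blast
  then have kk: "k * k = 1" using ee lorentz_commute[of w e] by (simp add: k_def)
  have ek: "e = k *\<^sub>R w"
  proof -
    \<comment> \<open>Up to a multiple of \<open>w\<close>, every \<open>y\<close> lies in the common hyperplane and so is orthogonal to \<open>e\<close>.\<close>
    have "lorentz y (e - k *\<^sub>R w) = 0" for y
    proof -
      have "lorentz (y - lorentz y w *\<^sub>R w) w = 0" using unit[OF w(1)] by simp
      then have "lorentz (y - lorentz y w *\<^sub>R w) e = 0" using same by blast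
      then show ?thesis using lorentz_commute[of w e]
        by (simp add: lorentz_commute[of y "e - _"] k_def lorentz_commute[of e y] lorentz_commute[of w y])
    qed
    then have "euclidean_dual (e - k *\<^sub>R w) \<bullet> euclidean_dual (e - k *\<^sub>R w) = 0" by (simp add: lorentz_dual)
    then have "euclidean_dual (e - k *\<^sub>R w) = 0" by simp
    then show ?thesis by (simp add: euclidean_dual_def prod_eq_iff)
  qed
  have "x0 \<in> ?P" using base by (auto simp: polyhedron_of_def less_imp_le)
  then have "k * lorentz x0 w \<le> 0" using half[of x0] ek by simp
  then have "k \<ge> 0" using base(2)[OF w(1)] by (simp add: mult_le_0_iff)
  then have "k = 1" using kk by (simp add: square_eq_1_iff)
  then show ?thesis using ek w(1) by simp
qed

text \<open>The foot of the perpendicular from the base point to a wall lies strictly inside all other walls,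
since two different unit vectors have inner product less than 1.\<close>

lemma facet_normals_hyp_cell120:
  fixes V :: "(real^4) set"
  assumes V: "finite V" "V \<noteq> {}" "\<And>v. v \<in> V \<Longrightarrow> norm v = 1" and r: "r > 0"
  shows "{e. facet_normal {x \<in> hyp4. \<forall>v\<in>V. lorentz x (wall r v) \<le> 0} e} = wall r ` V"
proof -
  have P: "{x \<in> hyp4. \<forall>v\<in>V. lorentz x (wall r v) \<le> 0} = polyhedron_of (wall r ` V)"
    by (simp add: polyhedron_of_def)
  have unit: "lorentz w w = 1" if "w \<in> wall r ` V" for w
    using that V(3) lorentz_wall_self by auto
  have base: "(0, 1) \<in> hyp4" by (simp add: hyp4_def lorentz_def)
  have base_neg: "lorentz (0, 1) w < 0" if "w \<in> wall r ` V" for w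
    using that r by (auto simp: lorentz_def wall_def)
  have cs: "cosh r * cosh r = sinh r * sinh r + 1"
    using cosh_square_eq[of r] by (simp add: power2_eq_square)
  have "facet_normal (polyhedron_of (wall r ` V)) w" if "w \<in> wall r ` V" for w
  proof -
    obtain v where v: "v \<in> V" "w = wall r v" using \<open>w \<in> wall r ` V\<close> by blast
    have vv: "v \<bullet> v = 1" using V(3)[OF v(1)] by (simp add: norm_eq_1)
    have foot: "lorentz (sinh r *\<^sub>R v, cosh r) (wall r u) = sinh r * cosh r * (v \<bullet> u - 1)" for u
      by (simp add: lorentz_def wall_def algebra_simps)
    show ?thesis
    proof (rule facet_normal_of_wall[where p = "(sinh r *\<^sub>R v, cosh r)"])
      show "(sinh r *\<^sub>R v, cosh r) \<in> hyp4"
        using cs vv by (simp add: hyp4_def lorentz_def cosh_real_pos)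
      show "lorentz (sinh r *\<^sub>R v, cosh r) w = 0"
        using vv by (simp add: v(2) foot)
      show "lorentz (sinh r *\<^sub>R v, cosh r) w' < 0" if "w' \<in> wall r ` V" "w' \<noteq> w" for w'
      proof -
        obtain u where u: "u \<in> V" "w' = wall r u" "u \<noteq> v" using \<open>w' \<in> wall r ` V\<close> \<open>w' \<noteq> w\<close> v by blast
        have "u \<bullet> u = 1" using V(3)[OF u(1)] by (simp add: norm_eq_1)
        moreover have "(v - u) \<bullet> (v - u) > 0" using u(3) by simp
        ultimately have "v \<bullet> u < 1" using vv by (simp add: inner_diff inner_commute)
        moreover have "sinh r * cosh r > 0" using r by (simp add: cosh_real_pos)
        ultimately show ?thesis unfolding u(2) foot by (simp add: mult_less_0_iff)
      qed
    qed (use V(1) \<open>w \<in> wall r ` V\<close> unit in auto)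
  qed
  moreover have "e \<in> wall r ` V" if "facet_normal (polyhedron_of (wall r ` V)) e" for e
    by (rule wall_of_facet_normal[OF _ _ unit base base_neg that]) (use V in simp_all)
  ultimately show ?thesis unfolding P by blast
qed

section \<open>The right-angled 120-cell\<close>

lemma racg_word_prod:
  assumes "w \<in> lists (V \<times> UNIV)"
  shows "word_prod (racg V E) (\<lambda>v. racg_rel V E `` {[(v, True)]}) w = racg_rel V E `` {w}"
  using assms
proof induction
  case Nil
  then show ?case by (simp add: racg_def presented_group_def)
next
  case (Cons a w)
  obtain v s where a: "a = (v, s)" by (cases a)
  then have v: "[(v, True)] \<in> lists (V \<times> UNIV)" "[(v, s)] \<in> lists (V \<times> UNIV)" using Cons by auto
  have "([(v, s)], [(v, True)]) \<in> racg_rel V E"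
    using sign_irrelevant[OF v(2)] by (simp add: pos_word_def)
  from presentation_rel.append[OF this presentation_rel.refl[OF Cons.hyps(2)]]
  have "racg_rel V E `` {a # w} = racg_rel V E `` {[(v, True)] @ w}"
    by (intro equiv_class_eq[OF equiv_presentation_rel]) (simp add: a)
  also have "\<dots> = racg_rel V E `` {[(v, True)]} \<otimes>\<^bsub>racg V E\<^esub> racg_rel V E `` {w}"
    unfolding racg_def by (rule presented_group_mult[symmetric, OF v(1) Cons.hyps(2)])
  finally show ?case using Cons.IH by (simp add: a)
qed

text \<open>The action on states and heights exists by the universal property: a generator acts as an
involution because \<open>v\<close> belongs to its own move, and adjacent generators commute because neither belongs
to the move of the other.\<close>

theorem legal_system_fibers:
  fixes G (structure) and V :: "'v set"
  assumes G: "group G" and iso: "G \<cong> racg V E" and V: "finite V" and legal: "legal_system V E m"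
  shows "virtually_algebraically_fibers G"
proof -
  let ?X = "racg V E" and ?c = "\<lambda>v. racg_rel V E `` {[(v, True)]}"
  interpret G: group G by (rule G)
  interpret X: group ?X unfolding racg_def by (rule group_presented_group)
  obtain \<psi> where \<psi>: "\<psi> \<in> iso G ?X" using iso by (auto simp: is_iso_def)
  define F where "F = inv_into (carrier G) \<psi>"
  have F: "F \<in> iso ?X G" unfolding F_def using \<psi> by (rule G.iso_set_sym)
  interpret F: group_hom ?X G F
    by unfold_locales (use F in \<open>simp add: iso_def\<close>)
  have \<psi>F: "\<psi> (F A) = A" if "A \<in> carrier ?X" for A
    using \<psi> that by (auto simp: F_def iso_def bij_betw_def f_inv_into_f)
  have lists: "[(v, s)] \<in> lists (V \<times> UNIV)" if "v \<in> V" for v s using that by simp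
  have c_car: "?c v \<in> carrier ?X" if "v \<in> V" for v
    unfolding racg_def presented_group_def partial_object.select_convs
    by (rule quotientI[OF lists[OF that]])
  have c_mult: "?c u \<otimes>\<^bsub>?X\<^esub> ?c v = racg_rel V E `` {[(u, True), (v, True)]}" if "u \<in> V" "v \<in> V" for u v
    using presented_group_mult[OF lists[OF that(1)] lists[OF that(2)]] by (simp add: racg_def)
  have c_sq: "?c v \<otimes>\<^bsub>?X\<^esub> ?c v = \<one>\<^bsub>?X\<^esub>" if "v \<in> V" for v
  proof -
    have "racg_rel V E `` {[(v, True), (v, True)]} = racg_rel V E `` {[]}"
      by (rule equiv_class_eq[OF equiv_presentation_rel racg_rel_square[OF that]]) simp
    then show ?thesis using c_mult that by (simp add: racg_def presented_group_def)
  qed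
  have c_comm: "?c u \<otimes>\<^bsub>?X\<^esub> ?c v = ?c v \<otimes>\<^bsub>?X\<^esub> ?c u" if "u \<in> V" "v \<in> V" "{u, v} \<in> E" for u v
    unfolding c_mult[OF that(1,2)] c_mult[OF that(2,1)]
    by (rule equiv_class_eq[OF equiv_presentation_rel racg_rel_swap[OF that]]) simp
  have "carrier ?X = (\<lambda>w. racg_rel V E `` {w}) ` lists (V \<times> UNIV)"
    unfolding racg_def presented_group_def partial_object.select_convs quotient_def
    by (rule UNION_singleton_eq_range)
  also have "\<dots> = word_prod ?X ?c ` lists (V \<times> UNIV)"
    by (rule image_cong) (simp_all add: racg_word_prod)
  also have "\<dots> = generate ?X (?c ` V)"
    by (rule X.word_prod_generates) (use c_car c_sq in auto)
  finally have gen: "carrier ?X = generate ?X (?c ` V)" .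
  have m: "v \<in> m v" "{u, v} \<in> E \<Longrightarrow> u \<notin> m v" if "v \<in> V" for u v
    using legal that unfolding legal_system_def system_of_moves_def move_at_def by auto
  let ?B = "BijGroup (UNIV :: ('v set \<times> int) set)"
  interpret B: group ?B by (rule group_BijGroup)
  have B_mult: "f \<otimes>\<^bsub>?B\<^esub> g = f \<circ> g" if "f \<in> carrier ?B" "g \<in> carrier ?B" for f g
    using that by (auto simp: BijGroup_def compose_def fun_eq_iff)
  have B_one: "\<one>\<^bsub>?B\<^esub> = id"
    by (auto simp: BijGroup_def fun_eq_iff)
  have step_step: "move_step m v \<circ> move_step m v = id" if "v \<in> V" for v
    using m(1)[OF that] by (auto simp: move_step_def fun_eq_iff)
  have step_B: "move_step m v \<in> carrier ?B" if "v \<in> V" for v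
    using step_step[OF that] o_bij by (auto simp: BijGroup_def Bij_def)
  have step_comm: "move_step m u \<circ> move_step m v = move_step m v \<circ> move_step m u" if "u \<in> V" "v \<in> V" "{u, v} \<in> E" for u v
    using m(2)[OF that(2), of u] m(2)[OF that(1), of v] that(3)
    by (auto simp: move_step_def fun_eq_iff insert_commute)
  obtain A where A: "A \<in> hom ?X ?B"
    "\<And>w. w \<in> lists (V \<times> UNIV) \<Longrightarrow> A (racg_rel V E `` {w}) = word_prod ?B (move_step m) w"
  proof -
    have sq: "move_step m v \<otimes>\<^bsub>?B\<^esub> move_step m v = \<one>\<^bsub>?B\<^esub>" if "v \<in> V" for v
      unfolding B_mult[OF step_B[OF that] step_B[OF that]] B_one by (rule step_step[OF that])
    have comm: "move_step m u \<otimes>\<^bsub>?B\<^esub> move_step m v = move_step m v \<otimes>\<^bsub>?B\<^esub> move_step m u"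
      if "u \<in> V" "v \<in> V" "{u, v} \<in> E" for u v
      unfolding B_mult[OF step_B[OF that(1)] step_B[OF that(2)]] B_mult[OF step_B[OF that(2)] step_B[OF that(1)]]
      by (rule step_comm[OF that])
    show ?thesis
      by (rule B.racg_hom[where \<gamma> = "move_step m" and V = V and E = E, OF step_B sq comm]) (assumption | rule that)+
  qed
  have \<psi>_hom: "\<psi> \<in> hom G ?X" using \<psi> by (simp add: iso_def)
  have A_car: "A x \<in> carrier ?B" if "x \<in> carrier ?X" for x using A(1) that by (auto simp: hom_def)
  show ?thesis
  proof (rule fibering[where \<gamma> = "\<lambda>v. F (?c v)" and act = "A \<circ> \<psi>", OF G V _ _ _ _ _ _ _ legal])
    show "carrier G = generate G ((\<lambda>v. F (?c v)) ` V)"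
    proof -
      have "generate G ((\<lambda>v. F (?c v)) ` V) = generate G (F ` ?c ` V)" by (simp only: image_image)
      also have "\<dots> = F ` generate ?X (?c ` V)"
        using c_car by (intro F.generate_img) blast
      also have "\<dots> = carrier G"
        using F unfolding gen[symmetric] iso_def bij_betw_def by blast
      finally show ?thesis ..
    qed
    show "F (?c v) \<otimes> F (?c v) = \<one>" if "v \<in> V" for v
      unfolding F.hom_mult[OF c_car c_car, symmetric, OF that that] c_sq[OF that] by (rule F.hom_one)
    show "F (?c u) \<otimes> F (?c v) = F (?c v) \<otimes> F (?c u)" if "u \<in> V" "v \<in> V" "{u, v} \<in> E" for u v
      unfolding F.hom_mult[OF c_car c_car, symmetric, OF that(1,2)] F.hom_mult[OF c_car c_car, symmetric, OF that(2,1)]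
      by (simp only: c_comm[OF that])
    show "(A \<circ> \<psi>) \<one> = id"
      using hom_one[OF \<psi>_hom G X.is_group] hom_one[OF A(1) X.is_group B.is_group] by (simp add: B_one)
    show "(A \<circ> \<psi>) (x \<otimes> y) = (A \<circ> \<psi>) x \<circ> (A \<circ> \<psi>) y" if "x \<in> carrier G" "y \<in> carrier G" for x y
    proof -
      have xy: "\<psi> x \<in> carrier ?X" "\<psi> y \<in> carrier ?X" using \<psi>_hom that by (auto simp: hom_def)
      then show ?thesis
        using hom_mult[OF \<psi>_hom that] hom_mult[OF A(1) xy] B_mult[OF A_car[OF xy(1)] A_car[OF xy(2)]]
        by simp
    qed
    show "(A \<circ> \<psi>) (F (?c v)) = move_step m v" if "v \<in> V" for v
      using \<psi>F[OF c_car[OF that]] A(2)[OF lists[OF that]] step_B[OF that] by simp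
    show "F (?c v) \<in> carrier G" if "v \<in> V" for v using c_car[OF that] by simp
  qed
qed

text \<open>From \<open>(tanh r)\<^sup>2 = \<phi>/2\<close>, the Lorentz product plus 1 is at most \<open>(cosh r)\<^sup>2 (3/2 - \<phi>)\<close>, which is
negative.  The walls of non-adjacent facets are therefore ultraparallel.\<close>

lemma walls_nonadjacent:
  assumes "v \<bullet> w \<le> 1 / 2"
  shows "lorentz (wall right_angled_inradius v) (wall right_angled_inradius w) \<le> - 1"
proof -
  let ?c = "(cosh right_angled_inradius)\<^sup>2" and ?s = "(sinh right_angled_inradius)\<^sup>2"
  have s: "?s = ?c * (golden / 2)"
    using right_angled_inradius(2) by (simp add: tanh_def power_divide field_simps)
  have c: "?c - ?s = 1" using cosh_square_eq[of right_angled_inradius] by simp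
  have pos: "?c \<ge> 0" by simp
  have "lorentz (wall right_angled_inradius v) (wall right_angled_inradius w) = ?c * (v \<bullet> w) - ?s"
    by (simp add: lorentz_def wall_def power2_eq_square)
  also have "\<dots> \<le> ?c * (1 / 2) - ?s"
    using assms by (intro diff_right_mono mult_left_mono) auto
  also have "\<dots> + 1 = ?c * (3 / 2 - golden)"
    using s c by (simp add: algebra_simps)
  finally have "lorentz (wall right_angled_inradius v) (wall right_angled_inradius w) + 1 \<le> ?c * (3 / 2 - golden)"
    by simp
  moreover have "?c * (3 / 2 - golden) \<le> 0"
    using golden_bounds pos by (intro mult_nonneg_nonpos) auto
  ultimately show ?thesis by linarith
qed

lemma reflection_group_racg:
  "reflection_group right_angled_cell120 \<cong> racg verts E600"
proof -
  let ?r = right_angled_inradius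
  have norm1: "norm v = 1" if "v \<in> verts" for v
    using norm_verts[OF that] by (simp add: norm_eq_1)
  have "verts \<noteq> {}" using card_verts by auto
  then have facets: "{e. facet_normal right_angled_cell120 e} = wall ?r ` verts"
    unfolding right_angled_cell120_def hyp_cell120_def polytope_vertices_cell600
    using facet_normals_hyp_cell120[OF finite_verts _ norm1 right_angled_inradius(1)] by blast
  have "{hyp_reflection e |e. facet_normal right_angled_cell120 e} = hyp_reflection ` {e. facet_normal right_angled_cell120 e}"
    by blast
  then have gens: "{hyp_reflection e |e. facet_normal right_angled_cell120 e} = (\<lambda>v. hyp_reflection (wall ?r v)) ` verts"
    unfolding facets image_image .
  show ?thesis
    unfolding reflection_group_def gens
  proof (rule reflections_racg)
    show "lorentz (wall ?r v) (wall ?r v) = 1" if "v \<in> verts" for v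
      using lorentz_wall_self norm1[OF that] .
    show "lorentz (wall ?r u) (wall ?r v) = 0" if "u \<in> verts" "v \<in> verts" "{u, v} \<in> E600" for u v
      using that by (intro adjacent_walls_orthogonal) (simp add: E600_iff)
    show "lorentz (wall ?r u) (wall ?r v) \<le> - 1" if "u \<in> verts" "v \<in> verts" "u \<noteq> v" "{u, v} \<notin> E600" for u v
      using that inner_cases[OF that(1-3)] by (intro walls_nonadjacent) (auto simp: E600_iff)
    show "(0, 1) \<in> hyp4" by (simp add: hyp4_def lorentz_def)
    show "lorentz (0, 1) (wall ?r v) < 0" if "v \<in> verts" for v
      using right_angled_inradius(1) by (simp add: lorentz_def wall_def)
  qed
qed

lemma group_reflection_group: "group (reflection_group right_angled_cell120)"
proof -
  interpret B: group "BijGroup hyp4" by (rule group_BijGroup)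
  have "subgroup (generate (BijGroup hyp4) {hyp_reflection e |e. facet_normal right_angled_cell120 e}) (BijGroup hyp4)"
    by (rule B.generate_is_subgroup) (auto simp: facet_normal_def intro: hyp_reflection_Bij)
  then show ?thesis
    unfolding reflection_group_def by (rule B.subgroup_imp_group)
qed

theorem mainTheorem4:
  shows "has_legal_system (polytope_vertices cell600) (polytope_edges cell600)
    \<and> reflection_group right_angled_cell120
        \<cong> racg (polytope_vertices cell600) (polytope_edges cell600)
    \<and> virtually_algebraically_fibers (reflection_group right_angled_cell120)"
  unfolding polytope_vertices_cell600 has_legal_system_def
  using legal_system_600 reflection_group_racg
    legal_system_fibers[OF group_reflection_group reflection_group_racg finite_verts legal_system_600]
  by blast

end
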